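(* Let $$M=\left\{\rho\in(0,1) : \rho=\sqrt{\tfrac12\left(1+\cos\tfrac{2k\pi}{2m+1}\right)} \text{ for some integers } m\ge 1,\ 1\le k\le m\right\}.$$ A real normed space $X$ with unit sphere $S=\{x\in X:\|x\|=1\}$ is an inner product space if and only if there exists $\rho\in M$ such that $X$ has the following property: for all $u,v\in S$, $$\inf_{t\in[0,1]}\|tu+(1-t)v\|=\rho\ \Longrightarrow\ \tfrac12u+\tfrac12v\in\rho S.$$
   Context: $\rho S=\{\rho x: x\in S\}=\{x\in X:\|x\|=\rho\}$. "$X$ is an inner product space" means that the norm of $X$ is induced by an inner product. *)

theory Defs
  imports "HOL-Analysis.Analysis"
begin

definition inner_product :: "('a::real_vector \<Rightarrow> 'a \<Rightarrow> real) \<Rightarrow> bool" where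
  "inner_product ip \<longleftrightarrow>
     bilinear ip \<and> (\<forall>x y. ip x y = ip y x) \<and> (\<forall>x. x \<noteq> 0 \<longrightarrow> ip x x > 0)"

text \<open>
  The predicate takes the norm as an argument because \<^class>\<open>real_inner\<close> can only be a
  sort constraint: it cannot occur in a proposition about a given normed space.
\<close>

definition induced_by_inner_product :: "('a::real_vector \<Rightarrow> real) \<Rightarrow> bool" where
  "induced_by_inner_product N \<longleftrightarrow>
     (\<exists>ip. inner_product ip \<and> (\<forall>x. N x = sqrt (ip x x)))"

definition M :: "real set" where
  "M = {\<rho> \<in> {0<..<1}. \<exists>m k :: nat. m \<ge> 1 \<and> 1 \<le> k \<and> k \<le> m \<and>
         \<rho> = sqrt (1 / 2 * (1 + cos (2 * real k * pi / (2 * real m + 1))))}"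

end

theory Submission
  imports Defs
begin

text \<open>
  Parallelogram law and homogeneity reduce the claim to a normed plane with unit circle \<open>S\<close>.
  There the hypothesis says: if a chord \<open>u v\<close> of \<open>S\<close> supports \<open>\<rho> S\<close>, its midpoint is \<open>\<rho> s\<close> with
  \<open>s \<in> S\<close> and \<open>v - u\<close> is tangent to \<open>S\<close> at \<open>s\<close>. Hence every quadratic form \<open>Q\<close> satisfies
  \<open>Q v - Q u = Q (v - u, v + u)\<close>, a positive multiple of the derivative of \<open>Q\<close> along \<open>S\<close> at \<open>s\<close>.
  Choose coordinates in which \<open>S\<close> touches the square \<open>[-1, 1]\<^sup>2\<close> at \<open>(1, 0)\<close> and \<open>(0, 1)\<close>, and take the
  largest \<open>e \<le> 1\<close> for which \<open>e x\<^sup>2 + y\<^sup>2\<close> increases along \<open>S\<close> from \<open>(1, 0)\<close> to \<open>(0, 1)\<close> and then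
  decreases to \<open>(-1, 0)\<close>. If \<open>e < 1\<close>, this monotonicity is strict: otherwise the form is constant
  on an arc, and the maps \<open>s \<mapsto> u\<close> and \<open>s \<mapsto> v\<close> carry a longest such arc isometrically to arcs of
  constancy that must overlap up to sign without being equal, which gives a longer one. Strict
  monotonicity survives a small increase of \<open>e\<close>, so \<open>e = 1\<close> and \<open>x\<^sup>2 + y\<^sup>2\<close> is constant on \<open>S\<close>.
\<close>

section \<open>Oriented wedge products and tangent directions\<close>

text \<open>Nothing excludes corners or segments on the unit circle at the outset, so it is
  parametrised by the angle of its outward normal. Selecting the support point by the chord midpoint
  makes the parametrisation continuous, which rules out segments; corners fall to a balance argument
  for the two chord ends. Monotonicity comes without differentiation: an increment along the circle
  lies in the cone of its two bounding tangent directions. Why arcs must overlap: a zero of the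
  slope is a chord with ends on one level. That level cuts a half turn into a high and a low arc, so
  the slope changes sign at the zero unless there is an arc of constancy. A longest such arc cannot
  have slopes of one sign on both sides, hence it contains a multiple of \<open>pi/2\<close>; the
  values \<open>e\<close> and \<open>1\<close> there tell the two kinds of turning points apart, and
  both images of the arc lie on one level. Why strictness survives: at the contact points with the
  square the slope vanishes for every \<open>e\<close>, so compactness fails exactly there. The sign
  near them is read off from the far ends of the chords, where the slope is bounded away from
  zero.\<close>

lemma strict_increase_from_right:
  fixes f :: "real \<Rightarrow> real"
  assumes cont: "continuous_on {p..q} f"
    and right: "\<And>t. p < t \<Longrightarrow> t < q \<Longrightarrow> \<exists>d>0. \<forall>s. t < s \<and> s < t + d \<longrightarrow> f t < f s"
    and "p \<le> s" "s < r" "r \<le> q"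
  shows "f s < f r"
proof -
  have inner_le: "f x \<le> f y" if "p < x" "x \<le> y" "y \<le> q" for x y
  proof -
    have "continuous_on {x..y} f"
      using cont by (rule continuous_on_subset) (use that in auto)
    then have "\<exists>m\<in>{x..y}. \<forall>z\<in>{x..y}. f z \<le> f m"
      using that by (intro continuous_attains_sup) auto
    then obtain m where m: "m \<in> {x..y}" "\<And>z. z \<in> {x..y} \<Longrightarrow> f z \<le> f m" by blast
    \<comment> \<open>A maximum before \<open>y\<close> would be exceeded immediately to its
      right.\<close>
    have "m = y"
    proof (rule ccontr)
      assume "m \<noteq> y"
      then have "p < m" "m < q" "m < y" using m that by auto
      then obtain d where d: "d > 0" "\<And>s. m < s \<and> s < m + d \<Longrightarrow> f m < f s"
        using right by blast
      define z where "z = min (m + d/2) y"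
      have "m < z" "z < m + d" "z \<in> {x..y}" using d \<open>m < y\<close> m by (auto simp: z_def min_def)
      then show False using d(2)[of z] m(2)[of z] by auto
    qed
    then show ?thesis using m(2)[of x] that by auto
  qed
  \<comment> \<open>The growth condition says nothing at \<open>p\<close> itself; continuity carries
    the inequality there.\<close>
  have le: "f x \<le> f y" if "p \<le> x" "x < y" "y \<le> q" for x y
  proof (rule continuous_le_on_closure[of "{x<..<y}" f x "f y"])
    show "continuous_on (closure {x<..<y}) f"
      using cont by (rule continuous_on_subset) (use that in auto)
    show "x \<in> closure {x<..<y}" using that by auto
    show "f z \<le> f y" if "z \<in> {x<..<y}" for z
      using inner_le[of z y] that \<open>p \<le> x\<close> \<open>y \<le> q\<close> by auto
  qed
  define m where "m = (s + r) / 2"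
  have m: "p < m" "m < q" "s < m" "m < r" using assms by (auto simp: m_def)
  then obtain d where d: "d > 0" "\<And>s. m < s \<and> s < m + d \<Longrightarrow> f m < f s"
    using right by blast
  define z where "z = min (m + d/2) r"
  have z: "m < z" "z < m + d" "z \<le> r" using d m by (auto simp: z_def min_def)
  have "f s \<le> f m" using le[of s m] assms m by auto
  also have "f m < f z" using d(2)[of z] z by auto
  also have "f z \<le> f r" using inner_le[of z r] assms m z by auto
  finally show ?thesis .
qed

definition wedge :: "complex \<Rightarrow> complex \<Rightarrow> real" where
  "wedge z w = Re z * Im w - Im z * Re w"

text \<open>The angle is that of the outward normal \<open>(cos t, sin t)\<close>, and
  \<open>dir t\<close> is this normal after a quarter turn, the counterclockwise tangent. Hence
  \<open>wedge z (dir t)\<close> is the inner product of \<open>z\<close> with the normal: a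
  height.\<close>

definition dir :: "real \<Rightarrow> complex" where
  "dir t = Complex (- sin t) (cos t)"

lemma dir_simps [simp]: "Re (dir t) = - sin t" "Im (dir t) = cos t"
  by (simp_all add: dir_def)

lemma wedge_add_left: "wedge (z + z') w = wedge z w + wedge z' w"
  and wedge_add_right: "wedge w (z + z') = wedge w z + wedge w z'"
  and wedge_diff_left: "wedge (z - z') w = wedge z w - wedge z' w"
  and wedge_diff_right: "wedge w (z - z') = wedge w z - wedge w z'"
  and wedge_minus_left: "wedge (- z) w = - wedge z w"
  and wedge_minus_right: "wedge w (- z) = - wedge w z"
  and wedge_scale_left: "wedge (r *\<^sub>R z) w = r * wedge z w"
  and wedge_scale_right: "wedge w (r *\<^sub>R z) = r * wedge w z"
  and wedge_self: "wedge z z = 0"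
  by (simp_all add: wedge_def algebra_simps)

lemmas wedge_linear = wedge_add_left wedge_add_right wedge_diff_left wedge_diff_right
  wedge_minus_left wedge_minus_right wedge_scale_left wedge_scale_right wedge_self

lemma wedge_dir_dir: "wedge (dir t) (dir t') = sin (t' - t)"
  by (simp add: wedge_def sin_diff)

lemma dir_add_pi: "dir (t + pi) = - dir t"
  by (simp add: complex_eq_iff)

lemma dir_nonzero: "dir t \<noteq> 0"
proof
  assume "dir t = 0"
  then have "sin t = 0" "cos t = 0" by (auto simp: complex_eq_iff)
  then show False using sin_cos_squared_add[of t] by simp
qed

lemma continuous_wedge [continuous_intros]:
  fixes f :: "'a::t2_space \<Rightarrow> complex"
  shows "continuous_on S f \<Longrightarrow> continuous_on S g \<Longrightarrow> continuous_on S (\<lambda>x. wedge (f x) (g x))"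
  unfolding wedge_def by (intro continuous_intros)

lemma continuous_dir [continuous_intros]:
  fixes f :: "'a::t2_space \<Rightarrow> real"
  shows "continuous_on S f \<Longrightarrow> continuous_on S (\<lambda>x. dir (f x))"
  unfolding dir_def Complex_eq by (intro continuous_intros)

lemma wedge_zero_imp_parallel_dir:
  assumes "wedge z (dir t) = 0"
  shows "z = (Im z * cos t - Re z * sin t) *\<^sub>R dir t"
proof -
  have z: "Re z * cos t + Im z * sin t = 0" using assms by (simp add: wedge_def)
  have sq: "(sin t)\<^sup>2 + (cos t)\<^sup>2 = 1" by simp
  have 1: "Re z = (Im z * cos t - Re z * sin t) * (- sin t)" using z sq by algebra
  have 2: "Im z = (Im z * cos t - Re z * sin t) * cos t" using z sq by algebra
  show ?thesis using 1 2 by (simp add: complex_eq_iff)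
qed

text \<open>Cramer's rule in the basis \<open>dir t\<close>, \<open>dir t'\<close>, whose
  determinant \<open>sin (t' - t)\<close> is positive; the two sign conditions are those of the
  coefficients.\<close>

lemma cone_decomposition:
  assumes "wedge z (dir t) \<le> 0" "wedge z (dir t') \<ge> 0" "t < t'" "t' < t + pi"
  obtains x y where "x \<ge> 0" "y \<ge> 0" "z = x *\<^sub>R dir t + y *\<^sub>R dir t'"
proof -
  define s where "s = sin (t' - t)"
  have s: "s > 0" unfolding s_def using assms by (intro sin_gt_zero) auto
  define x where "x = wedge z (dir t') / s"
  define y where "y = - wedge z (dir t) / s"
  have s': "s = sin t' * cos t - cos t' * sin t" by (simp add: s_def sin_diff)
  have "s * Re z = s * (x * (- sin t) + y * (- sin t'))"
    using s unfolding x_def y_def by (simp add: field_simps) (simp add: s' wedge_def algebra_simps)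
  moreover have "s * Im z = s * (x * cos t + y * cos t')"
    using s unfolding x_def y_def by (simp add: field_simps) (simp add: s' wedge_def algebra_simps)
  ultimately have "z = x *\<^sub>R dir t + y *\<^sub>R dir t'"
    using s by (simp add: complex_eq_iff)
  moreover have "x \<ge> 0" "y \<ge> 0" using assms s by (auto simp: x_def y_def divide_nonpos_pos)
  ultimately show ?thesis using that by blast
qed

text \<open>The norm is a function on \<open>complex\<close>, so that coordinates are at hand. The
  infimum is replaced by a lower bound that is attained at some \<open>s\<close>, the form in which
  chords arise below.\<close>

locale midpoint_plane =
  fixes N :: "complex \<Rightarrow> real" and \<rho> :: real
  assumes tri: "N (z + w) \<le> N z + N w"
    and scale: "N (r *\<^sub>R z) = \<bar>r\<bar> * N z"
    and N_one: "N 1 = 1" and N_ii: "N \<i> = 1"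
    and Re_le: "\<bar>Re z\<bar> \<le> N z" and Im_le: "\<bar>Im z\<bar> \<le> N z"
    and rho: "0 < \<rho>" "\<rho> < 1"
    and chord_midpoint: "\<And>u v s. N u = 1 \<Longrightarrow> N v = 1 \<Longrightarrow>
      (\<And>s. 0 \<le> s \<Longrightarrow> s \<le> 1 \<Longrightarrow> \<rho> \<le> N (s *\<^sub>R u + (1 - s) *\<^sub>R v)) \<Longrightarrow>
      0 \<le> s \<Longrightarrow> s \<le> 1 \<Longrightarrow> N (s *\<^sub>R u + (1 - s) *\<^sub>R v) = \<rho> \<Longrightarrow> N (u + v) = 2 * \<rho>"
begin

lemma N_nonneg: "0 \<le> N z"
  using Re_le[of z] by linarith

lemma N_minus: "N (- z) = N z"
  using scale[of "-1" z] by simp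

lemma N_zero: "N 0 = 0"
  using scale[of 0 0] by simp

lemma N_pos: "z \<noteq> 0 \<Longrightarrow> 0 < N z"
  using Re_le[of z] Im_le[of z] by (force simp: complex_eq_iff)

lemma cmod_le_N: "cmod z \<le> 2 * N z"
  using Re_le[of z] Im_le[of z] cmod_le[of z] by linarith

lemma N_le: "N z \<le> 2 * cmod z"
proof -
  have "z = Re z *\<^sub>R 1 + Im z *\<^sub>R \<i>" by (simp add: complex_eq_iff)
  then have "N z \<le> N (Re z *\<^sub>R 1) + N (Im z *\<^sub>R \<i>)" using tri by metis
  also have "\<dots> = \<bar>Re z\<bar> + \<bar>Im z\<bar>" by (simp only: scale N_one N_ii mult_1_right)
  also have "\<dots> \<le> 2 * cmod z" using abs_Re_le_cmod[of z] abs_Im_le_cmod[of z] by linarith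
  finally show ?thesis .
qed

lemma continuous_N: "continuous_on S N"
proof (rule continuous_on_subset[OF _ subset_UNIV], rule lipschitz_on_continuous_on)
  show "2-lipschitz_on UNIV N"
  proof (rule lipschitz_onI)
    fix z w
    have "N z \<le> N w + N (z - w)" using tri[of w "z - w"] by simp
    moreover have "N w \<le> N z + N (z - w)" using tri[of z "w - z"] N_minus[of "z - w"] by simp
    ultimately show "dist (N z) (N w) \<le> 2 * dist z w"
      using N_le[of "z - w"] by (simp add: dist_norm)
  qed simp
qed

lemma continuous_N_comp [continuous_intros]:
  "continuous_on S f \<Longrightarrow> continuous_on S (\<lambda>x. N (f x))"
  by (rule continuous_on_compose2[OF continuous_N[of UNIV]]) auto

text \<open>The linear functional of the normal at angle \<open>t\<close> is maximal at
  \<open>c\<close> over the unit ball; the factor \<open>N z\<close> states this for vectors of any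
  length.\<close>

definition supports :: "real \<Rightarrow> complex \<Rightarrow> bool" where
  "supports t c \<longleftrightarrow> N c = 1 \<and> (\<forall>z. wedge z (dir t) \<le> N z * wedge c (dir t))"

lemma supportsD:
  assumes "supports t c"
  shows "N c = 1" "wedge z (dir t) \<le> N z * wedge c (dir t)"
  using assms by (auto simp: supports_def)

lemma supports_pos:
  assumes "supports t c"
  shows "0 < wedge c (dir t)"
proof -
  define z where "z = Complex (cos t) (sin t)"
  have "wedge z (dir t) = 1" by (simp add: z_def wedge_def flip: power2_eq_square)
  then have "0 < N z * wedge c (dir t)" using supportsD(2)[OF assms, of z] by simp
  then show ?thesis using N_nonneg[of z] by (simp add: zero_less_mult_iff)
qed

lemma supports_eq_height:
  assumes "supports t c" "supports t c'"
  shows "wedge c (dir t) = wedge c' (dir t)"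
  using supportsD(2)[OF assms(1), of c'] supportsD(2)[OF assms(2), of c]
  by (simp add: supportsD(1)[OF assms(1)] supportsD(1)[OF assms(2)])

lemma ex_supports: "\<exists>c. supports t c"
proof -
  have "closed {z. N z = 1}" 
    by (intro closed_Collect_eq continuous_N continuous_on_const)
  moreover have "bounded {z. N z = 1}"
    by (rule boundedI[of _ 2]) (metis cmod_le_N mem_Collect_eq mult_1_right)
  ultimately have "compact {z. N z = 1}" by (simp add: compact_eq_bounded_closed)
  moreover have "{z. N z = 1} \<noteq> {}" using N_one by blast
  moreover have "continuous_on {z. N z = 1} (\<lambda>z. wedge z (dir t))" by (intro continuous_intros)
  ultimately obtain c where c: "N c = 1" "\<And>z. N z = 1 \<Longrightarrow> wedge z (dir t) \<le> wedge c (dir t)"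
    using continuous_attains_sup[of "{z. N z = 1}" "\<lambda>z. wedge z (dir t)"] by auto
  have "wedge z (dir t) \<le> N z * wedge c (dir t)" for z
  proof (cases "z = 0")
    case False
    then have "N z > 0" by (rule N_pos)
    then show ?thesis using c(2)[of "(1 / N z) *\<^sub>R z"]
      by (simp add: scale wedge_scale_left field_simps)
  qed (simp add: wedge_def N_zero)
  then show ?thesis using c by (auto simp: supports_def)
qed

lemma line_less_one:
  assumes "N p < 1" "N (p + r *\<^sub>R d) \<le> 1" "0 \<le> x" "x < r"
  shows "N (p + x *\<^sub>R d) < 1"
proof -
  have "p + x *\<^sub>R d = (1 - x/r) *\<^sub>R p + (x/r) *\<^sub>R (p + r *\<^sub>R d)"
    using assms by (simp add: algebra_simps)
  then have "N (p + x *\<^sub>R d) \<le> (1 - x/r) * N p + (x/r) * N (p + r *\<^sub>R d)"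
    using tri[of "(1 - x/r) *\<^sub>R p" "(x/r) *\<^sub>R (p + r *\<^sub>R d)"] assms by (simp add: scale)
  also have "\<dots> \<le> (1 - x/r) * N p + (x/r) * 1"
    using assms by (intro add_left_mono mult_left_mono) auto
  also have "\<dots> < (1 - x/r) * 1 + (x/r) * 1"
    using assms by (intro add_strict_right_mono mult_strict_left_mono) auto
  finally show ?thesis by simp
qed

lemma ex_exit:
  assumes "N p < 1" "d \<noteq> 0"
  obtains r where "r > 0" "N (p + r *\<^sub>R d) = 1"
proof -
  \<comment> \<open>At this distance \<open>R *\<^sub>R d\<close> has norm 2, so the triangle
    inequality leaves norm at least 1 at \<open>p + R *\<^sub>R d\<close>.\<close>
  define R where "R = 2 / N d"
  have Nd: "N d > 0" using assms N_pos by auto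
  have "N (R *\<^sub>R d) \<le> N (p + R *\<^sub>R d) + N p"
    using tri[of "p + R *\<^sub>R d" "- p"] by (simp add: N_minus)
  then have "1 \<le> N (p + R *\<^sub>R d)" using assms Nd by (simp add: scale R_def)
  moreover have cont: "continuous_on {0..R} (\<lambda>r. N (p + r *\<^sub>R d))"
    by (intro continuous_intros)
  moreover have "N (p + 0 *\<^sub>R d) \<le> 1" using assms by simp
  moreover have "0 \<le> R" using Nd by (simp add: R_def)
  ultimately obtain r where "0 \<le> r" "r \<le> R" "N (p + r *\<^sub>R d) = 1"
    using IVT'[of "\<lambda>r. N (p + r *\<^sub>R d)" 0 1 R, OF _ _ _ cont] by blast
  moreover have "r \<noteq> 0" using calculation assms by auto
  ultimately show ?thesis using that[of r] by auto
qed

text \<open>On each ray from the interior point \<open>p\<close>, the nearer of two distinct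
  candidates would lie in the open ball by \<open>line_less_one\<close>.\<close>

lemma line_two_points:
  assumes "N p < 1" "N (p + r *\<^sub>R d) = 1" "N (p - s *\<^sub>R d) = 1" "r > 0" "s > 0"
    and "N (p + x *\<^sub>R d) = 1"
  shows "x = r \<or> x = - s"
proof (cases "x \<ge> 0")
  case True
  have "\<not> x < r" using line_less_one[of p r d x] assms True by auto
  moreover have "\<not> r < x" using line_less_one[of p x d r] assms by auto
  ultimately show ?thesis by simp
next
  case False
  have "\<not> - x < s" using line_less_one[of p s "- d" "- x"] assms False by auto
  moreover have "\<not> s < - x" using line_less_one[of p "- x" "- d" s] assms by auto
  ultimately show ?thesis by simp
qed

definition is_chord :: "real \<Rightarrow> complex \<Rightarrow> real \<Rightarrow> bool" where
  "is_chord t c l \<longleftrightarrow> supports t c \<and> 0 \<le> l \<and>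
     N (\<rho> *\<^sub>R c + l *\<^sub>R dir t) = 1 \<and> N (\<rho> *\<^sub>R c - l *\<^sub>R dir t) = 1"

lemma is_chord_pos: "is_chord t c l \<Longrightarrow> 0 < l"
  using rho by (cases "l = 0") (auto simp: is_chord_def scale supports_def)

lemma N_rho_less: "N c = 1 \<Longrightarrow> N (\<rho> *\<^sub>R c) < 1"
  using rho by (simp add: scale)

text \<open>For any support point \<open>s\<close>, take the chord through
  \<open>\<rho> *\<^sub>R s\<close> parallel to the supporting line. All its points have the height
  of \<open>\<rho> *\<^sub>R s\<close>, hence norm at least \<open>\<rho>\<close>, so the midpoint
  hypothesis applies. The normalised midpoint \<open>c\<close> has the height of \<open>s\<close>
  and supports as well, although it may differ from \<open>s\<close> at this stage.\<close>

lemma ex_chord: "\<exists>c l. is_chord t c l"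
proof -
  obtain s where s: "supports t s" using ex_supports by blast
  define h where "h = wedge s (dir t)"
  have h: "h > 0" using supports_pos[OF s] by (simp add: h_def)
  have Ns: "N s = 1" using s by (simp add: supports_def)
  have p: "N (\<rho> *\<^sub>R s) < 1" using N_rho_less[OF Ns] .
  obtain r where r: "r > 0" "N (\<rho> *\<^sub>R s + r *\<^sub>R dir t) = 1" using ex_exit[OF p dir_nonzero] .
  obtain q where q: "q > 0" "N (\<rho> *\<^sub>R s + q *\<^sub>R (- dir t)) = 1"
    using ex_exit[OF p, of "- dir t"] dir_nonzero by auto
  define v where "v = \<rho> *\<^sub>R s + r *\<^sub>R dir t"
  define u where "u = \<rho> *\<^sub>R s - q *\<^sub>R dir t"
  have ge: "\<rho> \<le> N z" if "wedge z (dir t) = \<rho> * h" for z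
    using supportsD(2)[OF s, of z] that h by (simp flip: h_def)
  have seg: "wedge (x *\<^sub>R v + (1 - x) *\<^sub>R u) (dir t) = \<rho> * h" for x
    by (simp add: u_def v_def wedge_linear h_def algebra_simps)
  \<comment> \<open>The weight at which the chord passes through \<open>\<rho> *\<^sub>R s\<close>,
    where the bound \<open>\<rho>\<close> is attained.\<close>
  define x where "x = q / (r + q)"
  have "x * r - (1 - x) * q = 0" using r q by (simp add: x_def field_simps)
  moreover have "x *\<^sub>R v + (1 - x) *\<^sub>R u = \<rho> *\<^sub>R s + (x * r - (1 - x) * q) *\<^sub>R dir t"
    by (simp add: u_def v_def algebra_simps)
  ultimately have "N (x *\<^sub>R v + (1 - x) *\<^sub>R u) = \<rho>" using Ns rho by (simp add: scale)
  then have uv: "N (v + u) = 2 * \<rho>"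
    using r q by (intro chord_midpoint[of v u x] ge seg) (auto simp: u_def v_def x_def)
  define c where "c = (1 / (2 * \<rho>)) *\<^sub>R (v + u)"
  define l where "l = (r + q) / 2"
  have "N c = 1" using uv rho by (simp add: c_def scale)
  moreover have "wedge v (dir t) = \<rho> * h" "wedge u (dir t) = \<rho> * h"
    by (simp_all add: u_def v_def wedge_linear h_def)
  then have "wedge c (dir t) = h"
    using rho by (simp add: c_def wedge_scale_left wedge_add_left)
  ultimately have "supports t c" using s by (auto simp: supports_def h_def)
  moreover have "\<rho> *\<^sub>R c = (1/2) *\<^sub>R (v + u)" using rho by (simp add: c_def)
  then have "\<rho> *\<^sub>R c + l *\<^sub>R dir t = v" "\<rho> *\<^sub>R c - l *\<^sub>R dir t = u"
    by (simp_all add: complex_eq_iff u_def v_def l_def field_simps)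
  ultimately have "is_chord t c l" using r q by (simp add: is_chord_def l_def u_def v_def)
  then show ?thesis by blast
qed

text \<open>Support points of one direction have equal height, so both chords lie on one line; it
  passes through the open ball and meets the circle in two points only.\<close>

lemma chord_unique:
  assumes "is_chord t c l" "is_chord t c' l'"
  shows "c' = c" "l' = l"
proof -
  have l: "l > 0" "l' > 0" using assms is_chord_pos by auto
  have s: "supports t c" "supports t c'" using assms by (auto simp: is_chord_def)
  have "wedge (c' - c) (dir t) = 0" using supports_eq_height[OF s] by (simp add: wedge_linear)
  then obtain y where y: "c' - c = y *\<^sub>R dir t" using wedge_zero_imp_parallel_dir by blast
  then have c': "c' = c + y *\<^sub>R dir t" by (simp add: algebra_simps)
  have p: "N (\<rho> *\<^sub>R c) < 1" using N_rho_less s by (simp add: supports_def)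
  have "N (\<rho> *\<^sub>R c + (\<rho> * y + l') *\<^sub>R dir t) = 1" "N (\<rho> *\<^sub>R c + (\<rho> * y - l') *\<^sub>R dir t) = 1"
    using assms(2) by (simp_all add: is_chord_def c' algebra_simps)
  then have "\<rho> * y + l' = l \<or> \<rho> * y + l' = - l" "\<rho> * y - l' = l \<or> \<rho> * y - l' = - l"
    using line_two_points[OF p] assms(1) l unfolding is_chord_def by blast+
  then have "l' = l" "\<rho> * y = 0" using l by linarith+
  then show "c' = c" "l' = l" using rho c' by auto
qed

text \<open>Among possibly many support points this is the one whose multiple by
  \<open>\<rho>\<close> bisects the chord; \<open>chord_unique\<close> makes the choice
  unambiguous.\<close>

definition touch :: "real \<Rightarrow> complex" where "touch t = (SOME c. \<exists>l. is_chord t c l)"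
definition half :: "real \<Rightarrow> real" where "half t = (SOME l. is_chord t (touch t) l)"

lemma is_chord_touch: "is_chord t (touch t) (half t)"
proof -
  have "\<exists>l. is_chord t (touch t) l"
    unfolding touch_def by (rule someI_ex) (rule ex_chord)
  then show ?thesis unfolding half_def by (rule someI_ex)
qed

lemma supports_touch: "supports t (touch t)"
  using is_chord_touch by (simp add: is_chord_def)

lemma N_touch: "N (touch t) = 1"
  using supports_touch by (simp add: supports_def)

lemma half_pos: "0 < half t"
  using is_chord_touch is_chord_pos by blast

lemma touch_half_shift: "touch (t + pi) = - touch t" "half (t + pi) = half t"
proof -
  have "wedge z (dir (t + pi)) \<le> N z * wedge (- touch t) (dir (t + pi))" for z
    using supportsD(2)[OF supports_touch, of "- z" t] by (simp add: dir_add_pi wedge_linear N_minus)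
  then have "supports (t + pi) (- touch t)" by (simp add: supports_def N_minus N_touch)
  moreover have "\<rho> *\<^sub>R (- touch t) + half t *\<^sub>R dir (t + pi) = - (\<rho> *\<^sub>R touch t + half t *\<^sub>R dir t)"
    "\<rho> *\<^sub>R (- touch t) - half t *\<^sub>R dir (t + pi) = - (\<rho> *\<^sub>R touch t - half t *\<^sub>R dir t)"
    by (simp_all add: dir_add_pi)
  ultimately have "is_chord (t + pi) (- touch t) (half t)"
    using is_chord_touch[of t] unfolding is_chord_def by (metis N_minus)
  from chord_unique[OF this is_chord_touch]
  show "touch (t + pi) = - touch t" "half (t + pi) = half t" by auto
qed

text \<open>Closed graph with bounded values: being a chord is a closed condition on
  \<open>(t, c, l)\<close>, and by uniqueness the set it describes is the graph.\<close>

lemma continuous_touch_half: "continuous_on UNIV (\<lambda>t. (touch t, half t))"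
proof -
  have b: "cmod (touch t) \<le> 2" "\<bar>half t\<bar> \<le> 4" for t
  proof -
    show "cmod (touch t) \<le> 2" using cmod_le_N[of "touch t"] N_touch by simp
    have "N (half t *\<^sub>R dir t) \<le> N (\<rho> *\<^sub>R touch t + half t *\<^sub>R dir t) + N (- (\<rho> *\<^sub>R touch t))"
      using tri[of "\<rho> *\<^sub>R touch t + half t *\<^sub>R dir t" "- (\<rho> *\<^sub>R touch t)"] by simp
    also have "\<dots> = 1 + \<rho>"
      using is_chord_touch[of t] rho by (simp add: is_chord_def N_minus scale N_touch)
    finally have "N (half t *\<^sub>R dir t) \<le> 1 + \<rho>" .
    then have "cmod (half t *\<^sub>R dir t) \<le> 4" using cmod_le_N[of "half t *\<^sub>R dir t"] rho by linarith
    moreover have "cmod (dir t) = 1" by (simp add: cmod_def)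
    ultimately show "\<bar>half t\<bar> \<le> 4" by simp
  qed
  have contN: "continuous_on UNIV (\<lambda>x. N (f x))" if "continuous_on UNIV f" for f :: "real \<times> complex \<times> real \<Rightarrow> complex"
    using that by (rule continuous_N_comp)
  have c1: "closed {x :: real \<times> complex \<times> real. N (fst (snd x)) = 1}"
    by (intro closed_Collect_eq continuous_on_const, rule contN) (intro continuous_on_fst continuous_on_snd continuous_on_id)
  have c2: "closed {x :: real \<times> complex \<times> real. \<forall>z. wedge z (dir (fst x)) \<le> N z * wedge (fst (snd x)) (dir (fst x))}"
    by (intro closed_Collect_all closed_Collect_le continuous_on_mult continuous_wedge continuous_dir
          continuous_on_const continuous_on_fst continuous_on_snd continuous_on_id)
  have c3: "closed {x :: real \<times> complex \<times> real. 0 \<le> snd (snd x)}"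
    by (intro closed_Collect_le continuous_on_const continuous_on_fst continuous_on_snd continuous_on_id)
  have c4: "closed {x :: real \<times> complex \<times> real. N (\<rho> *\<^sub>R fst (snd x) + snd (snd x) *\<^sub>R dir (fst x)) = 1}"
    by (intro closed_Collect_eq continuous_on_const, rule contN)
       (intro continuous_on_add continuous_on_diff continuous_on_scaleR continuous_dir
          continuous_on_const continuous_on_fst continuous_on_snd continuous_on_id)
  have c5: "closed {x :: real \<times> complex \<times> real. N (\<rho> *\<^sub>R fst (snd x) - snd (snd x) *\<^sub>R dir (fst x)) = 1}"
    by (intro closed_Collect_eq continuous_on_const, rule contN)
       (intro continuous_on_add continuous_on_diff continuous_on_scaleR continuous_dir
          continuous_on_const continuous_on_fst continuous_on_snd continuous_on_id)
  have "closed {x :: real \<times> complex \<times> real. is_chord (fst x) (fst (snd x)) (snd (snd x))}"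
    unfolding is_chord_def supports_def
    by (rule closed_Collect_conj[OF closed_Collect_conj[OF c1 c2]
          closed_Collect_conj[OF c3 closed_Collect_conj[OF c4 c5]]])
  moreover have "{x. is_chord (fst x) (fst (snd x)) (snd (snd x))} = (\<lambda>t. (t, touch t, half t)) ` UNIV"
  proof (intro set_eqI iffI)
    fix x :: "real \<times> complex \<times> real"
    assume "x \<in> {x. is_chord (fst x) (fst (snd x)) (snd (snd x))}"
    then have ch: "is_chord (fst x) (fst (snd x)) (snd (snd x))" by simp
    have "x = (fst x, touch (fst x), half (fst x))"
      using chord_unique[OF is_chord_touch ch] by (simp add: prod_eq_iff)
    then show "x \<in> (\<lambda>t. (t, touch t, half t)) ` UNIV" by (rule image_eqI) simp
  next
    fix x :: "real \<times> complex \<times> real"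
    assume "x \<in> (\<lambda>t. (t, touch t, half t)) ` UNIV"
    then obtain t where "x = (t, touch t, half t)" by (rule imageE)
    then show "x \<in> {x. is_chord (fst x) (fst (snd x)) (snd (snd x))}"
      using is_chord_touch[of t] by simp
  qed
  ultimately have "closed ((\<lambda>t. (t, touch t, half t)) ` UNIV)" by simp
  moreover have "compact (cball (0::complex) 2 \<times> {-4..4::real})" by (intro compact_Times) auto
  moreover have "(\<lambda>t. (touch t, half t)) \<in> UNIV \<rightarrow> cball (0::complex) 2 \<times> {-4..4::real}"
  proof
    fix t :: real
    show "(touch t, half t) \<in> cball 0 2 \<times> {-4..4}"
      using b(1)[of t] b(2)[of t] by (simp add: abs_le_iff)
  qed
  ultimately show ?thesis by (intro continuous_from_closed_graph)
qed

lemma continuous_touch: "continuous_on S touch"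
proof -
  have "continuous_on UNIV touch" using continuous_on_fst[OF continuous_touch_half] by simp
  then show ?thesis by (rule continuous_on_subset) simp
qed

lemma continuous_half: "continuous_on S half"
proof -
  have "continuous_on UNIV half" using continuous_on_snd[OF continuous_touch_half] by simp
  then show ?thesis by (rule continuous_on_subset) simp
qed

lemma continuous_touch_comp [continuous_intros]:
  "continuous_on S f \<Longrightarrow> continuous_on S (\<lambda>x. touch (f x))"
  by (rule continuous_on_compose2[OF continuous_touch[of UNIV]]) auto

lemma continuous_half_comp [continuous_intros]:
  "continuous_on S f \<Longrightarrow> continuous_on S (\<lambda>x. half (f x))"
  by (rule continuous_on_compose2[OF continuous_half[of UNIV]]) auto

end

section \<open>The chord map of the unit circle\<close>

context midpoint_plane
begin

text \<open>The substitute for differentiability: moving forward along the circle means moving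
  within the cone of the two tangent directions.\<close>

lemma supports_cone:
  assumes "supports t z" "supports t' z'" "t < t'" "t' < t + pi"
  obtains x y where "x \<ge> 0" "y \<ge> 0" "z' - z = x *\<^sub>R dir t + y *\<^sub>R dir t'"
proof -
  have "wedge (z' - z) (dir t) \<le> 0" "wedge (z' - z) (dir t') \<ge> 0"
    using supportsD(2)[OF assms(1), of z'] supportsD(2)[OF assms(2), of z]
      supportsD(1)[OF assms(1)] supportsD(1)[OF assms(2)] by (simp_all add: wedge_diff_left)
  then show ?thesis using cone_decomposition assms(3,4) that by blast
qed

lemma inner_dir_dir: "inner (dir t) (dir t') = cos (t' - t)"
  by (simp add: inner_complex_def cos_diff)

text \<open>Absence of segments. For slightly larger angles \<open>touch\<close> is not behind
  \<open>z\<close> along \<open>dir t\<close>, for slightly smaller ones it is not ahead, so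
  continuity squeezes \<open>touch t\<close> onto \<open>z\<close>.\<close>

lemma supports_unique:
  assumes z: "supports t z"
  shows "z = touch t"
proof -
  define k where "k = (\<lambda>t'. inner (touch t' - z) (dir t))"
  have cont: "continuous_on S k" for S
    unfolding k_def by (intro continuous_intros)
  have right: "k t' \<ge> 0" if t': "t < t'" "t' < t + pi/2" for t'
  proof -
    obtain x y where "x \<ge> 0" "y \<ge> 0" "touch t' - z = x *\<^sub>R dir t + y *\<^sub>R dir t'"
      using supports_cone[OF z supports_touch, of t'] t' pi_gt_zero by (metis add_strict_left_mono field_sum_of_halves less_add_same_cancel1 order_less_trans pi_half_gt_zero)
    moreover have "cos (t - t') \<ge> 0" using t' by (intro cos_ge_zero) auto
    ultimately show ?thesis by (simp add: k_def inner_add_left inner_dir_dir)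
  qed
  have left: "k t' \<le> 0" if t': "t - pi/2 < t'" "t' < t" for t'
  proof -
    obtain x y where "x \<ge> 0" "y \<ge> 0" "z - touch t' = x *\<^sub>R dir t' + y *\<^sub>R dir t"
      using supports_cone[OF supports_touch z, of t'] t' pi_half_gt_zero by (auto simp: field_simps)
    moreover have "cos (t - t') \<ge> 0" using t' by (intro cos_ge_zero) auto
    ultimately have "inner (z - touch t') (dir t) \<ge> 0" by (simp add: inner_add_left inner_dir_dir)
    then show ?thesis by (simp add: k_def inner_diff_left)
  qed
  have "k t \<ge> 0"
    by (rule continuous_ge_on_closure[of "{t<..<t+pi/2}" k])
       (use right pi_half_gt_zero in \<open>auto intro: cont\<close>)
  moreover have "k t \<le> 0"
    by (rule continuous_le_on_closure[of "{t-pi/2<..<t}" k])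
       (use left pi_half_gt_zero in \<open>auto intro: cont\<close>)
  ultimately have k: "inner (touch t - z) (dir t) = 0" by (simp add: k_def)
  have "wedge (touch t - z) (dir t) = 0"
    using supports_eq_height[OF z supports_touch] by (simp add: wedge_diff_left)
  then obtain y where y: "touch t - z = y *\<^sub>R dir t" using wedge_zero_imp_parallel_dir by blast
  then have "y = 0" using k by (simp add: inner_dir_dir)
  then show ?thesis using y by simp
qed

definition height :: "real \<Rightarrow> real" where
  "height t = wedge (touch t) (dir t)"

lemma height_pos: "height t > 0"
  unfolding height_def using supports_pos[OF supports_touch] .

lemma height_ge: "wedge (touch s) (dir t) \<le> height t"
  using supportsD(2)[OF supports_touch, of "touch s" t] by (simp add: N_touch height_def)

text \<open>All tangent directions at angles between \<open>t\<close> and \<open>t + pi\<close>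
  descend with respect to the normal of \<open>t\<close>, and the increment is a nonnegative
  combination of two of them.\<close>

lemma height_antimono:
  assumes "t \<le> s" "s \<le> s'" "s' \<le> t + pi"
  shows "wedge (touch s') (dir t) \<le> wedge (touch s) (dir t)"
proof -
  consider "s = s'" | "s = t" "s' = t + pi" | "s < s'" "s' < s + pi"
    using assms by force
  then show ?thesis
  proof cases
    case 2
    then show ?thesis using height_pos[of t] by (simp add: touch_half_shift wedge_minus_left flip: height_def)
  next
    case 3
    obtain x y where xy: "x \<ge> 0" "y \<ge> 0" "touch s' - touch s = x *\<^sub>R dir s + y *\<^sub>R dir s'"
      using supports_cone[OF supports_touch supports_touch 3] .
    have "0 \<le> sin (s - t)" "0 \<le> sin (s' - t)" using assms by (auto intro!: sin_ge_zero)
    then have "sin (t - s) \<le> 0" "sin (t - s') \<le> 0"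
      using sin_minus[of "s - t"] sin_minus[of "s' - t"] by auto
    then have "wedge (touch s' - touch s) (dir t) \<le> 0"
      using xy by (simp add: wedge_linear wedge_dir_dir mult_nonneg_nonpos add_nonpos_nonpos)
    then show ?thesis by (simp add: wedge_linear)
  qed simp
qed

lemma height_mono:
  assumes "t - pi \<le> s" "s \<le> s'" "s' \<le> t"
  shows "wedge (touch s) (dir t) \<le> wedge (touch s') (dir t)"
  using height_antimono[of "t - pi" s s'] assms dir_add_pi[of "t - pi"]
  by (simp add: wedge_minus_right)

text \<open>The increments from \<open>s\<close> to \<open>s'\<close> and from \<open>s'\<close> to
  \<open>s + pi\<close> express the same wedge product in two ways; according to the sign of
  \<open>wedge (touch s) (dir s')\<close>, one of them is visibly nonnegative.\<close>

lemma wedge_touch_nonneg: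
  assumes "s \<le> s'" "s' \<le> s + pi"
  shows "0 \<le> wedge (touch s) (touch s')"
proof -
  consider "s = s'" | "s' = s + pi" | "s < s'" "s' < s + pi" using assms by force
  then show ?thesis
  proof cases
    case 3
    obtain x y where xy: "x \<ge> 0" "y \<ge> 0" "touch s' - touch s = x *\<^sub>R dir s + y *\<^sub>R dir s'"
      using supports_cone[OF supports_touch supports_touch 3] .
    obtain x' y' where xy': "x' \<ge> 0" "y' \<ge> 0" 
      "touch (s + pi) - touch s' = x' *\<^sub>R dir s' + y' *\<^sub>R dir (s + pi)"
      using supports_cone[OF supports_touch supports_touch, of s' "s + pi"] 3 by auto
    have "wedge (touch s) (touch s' - touch s) = x * height s + y * wedge (touch s) (dir s')"
      unfolding xy(3) by (simp add: wedge_linear height_def)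
    then have 1: "wedge (touch s) (touch s') = x * height s + y * wedge (touch s) (dir s')"
      by (simp add: wedge_linear)
    have "wedge (touch s) (touch (s + pi) - touch s') = x' * wedge (touch s) (dir s') - y' * height s"
      unfolding xy'(3) by (simp add: wedge_linear height_def dir_add_pi)
    then have 2: "wedge (touch s) (touch s') = y' * height s - x' * wedge (touch s) (dir s')"
      by (simp add: wedge_linear touch_half_shift)
    show ?thesis
    proof (cases "wedge (touch s) (dir s') \<ge> 0")
      case True
      then show ?thesis unfolding 1 using xy height_pos[of s] by (simp add: less_imp_le)
    next
      case False
      then have "x' * wedge (touch s) (dir s') \<le> 0" using xy' by (simp add: mult_nonneg_nonpos)
      moreover have "0 \<le> y' * height s" using xy' height_pos[of s] by simp
      ultimately show ?thesis unfolding 2 by linarith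
    qed
  qed (simp_all add: wedge_linear touch_half_shift)
qed

section \<open>Chord ends and the exclusion of corners\<close>

definition fwd :: "real \<Rightarrow> complex" where
  "fwd t = \<rho> *\<^sub>R touch t + half t *\<^sub>R dir t"

definition bwd :: "real \<Rightarrow> complex" where
  "bwd t = \<rho> *\<^sub>R touch t - half t *\<^sub>R dir t"

lemma N_fwd: "N (fwd t) = 1" and N_bwd: "N (bwd t) = 1"
  using is_chord_touch[of t] by (auto simp: is_chord_def fwd_def bwd_def)

lemma fwd_bwd: "fwd t + bwd t = (2 * \<rho>) *\<^sub>R touch t"
  unfolding fwd_def bwd_def scaleR_left_distrib mult_2 by simp

lemma fwd_shift: "fwd (t + pi) = - fwd t" and bwd_shift: "bwd (t + pi) = - bwd t"
  by (simp_all add: fwd_def bwd_def touch_half_shift dir_add_pi)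

lemma wedge_fwd: "wedge (fwd t) (dir t) = \<rho> * height t"
  and wedge_bwd: "wedge (bwd t) (dir t) = \<rho> * height t"
  by (simp_all add: fwd_def bwd_def wedge_linear height_def)

lemma continuous_fwd: "continuous_on S fwd"
  unfolding fwd_def[abs_def] by (intro continuous_intros)

lemma on_chord_line:
  assumes "N z = 1" "wedge z (dir t) = \<rho> * height t"
  shows "z = fwd t \<or> z = bwd t"
proof -
  have "wedge (z - \<rho> *\<^sub>R touch t) (dir t) = 0" using assms by (simp add: wedge_linear height_def)
  then obtain y where y: "z - \<rho> *\<^sub>R touch t = y *\<^sub>R dir t" using wedge_zero_imp_parallel_dir by blast
  then have z: "z = \<rho> *\<^sub>R touch t + y *\<^sub>R dir t" by (simp add: algebra_simps)
  have "y = half t \<or> y = - half t"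
    using line_two_points[OF N_rho_less[OF N_touch], of t "half t" "dir t" "half t" y]
      N_fwd[of t] N_bwd[of t] half_pos[of t] assms(1) z by (simp add: fwd_def bwd_def)
  then show ?thesis using z by (auto simp: fwd_def bwd_def)
qed

text \<open>Over half a turn the height with respect to \<open>t\<close> goes from
  \<open>height t\<close> to its negative and so passes the level of the chord; the orientation
  excludes the rear end.\<close>

lemma ex_fwd: "\<exists>b. t < b \<and> b < t + pi \<and> touch b = fwd t"
proof -
  have pos: "0 < \<rho> * height t" "\<rho> * height t < height t" using rho height_pos[of t] by auto
  have "\<exists>b\<ge>t. b \<le> t + pi \<and> wedge (touch b) (dir t) = \<rho> * height t"
  proof (rule IVT2')
    show "wedge (touch (t + pi)) (dir t) \<le> \<rho> * height t"
      using pos by (simp add: touch_half_shift wedge_linear flip: height_def)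
    show "\<rho> * height t \<le> wedge (touch t) (dir t)" using pos rho by (simp flip: height_def)
  qed (auto intro!: continuous_intros)
  then obtain b where b: "t \<le> b" "b \<le> t + pi" "wedge (touch b) (dir t) = \<rho> * height t" by blast
  have "b \<noteq> t" "b \<noteq> t + pi"
    using b(3) pos rho by (auto simp: touch_half_shift wedge_linear simp flip: height_def)
  moreover have "touch b \<noteq> bwd t"
  proof
    assume "touch b = bwd t"
    then have "wedge (touch t) (touch b) = - half t * height t"
      by (simp add: bwd_def wedge_linear height_def)
    then show False
      using wedge_touch_nonneg[OF b(1,2)] half_pos[of t] height_pos[of t]
      by (simp add: mult_le_0_iff)
  qed
  ultimately show ?thesis using b on_chord_line[OF N_touch b(3)] by (intro exI[of _ b]) auto
qed

lemma ex_bwd: "\<exists>a. t - pi < a \<and> a < t \<and> touch a = bwd t"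
proof -
  have pos: "0 < \<rho> * height t" "\<rho> * height t < height t" using rho height_pos[of t] by auto
  \<comment> \<open>The negated level is sought because its point is the antipode of the rear end; a
    shift by \<open>- pi\<close> then gives the end itself.\<close>
  have "\<exists>b\<ge>t. b \<le> t + pi \<and> wedge (touch b) (dir t) = - (\<rho> * height t)"
  proof (rule IVT2')
    show "wedge (touch (t + pi)) (dir t) \<le> - (\<rho> * height t)"
      using pos rho by (simp add: touch_half_shift wedge_linear flip: height_def)
    show "- (\<rho> * height t) \<le> wedge (touch t) (dir t)" using pos rho by (simp flip: height_def)
  qed (auto intro!: continuous_intros)
  then obtain b where b: "t \<le> b" "b \<le> t + pi" "wedge (touch b) (dir t) = - (\<rho> * height t)" by blast
  have "b \<noteq> t" "b \<noteq> t + pi"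
    using b(3) pos rho by (auto simp: touch_half_shift wedge_linear simp flip: height_def)
  moreover have "- touch b \<noteq> fwd t"
  proof
    assume "- touch b = fwd t"
    then have "touch b = - fwd t" by (metis minus_minus)
    then have "wedge (touch t) (touch b) = - half t * height t"
      by (simp add: fwd_def wedge_linear height_def)
    then show False
      using wedge_touch_nonneg[OF b(1,2)] half_pos[of t] height_pos[of t]
      by (simp add: mult_le_0_iff)
  qed
  then have "- touch b = bwd t"
    using on_chord_line[of "- touch b" t] b(3) by (simp add: N_minus N_touch wedge_linear)
  then have "touch (b - pi) = bwd t" using touch_half_shift(1)[of "b - pi"] by simp
  ultimately show ?thesis using b by (intro exI[of _ "b - pi"]) auto
qed

text \<open>If \<open>b'\<close> did not exceed \<open>b\<close>, then \<open>fwd t'\<close> would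
  lie on or above the chord of \<open>t\<close>. But \<open>\<rho> *\<^sub>R touch t'\<close> is at
  most at the level of that chord, and \<open>half t' *\<^sub>R dir t'\<close> strictly descends
  from it.\<close>

lemma fwd_less:
  assumes "t < b" "b < t + pi" "touch b = fwd t" "t' < b'" "touch b' = fwd t'" "t < t'" "t' < t + pi"
  shows "b < b'"
proof (rule ccontr)
  assume "\<not> b < b'"
  then have "\<rho> * height t \<le> wedge (touch b') (dir t)"
    using height_antimono[of t b' b] assms by (simp add: wedge_fwd)
  also have "\<dots> = \<rho> * wedge (touch t') (dir t) - half t' * sin (t' - t)"
    using sin_minus[of "t' - t"] by (simp add: assms(5) fwd_def wedge_linear wedge_dir_dir)
  also have "\<dots> < \<rho> * wedge (touch t') (dir t)"
    using assms half_pos[of t'] sin_gt_zero[of "t' - t"] by simp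
  also have "\<dots> \<le> \<rho> * height t" using rho height_ge by simp
  finally show False by simp
qed

lemma bwd_less:
  assumes "a < t" "touch a = bwd t" "t' - pi < a'" "a' < t'" "touch a' = bwd t'" "t < t'" "t' < t + pi"
  shows "a < a'"
proof (rule ccontr)
  assume "\<not> a < a'"
  then have "\<rho> * height t' \<le> wedge (touch a) (dir t')"
    using height_mono[of t' a' a] assms by (simp add: wedge_bwd)
  also have "\<dots> = \<rho> * wedge (touch t) (dir t') - half t * sin (t' - t)"
    by (simp add: assms(2) bwd_def wedge_linear wedge_dir_dir)
  also have "\<dots> < \<rho> * wedge (touch t) (dir t')"
    using assms half_pos[of t] sin_gt_zero[of "t' - t"] by simp
  also have "\<dots> \<le> \<rho> * height t'" using rho height_ge by simp
  finally show False by simp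
qed

text \<open>With respect to \<open>t\<close>, the point at angle \<open>b\<close> has positive
  height, the one at \<open>a + pi\<close> negative height.\<close>

lemma fwd_less_bwd_shift:
  assumes "t < b" "b < t + pi" "touch b = fwd t" "t - pi < a" "a < t" "touch a = bwd t"
  shows "b < a + pi"
proof (rule ccontr)
  assume "\<not> b < a + pi"
  then have "wedge (touch b) (dir t) \<le> wedge (touch (a + pi)) (dir t)"
    using height_antimono[of t "a + pi" b] assms by simp
  then have "\<rho> * height t \<le> - (\<rho> * height t)"
    by (simp add: assms(3,6) touch_half_shift wedge_fwd wedge_bwd wedge_minus_left)
  then show False using rho height_pos[of t] by (simp add: mult_le_0_iff)
qed

text \<open>The increments over the two subranges add up to zero, and nonnegative combinations of
  directions within less than half a turn cancel only trivially.\<close>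

lemma touch_const_between:
  assumes "touch t = touch t'" "t < t'" "t' < t + pi" "t \<le> s" "s \<le> t'"
  shows "touch s = touch t"
proof (cases "s = t \<or> s = t'")
  case False
  then have s: "t < s" "s < t'" using assms by auto
  obtain x y where xy: "x \<ge> 0" "y \<ge> 0" "touch s - touch t = x *\<^sub>R dir t + y *\<^sub>R dir s"
    using supports_cone[OF supports_touch supports_touch, of t s] s assms by auto
  obtain x' y' where xy': "x' \<ge> 0" "y' \<ge> 0" "touch t' - touch s = x' *\<^sub>R dir s + y' *\<^sub>R dir t'"
    using supports_cone[OF supports_touch supports_touch, of s t'] s assms by auto
  have "(x *\<^sub>R dir t + y *\<^sub>R dir s) + (x' *\<^sub>R dir s + y' *\<^sub>R dir t') = 0"
    unfolding xy(3)[symmetric] xy'(3)[symmetric] using assms by simp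
  then have "wedge (dir t) ((x *\<^sub>R dir t + y *\<^sub>R dir s) + (x' *\<^sub>R dir s + y' *\<^sub>R dir t')) = 0"
    by (simp add: wedge_def)
  then have "(y + x') * sin (s - t) + y' * sin (t' - t) = 0"
    by (simp add: wedge_linear wedge_dir_dir algebra_simps)
  moreover have "sin (s - t) > 0" "sin (t' - t) > 0" using s assms by (auto intro!: sin_gt_zero)
  moreover have "0 \<le> (y + x') * sin (s - t)" "0 \<le> y' * sin (t' - t)"
    using xy xy' calculation by auto
  ultimately have "(y + x') * sin (s - t) = 0" "y' * sin (t' - t) = 0" by linarith+
  then have "y + x' = 0" "y' = 0"
    using \<open>sin (s - t) > 0\<close> \<open>sin (t' - t) > 0\<close> by auto
  then have "x' = 0" "y' = 0" using xy xy' by linarith+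
  then show ?thesis using xy' assms by simp
qed (use assms in auto)

text \<open>
  At a corner of the unit circle the two ends of the turning chord would move in opposite
  directions, which forces antipodal tangent directions at two points less than half a turn apart.
\<close>

lemma touch_inj_half_turn:
  assumes "t < T" "T < t + pi"
  shows "touch t \<noteq> touch T"
proof
  assume eq: "touch t = touch T"
  define s where "s = touch t"
  obtain b where b: "t < b" "b < t + pi" "touch b = fwd t" using ex_fwd by blast
  obtain a where a: "t - pi < a" "a < t" "touch a = bwd t" using ex_bwd by blast
  have ba: "b < a + pi" using fwd_less_bwd_shift b a by blast
  \<comment> \<open>Keeping \<open>k t'\<close> positive by choosing \<open>t'\<close> near
    \<open>t\<close> yields \<open>b' < a + pi\<close>; then the directions at \<open>a\<close>,
    \<open>a'\<close>, \<open>b\<close>, \<open>b'\<close> all fit into less than half a turn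
    starting at \<open>a\<close>.\<close>
  define k where "k = (\<lambda>x. wedge (fwd x) (dir t))"
  have "continuous_on UNIV k"
    unfolding k_def by (intro continuous_intros continuous_fwd)
  then have "isCont k t" by (simp add: continuous_on_eq_continuous_at)
  moreover have kt: "k t > 0" using rho height_pos[of t] by (simp add: k_def wedge_fwd)
  ultimately have "\<forall>\<^sub>F x in at t. k x > 0"
    unfolding isCont_def by (metis order_tendstoD(1))
  then obtain d where d: "d > 0" "\<And>x. x \<noteq> t \<Longrightarrow> dist x t < d \<Longrightarrow> k x > 0"
    unfolding eventually_at by auto
  define t' where "t' = min (t + d/2) T"
  have t0: "t < t'" "t' \<le> T" "t' < t + pi" "dist t' t < d"
    using d(1) assms by (auto simp: t'_def dist_real_def min_def)
  have "k t' > 0" by (rule d(2)) (use t0 in simp_all)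
  note t' = t0(1-3) this
  have const: "touch x = s" if "t \<le> x" "x \<le> t'" for x
    unfolding s_def by (rule touch_const_between[OF eq assms]) (use that t' in simp_all)
  obtain b' where b': "t' < b'" "b' < t' + pi" "touch b' = fwd t'" using ex_fwd by blast
  obtain a' where a': "t' - pi < a'" "a' < t'" "touch a' = bwd t'" using ex_bwd by blast
  have less: "b < b'" "a < a'"
    using fwd_less[OF b b'(1,3)] bwd_less[OF a(2,3) a'] t' by auto
  have "b' < t + pi"
  proof (rule ccontr)
    assume "\<not> b' < t + pi"
    then have "touch (b' - pi) = s" using b' by (intro const) auto
    then have "touch b' = - s" using touch_half_shift(1)[of "b' - pi"] by simp
    then have "\<rho> * height t' = - height t'"
      using wedge_fwd[of t'] b'(3) const[of t'] t' by (simp add: wedge_minus_left height_def)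
    moreover have "0 < \<rho> * height t'" using rho height_pos[of t'] by simp
    ultimately show False using height_pos[of t'] by linarith
  qed
  have "b' < a + pi"
  proof (rule ccontr)
    assume "\<not> b' < a + pi"
    then have "wedge (touch b') (dir t) \<le> wedge (touch (a + pi)) (dir t)"
      using height_antimono[of t "a + pi" b'] a \<open>b' < t + pi\<close> by simp
    also have "\<dots> < 0" using a(3) rho height_pos[of t] by (simp add: touch_half_shift wedge_minus_left wedge_bwd)
    finally show False using t'(4) by (simp add: k_def b'(3))
  qed
  obtain x y where xy: "x \<ge> 0" "y \<ge> 0" "touch b' - touch b = x *\<^sub>R dir b + y *\<^sub>R dir b'"
    using supports_cone[OF supports_touch supports_touch, of b b'] less b \<open>b' < t + pi\<close> by auto
  obtain x' y' where xy': "x' \<ge> 0" "y' \<ge> 0" "touch a' - touch a = x' *\<^sub>R dir a + y' *\<^sub>R dir a'"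
    using supports_cone[OF supports_touch supports_touch, of a a'] less a' b' \<open>b' < a + pi\<close> by auto
  have "fwd t' + bwd t' = fwd t + bwd t" by (simp add: fwd_bwd const t' less_imp_le flip: s_def)
  then have "(touch b' - touch b) + (touch a' - touch a) = 0"
    by (simp add: b b' a a' algebra_simps)
  then have "wedge (dir a) ((x *\<^sub>R dir b + y *\<^sub>R dir b') + (x' *\<^sub>R dir a + y' *\<^sub>R dir a')) = 0"
    unfolding xy xy' by (simp add: wedge_def)
  then have "x * sin (b - a) + y * sin (b' - a) + y' * sin (a' - a) = 0"
    by (simp add: wedge_linear wedge_dir_dir algebra_simps)
  moreover have sn: "sin (b - a) > 0" "sin (b' - a) > 0" "sin (a' - a) > 0"
    using a a' b b' less ba \<open>b' < a + pi\<close> by (auto intro!: sin_gt_zero)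
  moreover have "0 \<le> x * sin (b - a)" "0 \<le> y * sin (b' - a)" "0 \<le> y' * sin (a' - a)"
    using xy xy' sn by auto
  ultimately have "x * sin (b - a) = 0" "y * sin (b' - a) = 0" by linarith+
  then have "x = 0" "y = 0" using sn by auto
  \<comment> \<open>Two chords with the same midpoint and a common end are parallel, against
    \<open>t < t' < t + pi\<close>.\<close>
  then have "fwd t' = fwd t" using xy b b' by simp
  then have "half t' *\<^sub>R dir t' = half t *\<^sub>R dir t"
    using const[of t'] t' by (simp add: fwd_def s_def)
  then have "wedge (dir t) (half t' *\<^sub>R dir t') = 0" by (simp add: wedge_linear)
  then have "half t' * sin (t' - t) = 0" by (simp add: wedge_linear wedge_dir_dir)
  moreover have "sin (t' - t) > 0" using t' by (intro sin_gt_zero) auto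
  ultimately show False using half_pos[of t'] by simp
qed

lemma touch_inj:
  assumes "touch s = touch t" "t \<le> s" "s < t + 2 * pi"
  shows "s = t"
proof (rule ccontr)
  assume "s \<noteq> t"
  then consider "t < s" "s < t + pi" | "s = t + pi" | "t < s - pi" "s - pi < t + pi" using assms by force
  then show False
  proof cases
    case 2
    then have "touch t = - touch t" using assms touch_half_shift by simp
    then have "touch t = 0" by simp
    then show False using N_touch[of t] N_zero by simp
  next
    case 3
    have "touch (s - pi) = - touch t"
      using touch_half_shift(1)[of "s - pi"] assms by simp
    then have "touch (s - pi) = touch (t + pi)" by (simp add: touch_half_shift)
    then show False using touch_inj_half_turn[of "s - pi" "t + pi"] 3 by auto
  next
    case 1
    then show False using touch_inj_half_turn[of t s] assms by simp
  qed
qed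

text \<open>Parallel unit vectors are equal or antipodal, and injectivity excludes both.\<close>

lemma wedge_touch_pos:
  assumes "s < s'" "s' < s + pi"
  shows "0 < wedge (touch s) (touch s')"
proof (rule ccontr)
  assume "\<not> 0 < wedge (touch s) (touch s')"
  then have w: "wedge (touch s) (touch s') = 0" using wedge_touch_nonneg[of s s'] assms by simp
  have nz: "touch s \<noteq> 0" using N_touch[of s] N_zero by auto
  define r where "r = inner (touch s) (touch s') / inner (touch s) (touch s)"
  have n0: "(Re (touch s))\<^sup>2 + (Im (touch s))\<^sup>2 \<noteq> 0"
    using nz by (simp add: complex_eq_iff)
  have "touch s' = r *\<^sub>R touch s"
    using w n0 unfolding r_def inner_complex_def wedge_def complex_eq_iff
    by (simp add: field_simps power2_eq_square)
  then have "\<bar>r\<bar> = 1" using N_touch[of s] N_touch[of s'] by (simp add: scale)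
  then have "r = 1 \<or> r = - 1" by linarith
  then have "touch s' = touch s \<or> touch s' = touch (s + pi)"
    using \<open>touch s' = r *\<^sub>R touch s\<close> by (auto simp: touch_half_shift)
  then show False using touch_inj[of s' s] touch_inj[of "s + pi" s'] assms by auto
qed

section \<open>The angles of the chord ends as increasing continuous functions\<close>

definition nxt :: "real \<Rightarrow> real" where
  "nxt t = (SOME b. t < b \<and> b < t + pi \<and> touch b = fwd t)"

definition prv :: "real \<Rightarrow> real" where
  "prv t = (SOME a. t - pi < a \<and> a < t \<and> touch a = bwd t)"

lemma nxt: "t < nxt t" "nxt t < t + pi" "touch (nxt t) = fwd t"
  using someI_ex[OF ex_fwd[of t]] by (auto simp: nxt_def)

lemma prv: "t - pi < prv t" "prv t < t" "touch (prv t) = bwd t"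
  using someI_ex[OF ex_bwd[of t]] by (auto simp: prv_def)

lemma nxt_less_prv: "nxt t < prv t + pi"
  using fwd_less_bwd_shift nxt prv by blast

lemma nxt_less: "t < t' \<Longrightarrow> nxt t < nxt t'"
  using fwd_less[OF nxt nxt(1,3)] nxt(2)[of t] nxt(1)[of t'] by (cases "t' < t + pi") auto

lemma prv_less: "t < t' \<Longrightarrow> prv t < prv t'"
  using bwd_less[OF prv(2,3) prv] prv(2)[of t] prv(1)[of t'] by (cases "t' < t + pi") auto

lemma nxt_unique: "t \<le> b \<Longrightarrow> b \<le> t + pi \<Longrightarrow> touch b = fwd t \<Longrightarrow> b = nxt t"
  using touch_inj[of b "nxt t"] touch_inj[of "nxt t" b] nxt[of t]
  by (cases "b \<le> nxt t") auto

lemma prv_unique: "t - pi \<le> a \<Longrightarrow> a \<le> t \<Longrightarrow> touch a = bwd t \<Longrightarrow> a = prv t"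
  using touch_inj[of a "prv t"] touch_inj[of "prv t" a] prv[of t]
  by (cases "a \<le> prv t") auto

lemma continuous_bwd: "continuous_on S bwd"
  unfolding bwd_def[abs_def] by (intro continuous_intros)

lemma continuous_local:
  fixes f :: "real \<Rightarrow> real"
  assumes "\<And>p q. continuous_on {p..q} f"
  shows "continuous_on S f"
proof (rule continuous_on_subset[OF _ subset_UNIV], rule continuous_at_imp_continuous_on, rule)
  fix t show "isCont f t"
    using continuous_on_interior[OF assms[of "t - 1" "t + 1"], of t] by simp
qed

text \<open>A closed graph argument once more: \<open>nxt_unique\<close> allows the strict
  inequalities of the definition to be relaxed to closed ones.\<close>

lemma continuous_nxt: "continuous_on S nxt"
proof (rule continuous_local)
  fix p q :: real
  show "continuous_on {p..q} nxt"
  proof (rule continuous_from_closed_graph[of "{p..q + pi}"])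
    have "(\<lambda>x. (x, nxt x)) ` {p..q} =
      {x \<in> {p..q} \<times> {p..q + pi}. fst x \<le> snd x \<and> snd x \<le> fst x + pi \<and> touch (snd x) = fwd (fst x)}"
      using nxt by (auto simp: image_iff less_imp_le intro!: nxt_unique) (smt (verit, best) nxt)+
    also have "\<dots> = ({p..q} \<times> {p..q + pi}) \<inter> ({x. fst x \<le> snd x} \<inter> ({x. snd x \<le> fst x + pi} \<inter> {x. touch (snd x) = fwd (fst x)}))"
      by blast
    also have "closed \<dots>"
      by (intro closed_Int closed_Times closed_Collect_le closed_Collect_eq closed_atLeastAtMost
          continuous_on_fst continuous_on_snd continuous_on_id continuous_on_add continuous_on_const
          continuous_touch_comp continuous_on_compose2[OF continuous_fwd[of UNIV]] subset_UNIV)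
    finally show "closed ((\<lambda>x. (x, nxt x)) ` {p..q})" .
    show "nxt \<in> {p..q} \<rightarrow> {p..q + pi}"
    proof
      fix x assume "x \<in> {p..q}"
      then show "nxt x \<in> {p..q + pi}" using nxt(1,2)[of x] by simp
    qed
  qed simp
qed

lemma continuous_prv: "continuous_on S prv"
proof (rule continuous_local)
  fix p q :: real
  show "continuous_on {p..q} prv"
  proof (rule continuous_from_closed_graph[of "{p - pi..q}"])
    have "(\<lambda>x. (x, prv x)) ` {p..q} =
      {x \<in> {p..q} \<times> {p - pi..q}. snd x \<le> fst x \<and> fst x - pi \<le> snd x \<and> touch (snd x) = bwd (fst x)}"
      using prv by (auto simp: image_iff less_imp_le intro!: prv_unique) (smt (verit, best) prv)+
    also have "\<dots> = ({p..q} \<times> {p - pi..q}) \<inter> ({x. snd x \<le> fst x} \<inter> ({x. fst x - pi \<le> snd x} \<inter> {x. touch (snd x) = bwd (fst x)}))"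
      by blast
    also have "closed \<dots>"
      by (intro closed_Int closed_Times closed_Collect_le closed_Collect_eq closed_atLeastAtMost
          continuous_on_fst continuous_on_snd continuous_on_id continuous_on_diff continuous_on_const
          continuous_touch_comp continuous_on_compose2[OF continuous_bwd[of UNIV]] subset_UNIV)
    finally show "closed ((\<lambda>x. (x, prv x)) ` {p..q})" .
    show "prv \<in> {p..q} \<rightarrow> {p - pi..q}"
    proof
      fix x assume "x \<in> {p..q}"
      then show "prv x \<in> {p - pi..q}" using prv(1,2)[of x] by simp
    qed
  qed simp
qed

end

section \<open>Quadratic forms along the unit circle\<close>

lemma periodic_int_shift:
  fixes g :: "real \<Rightarrow> 'b"
  assumes "\<And>x. g (x + pi) = g x"
  shows "g (x + of_int n * pi) = g x"
proof (induction n rule: int_induct[of _ 0])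
  case (step1 i)
  then show ?case using assms[of "x + of_int i * pi"] by (simp add: algebra_simps)
next
  case (step2 i)
  then show ?case using assms[of "x + of_int (i - 1) * pi"] by (simp add: algebra_simps)
qed simp

lemma ex_int_shift:
  obtains n :: int where "v \<le> t + of_int n * pi" "t + of_int n * pi < v + pi"
proof -
  define n where "n = - \<lfloor>(t - v) / pi\<rfloor>"
  have "of_int \<lfloor>(t - v) / pi\<rfloor> \<le> (t - v) / pi" "(t - v) / pi < of_int \<lfloor>(t - v) / pi\<rfloor> + 1"
    by linarith+
  then have "of_int \<lfloor>(t - v) / pi\<rfloor> * pi \<le> t - v" "t - v < (of_int \<lfloor>(t - v) / pi\<rfloor> + 1) * pi"
    by (simp_all only: pos_le_divide_eq pos_divide_less_eq pi_gt_zero)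
  then have "v \<le> t + of_int n * pi" "t + of_int n * pi < v + pi"
    by (simp_all add: n_def distrib_right)
  then show ?thesis by (rule that)
qed

text \<open>If \<open>b\<close> lies on the same rising branch, equal end values force constancy
  between; if it lies on the falling branch, the peak separates the arcs; if it lies on the next
  rising branch, monotonicity from \<open>b - pi\<close> to \<open>a\<close> makes the other arc
  constant.\<close>

lemma unimodal_alternatives_rising:
  fixes g :: "real \<Rightarrow> real"
  assumes per: "\<And>x. g (x + pi) = g x" and v: "v < p" "p < v + pi"
    and up: "\<And>s t. v \<le> s \<Longrightarrow> s \<le> t \<Longrightarrow> t \<le> p \<Longrightarrow> g s \<le> g t"
    and down: "\<And>s t. p \<le> s \<Longrightarrow> s \<le> t \<Longrightarrow> t \<le> v + pi \<Longrightarrow> g t \<le> g s"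
    and a: "v \<le> a" "a \<le> p" and b: "a < b" "b < a + pi" and eq: "g b = g a"
  shows "(\<forall>s\<in>{a..b}. g a \<le> g s) \<and> (\<forall>s\<in>{b..a+pi}. g s \<le> g a) \<or>
    (\<forall>s\<in>{a..b}. g s = g a) \<or> (\<forall>s\<in>{b..a+pi}. g s = g a)"
proof -
  have up': "g s \<le> g a" if "v + pi \<le> s" "s \<le> a + pi" for s
    using up[of "s - pi" a] per[of "s - pi"] that a by simp
  consider "b \<le> p" | "p \<le> b" "b \<le> v + pi" | "v + pi \<le> b" by linarith
  then show ?thesis
  proof cases
    case 1
    have "g s = g a" if "s \<in> {a..b}" for s
      using up[of a s] up[of s b] that 1 a eq by auto
    then show ?thesis by blast
  next
    case 2
    have "g a \<le> g s" if "s \<in> {a..b}" for s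
      using up[of a s] down[of s b] that 2 a eq by (cases "s \<le> p") auto
    moreover have "g s \<le> g a" if "s \<in> {b..a+pi}" for s
      using down[of b s] up'[of s] that 2 a eq by (cases "s \<le> v + pi") auto
    ultimately show ?thesis by blast
  next
    case 3
    have "g s = g a" if s: "s \<in> {b..a+pi}" for s
    proof -
      have "g (b - pi) \<le> g (s - pi)" using s 3 a by (intro up) auto
      then have "g b \<le> g s" using per[of "b - pi"] per[of "s - pi"] by simp
      then show ?thesis using up'[of s] s 3 eq by auto
    qed
    then show ?thesis by blast
  qed
qed

text \<open>Two points on one level cut the period into two arcs, one above and one below that level
  unless one of them is flat; \<open>\<tau>\<close> tells which is which. When \<open>a\<close> is
  on the falling branch, \<open>g\<close> is negated and the period starts at the peak
  \<open>p\<close>.\<close>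

lemma unimodal_alternatives:
  fixes g :: "real \<Rightarrow> real"
  assumes per: "\<And>x. g (x + pi) = g x" and v: "v < p" "p < v + pi"
    and up: "\<And>s t. v \<le> s \<Longrightarrow> s \<le> t \<Longrightarrow> t \<le> p \<Longrightarrow> g s \<le> g t"
    and down: "\<And>s t. p \<le> s \<Longrightarrow> s \<le> t \<Longrightarrow> t \<le> v + pi \<Longrightarrow> g t \<le> g s"
    and b: "a < b" "b < a + pi" and eq: "g b = g a"
  obtains (turn) \<tau> :: real where "\<tau> = 1 \<or> \<tau> = - 1"
      "\<And>s. a \<le> s \<Longrightarrow> s \<le> b \<Longrightarrow> \<tau> * g a \<le> \<tau> * g s"
      "\<And>s. b \<le> s \<Longrightarrow> s \<le> a + pi \<Longrightarrow> \<tau> * g s \<le> \<tau> * g a"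
  | (inner) "\<And>s. a \<le> s \<Longrightarrow> s \<le> b \<Longrightarrow> g s = g a"
  | (outer) "\<And>s. b \<le> s \<Longrightarrow> s \<le> a + pi \<Longrightarrow> g s = g a"
proof -
  obtain n :: int where n: "v \<le> a + of_int n * pi" "a + of_int n * pi < v + pi" by (rule ex_int_shift)
  define a' where "a' = a + of_int n * pi"
  define b' where "b' = b + of_int n * pi"
  note sh = periodic_int_shift[of g, OF per]
  have g': "g a' = g a" "g b' = g b" using sh by (auto simp: a'_def b'_def)
  have b': "a' < b'" "b' < a' + pi" "g b' = g a'" using b eq g' by (auto simp: a'_def b'_def)
  have tr: "P (g s)" if "\<forall>s\<in>{x + of_int n * pi..y + of_int n * pi}. P (g s)" "x \<le> s" "s \<le> y" for P x y s
    using bspec[OF that(1), of "s + of_int n * pi"] that(2,3) sh by auto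
  have ap: "a' + pi = (a + pi) + of_int n * pi" by (simp add: a'_def)
  show ?thesis
  proof (cases "a' \<le> p")
    case True
    have "(\<forall>s\<in>{a'..b'}. g a' \<le> g s) \<and> (\<forall>s\<in>{b'..a'+pi}. g s \<le> g a') \<or>
      (\<forall>s\<in>{a'..b'}. g s = g a') \<or> (\<forall>s\<in>{b'..a'+pi}. g s = g a')"
      using n True by (intro unimodal_alternatives_rising[where g = g, OF per v up down _ True b']) (auto simp: a'_def)
    then show ?thesis
    proof (elim disjE conjE)
      assume *: "\<forall>s\<in>{a'..b'}. g a' \<le> g s" "\<forall>s\<in>{b'..a'+pi}. g s \<le> g a'"
      show ?thesis
        using tr[OF *(1)[unfolded a'_def b'_def]] tr[OF *(2)[unfolded ap b'_def]] g'
        by (intro turn[of 1]) (auto simp: a'_def)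
    next
      assume *: "\<forall>s\<in>{a'..b'}. g s = g a'"
      show ?thesis using tr[OF *[unfolded a'_def b'_def]] g' by (intro inner) (auto simp: a'_def)
    next
      assume *: "\<forall>s\<in>{b'..a'+pi}. g s = g a'"
      show ?thesis using tr[OF *[unfolded ap b'_def]] g' by (intro outer) (auto simp: a'_def)
    qed
  next
    case False
    have "(\<forall>s\<in>{a'..b'}. - g a' \<le> - g s) \<and> (\<forall>s\<in>{b'..a'+pi}. - g s \<le> - g a') \<or>
      (\<forall>s\<in>{a'..b'}. - g s = - g a') \<or> (\<forall>s\<in>{b'..a'+pi}. - g s = - g a')"
    proof (rule unimodal_alternatives_rising[where g = "\<lambda>x. - g x" and v = p and p = "v + pi"])
      show "- g t \<le> - g s" if "v + pi \<le> s" "s \<le> t" "t \<le> p + pi" for s t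
        using up[of "s - pi" "t - pi"] per[of "s - pi"] per[of "t - pi"] that by simp
      show "- g s \<le> - g t" if "p \<le> s" "s \<le> t" "t \<le> v + pi" for s t using down that by simp
    qed (use per v False n b' in \<open>auto simp: a'_def\<close>)
    then show ?thesis
    proof (elim disjE conjE)
      assume *: "\<forall>s\<in>{a'..b'}. - g a' \<le> - g s" "\<forall>s\<in>{b'..a'+pi}. - g s \<le> - g a'"
      show ?thesis
        using tr[OF *(1)[unfolded a'_def b'_def]] tr[OF *(2)[unfolded ap b'_def]] g'
        by (intro turn[of "-1"]) (auto simp: a'_def)
    next
      assume *: "\<forall>s\<in>{a'..b'}. - g s = - g a'"
      show ?thesis using tr[OF *[unfolded a'_def b'_def]] g' by (intro inner) (auto simp: a'_def)
    next
      assume *: "\<forall>s\<in>{b'..a'+pi}. - g s = - g a'"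
      show ?thesis using tr[OF *[unfolded ap b'_def]] g' by (intro outer) (auto simp: a'_def)
    qed
  qed
qed

section \<open>Diagonal quadratic forms and their slopes\<close>

definition diag :: "real \<Rightarrow> real \<Rightarrow> complex \<Rightarrow> complex \<Rightarrow> real" where
  "diag \<kappa> \<mu> z w = \<kappa> * Re z * Re w + \<mu> * Im z * Im w"

lemma diag_linear:
  "diag \<kappa> \<mu> (z + z') w = diag \<kappa> \<mu> z w + diag \<kappa> \<mu> z' w"
  "diag \<kappa> \<mu> w (z + z') = diag \<kappa> \<mu> w z + diag \<kappa> \<mu> w z'"
  "diag \<kappa> \<mu> (z - z') w = diag \<kappa> \<mu> z w - diag \<kappa> \<mu> z' w"
  "diag \<kappa> \<mu> w (z - z') = diag \<kappa> \<mu> w z - diag \<kappa> \<mu> w z'"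
  "diag \<kappa> \<mu> (- z) w = - diag \<kappa> \<mu> z w"
  "diag \<kappa> \<mu> w (- z) = - diag \<kappa> \<mu> w z"
  "diag \<kappa> \<mu> (r *\<^sub>R z) w = r * diag \<kappa> \<mu> z w"
  "diag \<kappa> \<mu> w (r *\<^sub>R z) = r * diag \<kappa> \<mu> w z"
  by (simp_all add: diag_def algebra_simps)

lemma diag_commute: "diag \<kappa> \<mu> z w = diag \<kappa> \<mu> w z"
  by (simp add: diag_def)

lemma continuous_diag [continuous_intros]:
  fixes f :: "'a::t2_space \<Rightarrow> complex"
  shows "continuous_on S f \<Longrightarrow> continuous_on S g \<Longrightarrow> continuous_on S (\<lambda>x. diag \<kappa> \<mu> (f x) (g x))"
  unfolding diag_def by (intro continuous_intros)

context midpoint_plane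
begin

definition form_at :: "real \<Rightarrow> real \<Rightarrow> real \<Rightarrow> real" where
  "form_at \<kappa> \<mu> t = diag \<kappa> \<mu> (touch t) (touch t)"

text \<open>Half the derivative of the form at the point \<open>touch t\<close> in the tangent
  direction; no derivative of \<open>touch\<close> itself is involved.\<close>

definition slope_at :: "real \<Rightarrow> real \<Rightarrow> real \<Rightarrow> real" where
  "slope_at \<kappa> \<mu> t = diag \<kappa> \<mu> (touch t) (dir t)"

lemma continuous_form_at: "continuous_on S (form_at \<kappa> \<mu>)"
  unfolding form_at_def[abs_def] by (intro continuous_intros)

lemma continuous_slope_at: "continuous_on S (slope_at \<kappa> \<mu>)"
  unfolding slope_at_def[abs_def] by (intro continuous_intros)

lemma form_at_shift: "form_at \<kappa> \<mu> (t + pi) = form_at \<kappa> \<mu> t"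
  by (simp add: form_at_def touch_half_shift diag_linear)

lemma slope_at_shift: "slope_at \<kappa> \<mu> (t + pi) = slope_at \<kappa> \<mu> t"
  by (simp add: slope_at_def touch_half_shift diag_linear dir_add_pi)

lemma form_at_minus: "form_at (- \<kappa>) (- \<mu>) t = - form_at \<kappa> \<mu> t"
  by (simp add: form_at_def diag_def)

lemma slope_at_minus: "slope_at (- \<kappa>) (- \<mu>) t = - slope_at \<kappa> \<mu> t"
  by (simp add: slope_at_def diag_def)

text \<open>
  The key identity: by the midpoint property the chord from \<^term>\<open>bwd t\<close> to \<^term>\<open>fwd t\<close> has the
  direction of the tangent at its midpoint, so the increment of a quadratic form along the chord
  is its derivative along the unit circle at \<^term>\<open>touch t\<close>, up to a positive factor.
\<close>

lemma form_increment:
  "form_at \<kappa> \<mu> (nxt t) - form_at \<kappa> \<mu> (prv t) = 4 * \<rho> * half t * slope_at \<kappa> \<mu> t"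
proof -
  have "diag \<kappa> \<mu> (fwd t) (fwd t) - diag \<kappa> \<mu> (bwd t) (bwd t) = 4 * \<rho> * half t * diag \<kappa> \<mu> (touch t) (dir t)"
    unfolding fwd_def bwd_def by (simp add: diag_def algebra_simps)
  then show ?thesis by (simp add: form_at_def slope_at_def nxt prv)
qed

lemma slope_pos_iff: "0 < slope_at \<kappa> \<mu> t \<longleftrightarrow> form_at \<kappa> \<mu> (prv t) < form_at \<kappa> \<mu> (nxt t)"
  and slope_neg_iff: "slope_at \<kappa> \<mu> t < 0 \<longleftrightarrow> form_at \<kappa> \<mu> (nxt t) < form_at \<kappa> \<mu> (prv t)"
proof -
  define K where "K = 4 * \<rho> * half t"
  have K: "0 < K" using rho half_pos by (simp add: K_def)
  have "form_at \<kappa> \<mu> (nxt t) - form_at \<kappa> \<mu> (prv t) = K * slope_at \<kappa> \<mu> t"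
    unfolding form_increment K_def ..
  then have "0 < K * slope_at \<kappa> \<mu> t \<longleftrightarrow> form_at \<kappa> \<mu> (prv t) < form_at \<kappa> \<mu> (nxt t)"
    "K * slope_at \<kappa> \<mu> t < 0 \<longleftrightarrow> form_at \<kappa> \<mu> (nxt t) < form_at \<kappa> \<mu> (prv t)"
    by linarith+
  then show "0 < slope_at \<kappa> \<mu> t \<longleftrightarrow> form_at \<kappa> \<mu> (prv t) < form_at \<kappa> \<mu> (nxt t)"
    "slope_at \<kappa> \<mu> t < 0 \<longleftrightarrow> form_at \<kappa> \<mu> (nxt t) < form_at \<kappa> \<mu> (prv t)"
    using K by (simp_all add: zero_less_mult_iff mult_less_0_iff)
qed

text \<open>By polarisation the change over a short increment
  \<open>x *\<^sub>R dir t + y *\<^sub>R dir s\<close> is \<open>x * k1 s + y * k2 s\<close>. Both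
  factors are near the positive value assumed at \<open>t\<close>, and injectivity excludes
  \<open>x = y = 0\<close>. The linear term \<open>e\<close> serves the perturbation in
  \<open>form_mono\<close>.\<close>

lemma form_increasing_aux:
  assumes pos: "\<And>t. p < t \<Longrightarrow> t < q \<Longrightarrow> 0 < 2 * slope_at \<kappa> \<mu> t + inner e (dir t)"
    and "p \<le> s" "s < r" "r \<le> q"
  shows "form_at \<kappa> \<mu> s + inner e (touch s) < form_at \<kappa> \<mu> r + inner e (touch r)"
proof (rule strict_increase_from_right[OF _ _ assms(2-4)])
  show "continuous_on {p..q} (\<lambda>t. form_at \<kappa> \<mu> t + inner e (touch t))"
    by (intro continuous_intros continuous_form_at)
  fix t assume t: "p < t" "t < q"
  define k1 where "k1 = (\<lambda>s. diag \<kappa> \<mu> (touch t + touch s) (dir t) + inner e (dir t))"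
  define k2 where "k2 = (\<lambda>s. diag \<kappa> \<mu> (touch t + touch s) (dir s) + inner e (dir s))"
  have "continuous_on UNIV k1" "continuous_on UNIV k2"
    unfolding k1_def k2_def by (intro continuous_intros)+
  then have c: "k1 \<midarrow>t\<rightarrow> k1 t" "k2 \<midarrow>t\<rightarrow> k2 t"
    by (simp_all add: continuous_on_eq_continuous_at isCont_def)
  have p: "k1 t > 0" "k2 t > 0"
    using pos[OF t] by (simp_all add: k1_def k2_def slope_at_def diag_linear)
  have "\<forall>\<^sub>F x in at t. k1 x > 0 \<and> k2 x > 0"
    by (intro eventually_conj order_tendstoD(1)[OF c(1) p(1)] order_tendstoD(1)[OF c(2) p(2)])
  then obtain d where d: "d > 0" "\<forall>x\<in>UNIV. x \<noteq> t \<and> dist x t < d \<longrightarrow> k1 x > 0 \<and> k2 x > 0"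
    unfolding eventually_at by blast
  show "\<exists>d>0. \<forall>s. t < s \<and> s < t + d \<longrightarrow> form_at \<kappa> \<mu> t + inner e (touch t) < form_at \<kappa> \<mu> s + inner e (touch s)"
  proof (intro exI[of _ "min d pi"] conjI allI impI)
    fix s assume s: "t < s \<and> s < t + min d pi"
    then have s': "t < s" "s < t + pi" by linarith+
    have k: "k1 s > 0" "k2 s > 0"
      using bspec[OF d(2), of s] s by (auto simp: dist_real_def)
    obtain x y where xy: "x \<ge> 0" "y \<ge> 0" "touch s - touch t = x *\<^sub>R dir t + y *\<^sub>R dir s"
      by (rule supports_cone[OF supports_touch supports_touch s'])
    have "x \<noteq> 0 \<or> y \<noteq> 0" using xy(3) touch_inj_half_turn[OF s'] by auto
    have "(form_at \<kappa> \<mu> s + inner e (touch s)) - (form_at \<kappa> \<mu> t + inner e (touch t))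
      = diag \<kappa> \<mu> (touch t + touch s) (touch s - touch t) + inner e (touch s - touch t)"
      by (simp add: form_at_def diag_linear diag_commute[of \<kappa> \<mu> "touch s" "touch t"] inner_diff_right)
    also have "\<dots> = x * k1 s + y * k2 s"
      unfolding xy(3) by (simp add: k1_def k2_def diag_linear inner_add_right algebra_simps)
    also have "\<dots> > 0"
    proof (cases "x = 0")
      case True
      then show ?thesis using xy k \<open>x \<noteq> 0 \<or> y \<noteq> 0\<close> by simp
    next
      case False
      then show ?thesis using xy k by (intro add_pos_nonneg) simp_all
    qed
    finally show "form_at \<kappa> \<mu> t + inner e (touch t) < form_at \<kappa> \<mu> s + inner e (touch s)" by simp
  qed (use d in auto)
qed

lemma form_increasing:
  assumes "\<And>t. p < t \<Longrightarrow> t < q \<Longrightarrow> 0 < slope_at \<kappa> \<mu> t" "p \<le> s" "s < r" "r \<le> q"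
  shows "form_at \<kappa> \<mu> s < form_at \<kappa> \<mu> r"
  using form_increasing_aux[where e = 0 and p = p and q = q] assms by simp

lemma form_decreasing:
  assumes "\<And>t. p < t \<Longrightarrow> t < q \<Longrightarrow> slope_at \<kappa> \<mu> t < 0" "p \<le> s" "s < r" "r \<le> q"
  shows "form_at \<kappa> \<mu> r < form_at \<kappa> \<mu> s"
  using form_increasing[of p q "- \<kappa>" "- \<mu>" s r] assms by (simp add: form_at_minus slope_at_minus)

text \<open>The form is tilted by a small multiple of the linear functional of \<open>dir m\<close>,
  where \<open>m\<close> is the middle angle. The tilt contributes
  \<open>\<eta> * cos (t - m)\<close> to the derivative, positive because the range is shorter than
  \<open>pi\<close>, so the strict version applies.\<close>

lemma form_mono:
  assumes nonneg: "\<And>t. p < t \<Longrightarrow> t < q \<Longrightarrow> 0 \<le> slope_at \<kappa> \<mu> t" and pq: "p \<le> q" "q < p + pi"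
  shows "form_at \<kappa> \<mu> p \<le> form_at \<kappa> \<mu> q"
proof (cases "p = q")
  case False
  define m where "m = (p + q) / 2"
  define C where "C = inner (dir m) (touch q - touch p)"
  have less: "form_at \<kappa> \<mu> p < form_at \<kappa> \<mu> q + \<eta> * C" if "\<eta> > 0" for \<eta>
  proof -
    have "0 < 2 * slope_at \<kappa> \<mu> t + inner (\<eta> *\<^sub>R dir m) (dir t)" if "p < t" "t < q" for t
    proof -
      have "cos (t - m) > 0" using that pq by (intro cos_gt_zero_pi) (auto simp: m_def field_simps)
      then show ?thesis using nonneg[OF that] \<open>\<eta> > 0\<close> by (simp add: inner_dir_dir add_nonneg_pos)
    qed
    from form_increasing_aux[OF this, of p q] show ?thesis
      using False pq by (simp add: C_def inner_diff_right algebra_simps)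
  qed
  show ?thesis
  proof (rule ccontr)
    assume "\<not> ?thesis"
    then have D: "form_at \<kappa> \<mu> p - form_at \<kappa> \<mu> q > 0" (is "?D > 0") by simp
    \<comment> \<open>Small enough that \<open>\<eta> * C\<close> stays below the supposed
      drop.\<close>
    define \<eta> where "\<eta> = ?D / (\<bar>C\<bar> + 1)"
    have "\<eta> > 0" using D by (simp add: \<eta>_def)
    moreover have "\<eta> * C \<le> \<eta> * \<bar>C\<bar>" using calculation by (intro mult_left_mono) auto
    moreover have "\<bar>C\<bar> + 1 \<noteq> 0" by linarith
    then have "\<eta> * (\<bar>C\<bar> + 1) = ?D" by (simp add: \<eta>_def)
    then have "\<eta> * \<bar>C\<bar> + \<eta> = ?D" by (simp add: distrib_left)
    ultimately show False using less[of \<eta>] by linarith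
  qed
qed simp

lemma form_antimono:
  assumes "\<And>t. p < t \<Longrightarrow> t < q \<Longrightarrow> slope_at \<kappa> \<mu> t \<le> 0" "p \<le> q" "q < p + pi"
  shows "form_at \<kappa> \<mu> q \<le> form_at \<kappa> \<mu> p"
  using form_mono[of p q "- \<kappa>" "- \<mu>"] assms by (simp add: form_at_minus slope_at_minus)

section \<open>The contact points with the square and the chords belonging to them\<close>

lemma touch_zero: "touch 0 = 1"
proof -
  have "wedge z (dir 0) \<le> N z * wedge 1 (dir 0)" for z
    using Re_le[of z] by (simp add: wedge_def)
  then have "supports 0 1" by (simp add: supports_def N_one)
  then show ?thesis by (rule supports_unique[symmetric])
qed

lemma touch_pi_half: "touch (pi/2) = \<i>"
proof -
  have "wedge z (dir (pi/2)) \<le> N z * wedge \<i> (dir (pi/2))" for z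
    using Im_le[of z] by (simp add: wedge_def)
  then have "supports (pi/2) \<i>" by (simp add: supports_def N_ii)
  then show ?thesis by (rule supports_unique[symmetric])
qed

lemma Im_touch_pos: "0 < t \<Longrightarrow> t < pi \<Longrightarrow> 0 < Im (touch t)"
  using wedge_touch_pos[of 0 t] by (simp add: touch_zero wedge_def)

lemma Im_touch_neg: "- pi < t \<Longrightarrow> t < 0 \<Longrightarrow> Im (touch t) < 0"
  using wedge_touch_pos[of t 0] by (simp add: touch_zero wedge_def)

lemma Re_touch_pos: "- pi/2 < t \<Longrightarrow> t < pi/2 \<Longrightarrow> 0 < Re (touch t)"
  using wedge_touch_pos[of t "pi/2"] by (simp add: touch_pi_half wedge_def)

lemma Re_touch_neg: "pi/2 < t \<Longrightarrow> t < 3*pi/2 \<Longrightarrow> Re (touch t) < 0"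
  using wedge_touch_pos[of "pi/2" t] by (simp add: touch_pi_half wedge_def)

lemma slope_at_zero: "slope_at \<kappa> \<mu> 0 = 0"
  and slope_at_pi_half: "slope_at \<kappa> \<mu> (pi/2) = 0"
  by (simp_all add: slope_at_def diag_def touch_zero touch_pi_half)

text \<open>The chord of direction 0 lies on the vertical line of abscissa
  \<open>\<rho> > 0\<close>, so its ends stay in the right half plane.\<close>

lemma nxt_zero: "0 < nxt 0" "nxt 0 < pi/2"
proof -
  show "0 < nxt 0" by (rule nxt)
  have "Re (touch (nxt 0)) = \<rho>" by (simp add: nxt fwd_def touch_zero)
  then show "nxt 0 < pi/2"
    using Re_touch_neg[of "nxt 0"] nxt[of 0] rho touch_pi_half by (cases "nxt 0" "pi/2" rule: linorder_cases) auto
qed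

lemma prv_zero: "- pi/2 < prv 0" "prv 0 < 0"
proof -
  show "prv 0 < 0" by (rule prv)
  have r: "Re (touch (prv 0)) = \<rho>" by (simp add: prv bwd_def touch_zero)
  show "- pi/2 < prv 0"
  proof (rule ccontr)
    assume "\<not> - pi/2 < prv 0"
    then consider "prv 0 + pi = pi/2" | "prv 0 + pi < pi/2" by (auto simp: field_simps) argo
    then have "Re (touch (prv 0 + pi)) \<ge> 0"
    proof cases
      case 1
      then show ?thesis by (simp only: touch_pi_half) simp
    next
      case 2
      then show ?thesis using Re_touch_pos[of "prv 0 + pi"] prv(1)[of 0] pi_gt_zero by simp
    qed
    then show False using r rho by (simp add: touch_half_shift)
  qed
qed

lemma nxt_pi_half: "pi/2 < nxt (pi/2)" "nxt (pi/2) < pi"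
proof -
  show "pi/2 < nxt (pi/2)" by (rule nxt)
  have r: "Im (touch (nxt (pi/2))) = \<rho>" by (simp add: nxt fwd_def touch_pi_half)
  show "nxt (pi/2) < pi"
  proof (rule ccontr)
    assume "\<not> nxt (pi/2) < pi"
    then consider "nxt (pi/2) - pi = 0" | "0 < nxt (pi/2) - pi" by linarith
    then have "Im (touch (nxt (pi/2) - pi)) \<ge> 0"
      using Im_touch_pos[of "nxt (pi/2) - pi"] nxt(2)[of "pi/2"] touch_zero pi_gt_zero by cases (auto simp: less_imp_le)
    then show False using r rho touch_half_shift(1)[of "nxt (pi/2) - pi"] by simp
  qed
qed

lemma prv_pi_half: "0 < prv (pi/2)" "prv (pi/2) < pi/2"
proof -
  show "prv (pi/2) < pi/2" by (rule prv)
  have r: "Im (touch (prv (pi/2))) = \<rho>" by (simp add: prv bwd_def touch_pi_half)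
  show "0 < prv (pi/2)"
    using Im_touch_neg[of "prv (pi/2)"] prv(1)[of "pi/2"] r rho touch_zero pi_gt_zero
    by (cases "prv (pi/2)" "0::real" rule: linorder_cases) auto
qed

lemma slope_at_add: "slope_at (\<kappa> + \<kappa>') \<mu> t = slope_at \<kappa> \<mu> t - \<kappa>' * (Re (touch t) * sin t)"
  by (simp add: slope_at_def diag_def algebra_simps)

lemma slope_at_perturb: "\<bar>slope_at \<kappa>' \<mu> t - slope_at \<kappa> \<mu> t\<bar> \<le> \<bar>\<kappa>' - \<kappa>\<bar>"
proof -
  have "\<bar>Re (touch t)\<bar> * \<bar>sin t\<bar> \<le> 1 * 1"
    using Re_le[of "touch t"] N_touch[of t] by (intro mult_mono) auto
  then have "\<bar>\<kappa>' - \<kappa>\<bar> * (\<bar>Re (touch t)\<bar> * \<bar>sin t\<bar>) \<le> \<bar>\<kappa>' - \<kappa>\<bar> * 1"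
    by (intro mult_left_mono) auto
  then show ?thesis using slope_at_add[of \<kappa> "\<kappa>' - \<kappa>" \<mu> t] by (simp add: abs_mult)
qed

end

section \<open>Plateaus of an extremal form\<close>

text \<open>\<open>(C, S)\<close> and \<open>(C', S')\<close> lie on the upper half of one ellipse,
  and the determinant puts the second at the larger angle; there the abscissa decreases with the
  angle.\<close>

lemma cosine_less:
  fixes e :: real
  assumes "0 < e" "C\<^sup>2 + e * S\<^sup>2 = C'\<^sup>2 + e * S'\<^sup>2" "0 \<le> S" "0 \<le> S'" "0 < C * S' - C' * S"
  shows "C' < C"
proof (rule ccontr)
  assume "\<not> C' < C"
  then have le: "C \<le> C'" by simp
  consider "0 \<le> C" | "C \<le> 0" "0 \<le> C'" | "C' \<le> 0" using le by linarith
  then show False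
  proof cases
    case 1
    then have "C\<^sup>2 \<le> C'\<^sup>2" using le by (intro power_mono) auto
    then have "e * S'\<^sup>2 \<le> e * S\<^sup>2" using assms(2) by linarith
    then have "S'\<^sup>2 \<le> S\<^sup>2" using assms(1) by simp
    then have "S' \<le> S" using assms(3) by (rule power2_le_imp_le)
    then have "C * S' \<le> C' * S" using 1 le assms by (intro mult_mono) auto
    then show False using assms(5) by simp
  next
    case 2
    then have "C * S' \<le> 0" "0 \<le> C' * S" using assms by (simp_all add: mult_nonpos_nonneg)
    then show False using assms(5) by simp
  next
    case 3
    then have "(- C')\<^sup>2 \<le> (- C)\<^sup>2" using le by (intro power_mono) auto
    then have "C'\<^sup>2 \<le> C\<^sup>2" by simp
    then have "e * S\<^sup>2 \<le> e * S'\<^sup>2" using assms(2) by linarith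
    then have "S\<^sup>2 \<le> S'\<^sup>2" using assms(1) by simp
    then have "S \<le> S'" using assms(4) by (rule power2_le_imp_le)
    then have "(- C') * S \<le> (- C) * S'" using 3 le assms by (intro mult_mono) auto
    then show False using assms(5) by simp
  qed
qed

text \<open>With \<open>0 < e\<close> the form is positive definite, so that angles make sense; with
  \<open>e < 1\<close> its values at the two kinds of turning points differ.\<close>

locale extremal_form = midpoint_plane +
  fixes e :: real
  assumes e_pos: "0 < e" and e_less: "e < 1"
    and rise: "\<And>t. 0 \<le> t \<Longrightarrow> t \<le> pi/2 \<Longrightarrow> 0 \<le> slope_at e 1 t"
    and fall: "\<And>t. pi/2 \<le> t \<Longrightarrow> t \<le> pi \<Longrightarrow> slope_at e 1 t \<le> 0"
begin

abbreviation G :: "real \<Rightarrow> real" where "G \<equiv> form_at e 1"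
abbreviation F :: "real \<Rightarrow> real" where "F \<equiv> slope_at e 1"

lemma G_up:
  assumes "0 \<le> s" "s \<le> t" "t \<le> pi/2"
  shows "G s \<le> G t"
proof (rule form_mono)
  show "t < s + pi" using assms pi_half_gt_zero by linarith
qed (use assms in \<open>auto intro: rise\<close>)

lemma G_down:
  assumes "pi/2 \<le> s" "s \<le> t" "t \<le> pi"
  shows "G t \<le> G s"
proof (rule form_antimono)
  show "t < s + pi" using assms pi_half_gt_zero by linarith
qed (use assms in \<open>auto intro: fall\<close>)

lemma G_zero: "G 0 = e" and G_pi_half: "G (pi/2) = 1"
  by (simp_all add: form_at_def diag_def touch_zero touch_pi_half)

lemma G_pos: "0 < G t"
proof -
  have "touch t \<noteq> 0" using N_touch[of t] N_zero by auto
  then have "Re (touch t) \<noteq> 0 \<or> Im (touch t) \<noteq> 0" by (simp add: complex_eq_iff)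
  then have "0 < e * (Re (touch t))\<^sup>2 + (Im (touch t))\<^sup>2"
    using e_pos by (auto intro: add_pos_nonneg add_nonneg_pos)
  then show ?thesis by (simp add: form_at_def diag_def power2_eq_square mult.assoc)
qed

lemma G_int_shift: "G (t + of_int n * pi) = G t"
  by (rule periodic_int_shift) (rule form_at_shift)

section \<open>Zeros of the slope as chords with both ends on one level\<close>

lemma F_eq_0_iff: "F t = 0 \<longleftrightarrow> G (nxt t) = G (prv t)"
  using slope_pos_iff[of e 1 t] slope_neg_iff[of e 1 t] by linarith

lemma signed_F_le_0_iff: "\<tau> = 1 \<or> \<tau> = - 1 \<Longrightarrow> \<tau> * F t \<le> 0 \<longleftrightarrow> \<tau> * G (nxt t) \<le> \<tau> * G (prv t)"
  using slope_pos_iff[of e 1 t] slope_neg_iff[of e 1 t] by auto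

lemma signed_F_ge_0_iff: "\<tau> = 1 \<or> \<tau> = - 1 \<Longrightarrow> 0 \<le> \<tau> * F t \<longleftrightarrow> \<tau> * G (prv t) \<le> \<tau> * G (nxt t)"
  using slope_pos_iff[of e 1 t] slope_neg_iff[of e 1 t] by auto

lemma zero_alternatives:
  assumes "F t = 0"
  obtains (turn) \<tau> :: real where "\<tau> = 1 \<or> \<tau> = - 1"
      "\<And>s. prv t \<le> s \<Longrightarrow> s \<le> nxt t \<Longrightarrow> \<tau> * G (prv t) \<le> \<tau> * G s"
      "\<And>s. nxt t \<le> s \<Longrightarrow> s \<le> prv t + pi \<Longrightarrow> \<tau> * G s \<le> \<tau> * G (prv t)"
  | (inner) "\<And>s. prv t \<le> s \<Longrightarrow> s \<le> nxt t \<Longrightarrow> G s = G (prv t)"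
  | (outer) "\<And>s. nxt t \<le> s \<Longrightarrow> s \<le> prv t + pi \<Longrightarrow> G s = G (prv t)"
proof (rule unimodal_alternatives[of G 0 "pi/2" "prv t" "nxt t"])
  show "G (x + pi) = G x" for x by (rule form_at_shift)
  show "G s \<le> G t" if "0 \<le> s" "s \<le> t" "t \<le> pi/2" for s t using G_up that by blast
  show "G t \<le> G s" if "pi/2 \<le> s" "s \<le> t" "t \<le> 0 + pi" for s t using G_down that by simp
  show "prv t < nxt t" using prv(2)[of t] nxt(1)[of t] by simp
  show "G (nxt t) = G (prv t)" using assms F_eq_0_iff by blast
  show "nxt t < prv t + pi" by (rule nxt_less_prv)
  show "0 < pi/2" "pi/2 < 0 + pi" using pi_gt_zero by simp_all
next
  fix \<tau> :: real
  assume *: "\<tau> = 1 \<or> \<tau> = - 1"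
    "\<And>s. prv t \<le> s \<Longrightarrow> s \<le> nxt t \<Longrightarrow> \<tau> * G (prv t) \<le> \<tau> * G s"
    "\<And>s. nxt t \<le> s \<Longrightarrow> s \<le> prv t + pi \<Longrightarrow> \<tau> * G s \<le> \<tau> * G (prv t)"
  show thesis by (rule turn[OF *])
next
  assume "\<And>s. prv t \<le> s \<Longrightarrow> s \<le> nxt t \<Longrightarrow> G s = G (prv t)"
  then show thesis by (rule inner)
next
  assume "\<And>s. nxt t \<le> s \<Longrightarrow> s \<le> prv t + pi \<Longrightarrow> G s = G (prv t)"
  then show thesis by (rule outer)
qed

lemma window:
  obtains \<delta> where "\<delta> > 0"
    "\<And>s. \<bar>s - t\<bar> < \<delta> \<Longrightarrow> prv s < nxt t \<and> nxt s < prv t + pi \<and> prv t < nxt s \<and> nxt t < prv s + pi"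
proof -
  have c: "nxt \<midarrow>t\<rightarrow> nxt t" "prv \<midarrow>t\<rightarrow> prv t"
    using continuous_nxt[of UNIV] continuous_prv[of UNIV]
    by (simp_all add: continuous_on_eq_continuous_at isCont_def)
  have p: "prv t < nxt t" using prv(2)[of t] nxt(1)[of t] by simp
  have q: "nxt t - pi < prv t" "nxt t < prv t + pi" using nxt_less_prv[of t] by auto
  have "\<forall>\<^sub>F s in at t. (prv s < nxt t \<and> nxt s < prv t + pi) \<and> (prv t < nxt s \<and> nxt t - pi < prv s)"
    by (intro eventually_conj order_tendstoD(1)[OF c(1) p] order_tendstoD(1)[OF c(2) q(1)]
        order_tendstoD(2)[OF c(1) q(2)] order_tendstoD(2)[OF c(2) p])
  then obtain d where d: "d > 0" "\<forall>s\<in>UNIV. s \<noteq> t \<and> dist s t < d \<longrightarrow>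
      (prv s < nxt t \<and> nxt s < prv t + pi) \<and> (prv t < nxt s \<and> nxt t - pi < prv s)"
    unfolding eventually_at by blast
  show ?thesis
  proof (rule that[OF d(1)])
    fix s assume "\<bar>s - t\<bar> < d"
    then show "prv s < nxt t \<and> nxt s < prv t + pi \<and> prv t < nxt s \<and> nxt t < prv s + pi"
      using bspec[OF d(2), of s] p q by (cases "s = t") (auto simp: dist_real_def)
  qed
qed

text \<open>For \<open>\<tau> = 1\<close>: when the chord turns forward, its front end enters the
  low arc and its rear end the high arc, so the increment along it becomes nonpositive; turning
  backward exchanges the roles.\<close>

lemma turn_sign:
  assumes tau: "\<tau> = 1 \<or> \<tau> = - 1" and zero: "F t = 0"
    and H1: "\<And>s. prv t \<le> s \<Longrightarrow> s \<le> nxt t \<Longrightarrow> \<tau> * G (prv t) \<le> \<tau> * G s"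
    and H2: "\<And>s. nxt t \<le> s \<Longrightarrow> s \<le> prv t + pi \<Longrightarrow> \<tau> * G s \<le> \<tau> * G (prv t)"
  shows "\<exists>\<delta>>0. (\<forall>s. t \<le> s \<longrightarrow> s < t + \<delta> \<longrightarrow> \<tau> * F s \<le> 0) \<and>
    (\<forall>s. t - \<delta> < s \<longrightarrow> s \<le> t \<longrightarrow> 0 \<le> \<tau> * F s)"
proof -
  obtain \<delta> where \<delta>: "\<delta> > 0"
    "\<And>s. \<bar>s - t\<bar> < \<delta> \<Longrightarrow> prv s < nxt t \<and> nxt s < prv t + pi \<and> prv t < nxt s \<and> nxt t < prv s + pi"
    using window[of t] by blast
  have mono: "prv s \<le> prv s'" "nxt s \<le> nxt s'" if "s \<le> s'" for s s'
    using prv_less[of s s'] nxt_less[of s s'] that by (cases "s = s'"; simp)+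
  have "\<tau> * F s \<le> 0" if s: "t \<le> s" "s < t + \<delta>" for s
  proof -
    have w: "prv s < nxt t" "nxt s < prv t + pi" using \<delta>(2)[of s] s by auto
    have "\<tau> * G (nxt s) \<le> \<tau> * G (prv t)" using w mono(2)[OF s(1)] by (intro H2) auto
    also have "\<dots> \<le> \<tau> * G (prv s)" using w mono(1)[OF s(1)] by (intro H1) auto
    finally show ?thesis using signed_F_le_0_iff[OF tau] by blast
  qed
  moreover have "0 \<le> \<tau> * F s" if s: "t - \<delta> < s" "s \<le> t" for s
  proof -
    have w: "prv t < nxt s" "nxt t < prv s + pi" using \<delta>(2)[of s] s by auto
    have "\<tau> * G (prv s) = \<tau> * G (prv s + pi)" by (simp add: form_at_shift)
    also have "\<dots> \<le> \<tau> * G (prv t)" using w mono(1)[OF s(2)] by (intro H2) auto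
    also have "\<dots> \<le> \<tau> * G (nxt s)" using w mono(2)[OF s(2)] by (intro H1) auto
    finally show ?thesis using signed_F_ge_0_iff[OF tau] by blast
  qed
  ultimately show ?thesis using \<delta>(1) by blast
qed

section \<open>Plateaus and their elliptic length\<close>

definition plateau :: "real \<Rightarrow> real \<Rightarrow> bool" where
  "plateau p q \<longleftrightarrow> p \<le> q \<and> (\<forall>t. p \<le> t \<longrightarrow> t \<le> q \<longrightarrow> G t = G p)"

lemma plateauD: "plateau p q \<Longrightarrow> p \<le> t \<Longrightarrow> t \<le> q \<Longrightarrow> G t = G p"
  unfolding plateau_def by blast

lemma plateauI: "p \<le> q \<Longrightarrow> (\<And>t. p \<le> t \<Longrightarrow> t \<le> q \<Longrightarrow> G t = G p) \<Longrightarrow> plateau p q"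
  unfolding plateau_def by blast

lemma plateau_le: "plateau p q \<Longrightarrow> p \<le> q"
  unfolding plateau_def by blast

text \<open>A nonzero slope would persist nearby and make \<open>G\<close> strictly monotone on a
  subinterval of the plateau.\<close>

lemma plateau_zero:
  assumes "plateau p q" "p < q" "p \<le> t" "t \<le> q"
  shows "F t = 0"
proof (rule ccontr)
  assume nz: "F t \<noteq> 0"
  have "isCont F t"
    using continuous_slope_at[of UNIV e 1] by (simp add: continuous_on_eq_continuous_at)
  then obtain d where d: "d > 0" "\<And>s. \<bar>s - t\<bar> < d \<Longrightarrow> \<bar>F s - F t\<bar> < \<bar>F t\<bar>"
    unfolding continuous_at_eps_delta dist_real_def using nz by (metis zero_less_abs_iff)
  define l where "l = max p (t - d)"
  define r where "r = min q (t + d)"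
  have lr: "l < r" "p \<le> l" "r \<le> q" using assms d(1) by (auto simp: l_def r_def)
  have near: "\<bar>F s - F t\<bar> < \<bar>F t\<bar>" if "l < s" "s < r" for s
    using that by (intro d(2)) (auto simp: l_def r_def)
  have "G l = G r" using plateauD[OF assms(1), of l] plateauD[OF assms(1), of r] lr by auto
  moreover have "G l \<noteq> G r"
  proof (cases "F t > 0")
    case True
    then have "0 < F s" if "l < s" "s < r" for s using near[OF that] by linarith
    then have "G l < G r" by (rule form_increasing[of l r]) (use lr in auto)
    then show ?thesis by simp
  next
    case False
    then have "F s < 0" if "l < s" "s < r" for s using near[OF that] nz by linarith
    then have "G r < G l" by (rule form_decreasing[of l r]) (use lr in auto)
    then show ?thesis by simp
  qed
  ultimately show False by simp
qed

lemma zero_plateau: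
  assumes "p \<le> q" "q < p + pi" "\<And>t. p < t \<Longrightarrow> t < q \<Longrightarrow> F t = 0"
  shows "plateau p q"
proof -
  have "G t = G p" if t: "p \<le> t" "t \<le> q" for t
  proof (rule antisym)
    have zero: "F s = 0" if "p < s" "s < t" for s
      by (rule assms(3)) (use that t in linarith)+
    have len: "t < p + pi" using t assms(2) by linarith
    show "G t \<le> G p" by (rule form_antimono[OF _ t(1) len]) (simp add: zero)
    show "G p \<le> G t" by (rule form_mono[OF _ t(1) len]) (simp add: zero)
  qed
  with assms(1) show ?thesis by (rule plateauI)
qed

text \<open>Constancy over half a turn would spread by periodicity to the turning values
  \<open>e\<close> and \<open>1\<close>.\<close>

lemma plateau_less_pi:
  assumes "plateau p q"
  shows "q < p + pi"
proof (rule ccontr)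
  assume *: "\<not> q < p + pi"
  have "G t = G p" for t
  proof -
    obtain n :: int where n: "p \<le> t + of_int n * pi" "t + of_int n * pi < p + pi" by (rule ex_int_shift)
    have "G t = G (t + of_int n * pi)" by (rule G_int_shift[symmetric])
    also have "\<dots> = G p" using n * by (intro plateauD[OF assms]) auto
    finally show ?thesis .
  qed
  from this[of 0] this[of "pi/2"] show False using G_zero G_pi_half e_less by simp
qed

lemma plateau_int_shift:
  assumes "plateau p q"
  shows "plateau (p + of_int n * pi) (q + of_int n * pi)"
proof (rule plateauI)
  fix t assume t: "p + of_int n * pi \<le> t" "t \<le> q + of_int n * pi"
  have "G t = G (t - of_int n * pi)" 
    using G_int_shift[of "t - of_int n * pi" n] by simp
  also have "\<dots> = G p" using t by (intro plateauD[OF assms]) auto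
  also have "\<dots> = G (p + of_int n * pi)" by (rule G_int_shift[symmetric])
  finally show "G t = G (p + of_int n * pi)" .
qed (use plateau_le[OF assms] in simp)

text \<open>For points on one level, the cosine of their angle in the inner product
  \<open>diag e 1\<close>. Division by the level makes arcs on different levels comparable; longer
  arcs have smaller overlap.\<close>

definition overlap :: "real \<Rightarrow> real \<Rightarrow> real" where
  "overlap p q = diag e 1 (touch p) (touch q) / G p"

lemma overlap_int_shift: "overlap (p + of_int n * pi) (q + of_int n * pi) = overlap p q"
proof -
  have "overlap (p + (x + pi)) (q + (x + pi)) = overlap (p + x) (q + x)" for x
    using touch_half_shift(1)[of "p + x"] touch_half_shift(1)[of "q + x"] form_at_shift[of e 1 "p + x"]
    by (simp add: overlap_def diag_linear add.assoc)
  from periodic_int_shift[of "\<lambda>x. overlap (p + x) (q + x)" 0 n, OF this]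
  show ?thesis by simp
qed

text \<open>Lagrange's identity for a form of determinant \<open>e\<close>, and the subtraction
  formula for the sine, with \<open>diag\<close> as cosine and \<open>wedge\<close> as sine.\<close>

lemma form_identities:
  "(diag e 1 z w)\<^sup>2 + e * (wedge z w)\<^sup>2 = diag e 1 z z * diag e 1 w w"
  "diag e 1 z w * wedge z w' - diag e 1 z w' * wedge z w = diag e 1 z z * wedge w w'"
  by (simp_all add: diag_def wedge_def power2_eq_square algebra_simps)

text \<open>Over a plateau the circle runs along an ellipse for less than half a turn, so shortening
  the arc at either end raises the cosine.\<close>

lemma plateau_diag_less:
  assumes "plateau p q"
  shows "p \<le> r \<Longrightarrow> r < q \<Longrightarrow> diag e 1 (touch p) (touch q) < diag e 1 (touch p) (touch r)"
    and "p < r \<Longrightarrow> r \<le> q \<Longrightarrow> diag e 1 (touch p) (touch q) < diag e 1 (touch r) (touch q)"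
proof -
  note len = plateau_less_pi[OF assms]
  have G: "diag e 1 (touch s) (touch s) = G p" if "p \<le> s" "s \<le> q" for s
    using plateauD[OF assms that] by (simp add: form_at_def)
  {
    assume r: "p \<le> r" "r < q"
    show "diag e 1 (touch p) (touch q) < diag e 1 (touch p) (touch r)"
    proof (rule cosine_less[OF e_pos])
      show "(diag e 1 (touch p) (touch r))\<^sup>2 + e * (wedge (touch p) (touch r))\<^sup>2 =
        (diag e 1 (touch p) (touch q))\<^sup>2 + e * (wedge (touch p) (touch q))\<^sup>2"
        using G[of p] G[of q] G[of r] r by (simp add: form_identities)
      show "0 \<le> wedge (touch p) (touch r)" "0 \<le> wedge (touch p) (touch q)"
        using r len by (auto intro!: wedge_touch_nonneg)
      have "0 < wedge (touch r) (touch q)" using r len by (intro wedge_touch_pos) auto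
      then show "0 < diag e 1 (touch p) (touch r) * wedge (touch p) (touch q) -
          diag e 1 (touch p) (touch q) * wedge (touch p) (touch r)"
        unfolding form_identities using G[of p] G_pos[of p] r by simp
    qed
  next
    assume r: "p < r" "r \<le> q"
    show "diag e 1 (touch p) (touch q) < diag e 1 (touch r) (touch q)"
    proof (rule cosine_less[OF e_pos])
      show "(diag e 1 (touch r) (touch q))\<^sup>2 + e * (wedge (touch r) (touch q))\<^sup>2 =
        (diag e 1 (touch p) (touch q))\<^sup>2 + e * (wedge (touch p) (touch q))\<^sup>2"
        using G[of p] G[of q] G[of r] r by (simp add: form_identities)
      show "0 \<le> wedge (touch r) (touch q)" "0 \<le> wedge (touch p) (touch q)"
        using r len by (auto intro!: wedge_touch_nonneg)
      have "0 < wedge (touch p) (touch r)" using r len by (intro wedge_touch_pos) auto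
      then have "0 < diag e 1 (touch q) (touch q) * wedge (touch p) (touch r)"
        using G[of q] G_pos[of p] r by simp
      then show "0 < diag e 1 (touch r) (touch q) * wedge (touch p) (touch q) -
          diag e 1 (touch p) (touch q) * wedge (touch r) (touch q)"
        by (simp add: diag_def wedge_def algebra_simps)
    qed
  }
qed

text \<open>Length is the elliptic angle, hence minimal overlap, and not \<open>q - p\<close>: the
  chord maps preserve the former.\<close>

definition longest :: "real \<Rightarrow> real \<Rightarrow> bool" where
  "longest p q \<longleftrightarrow> p < q \<and> plateau p q \<and> (\<forall>p' q'. plateau p' q' \<longrightarrow> overlap p q \<le> overlap p' q')"

lemma longestD:
  assumes "longest p q"
  shows "p < q" "plateau p q" "plateau p' q' \<Longrightarrow> overlap p q \<le> overlap p' q'"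
  using assms unfolding longest_def by blast+

lemma longest_int_shift: "longest p q \<Longrightarrow> longest (p + of_int n * pi) (q + of_int n * pi)"
  unfolding longest_def overlap_int_shift using plateau_int_shift by simp

text \<open>Plateaus that meet share their level, so their hull is a plateau; a proper extension at
  either end would lower the overlap.\<close>

lemma longest_absorbs:
  assumes "longest p q" "plateau p' q'" "p' \<le> q" "p \<le> q'"
  shows "p \<le> p'" "q' \<le> q"
proof -
  define P where "P = min p p'"
  define Q where "Q = max q q'"
  define m where "m = max p p'"
  note L = longestD[OF assms(1)]
  have "p' \<le> q'" by (rule plateau_le[OF assms(2)])
  then have m: "p \<le> m" "p' \<le> m" "m \<le> q" "m \<le> q'" using L(1) assms by (auto simp: m_def)
  have eq: "G p = G p'" using plateauD[OF L(2) m(1,3)] plateauD[OF assms(2) m(2,4)] by simp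
  have G: "G t = G p" if "P \<le> t" "t \<le> Q" for t
  proof -
    have "p \<le> t \<and> t \<le> q \<or> p' \<le> t \<and> t \<le> q'"
      using that assms L(1) \<open>p' \<le> q'\<close> by (auto simp: P_def Q_def min_def max_def split: if_splits)
    then show ?thesis using plateauD[OF L(2), of t] plateauD[OF assms(2), of t] eq by auto
  qed
  have PQ: "P \<le> p" "q \<le> Q" "P \<le> Q" using L(1) by (auto simp: P_def Q_def)
  have GP: "G P = G p" by (rule G) (use PQ in auto)
  have plat: "plateau P Q" 
    by (rule plateauI[OF PQ(3)]) (use G GP in metis)
  \<comment> \<open>An intermediate arc, since \<open>plateau_diag_less\<close> moves one end at a
    time.\<close>
  have plat': "plateau P q"
  proof (rule plateauI)
    show "G t = G P" if "P \<le> t" "t \<le> q" for t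
      by (rule plateauD[OF plat]) (use that PQ in auto)
  qed (use PQ L(1) in auto)
  have "diag e 1 (touch p) (touch q) \<le> diag e 1 (touch P) (touch Q)"
    using L(3)[OF plat] GP G_pos[of p] by (simp add: overlap_def divide_le_cancel)
  moreover have "diag e 1 (touch P) (touch Q) \<le> diag e 1 (touch P) (touch q)"
    "Q \<noteq> q \<Longrightarrow> diag e 1 (touch P) (touch Q) < diag e 1 (touch P) (touch q)"
    using plateau_diag_less(1)[OF plat, of q] PQ L(1) by (cases "Q = q"; force)+
  moreover have "diag e 1 (touch P) (touch q) \<le> diag e 1 (touch p) (touch q)"
    "P \<noteq> p \<Longrightarrow> diag e 1 (touch P) (touch q) < diag e 1 (touch p) (touch q)"
    using plateau_diag_less(2)[OF plat', of p] PQ L(1) by (cases "P = p"; force)+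
  ultimately have "P = p" "Q = q" by linarith+
  then show "p \<le> p'" "q' \<le> q" by (auto simp: P_def Q_def)
qed

end

text \<open>A vector orthogonal to \<open>z\<close> for the form is a multiple of
  \<open>Complex (- Im z) (e * Re z)\<close>, the elliptic quarter turn of \<open>z\<close>. Equal
  levels and orientation force the same multiple at \<open>z\<close> and \<open>z'\<close>, so each
  chord end arises from the midpoint direction by one linear similarity of the form.\<close>

lemma chord_isometry:
  fixes e :: real
  assumes e: "0 < e" and l: "0 < l"
    and z: "diag e 1 z z = l" "diag e 1 z' z' = l"
    and D: "diag e 1 z D = 0" "diag e 1 z' D' = 0" "0 < wedge z D" "0 < wedge z' D'"
    and k: "diag e 1 (r *\<^sub>R z + D) (r *\<^sub>R z + D) = k" "diag e 1 (r *\<^sub>R z' + D') (r *\<^sub>R z' + D') = k"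
  shows "l * diag e 1 (r *\<^sub>R z + D) (r *\<^sub>R z' + D') = k * diag e 1 z z'"
    and "l * diag e 1 (r *\<^sub>R z - D) (r *\<^sub>R z' - D') = k * diag e 1 z z'"
proof -
  define w where "w = wedge z D / l"
  define w' where "w' = wedge z' D' / l"
  have rot: "D = (wedge z D / l) *\<^sub>R Complex (- Im z) (e * Re z)"
    if "diag e 1 z z = l" "diag e 1 z D = 0" for z D
  proof -
    have "l * Re D = wedge z D * (- Im z) + Re z * diag e 1 z D"
      unfolding that(1)[symmetric] by (simp add: diag_def wedge_def algebra_simps)
    then have "l * Re D = wedge z D * (- Im z)" using that by simp
    moreover have "l * Im D = wedge z D * (e * Re z) + Im z * diag e 1 z D"
      unfolding that(1)[symmetric] by (simp add: diag_def wedge_def algebra_simps)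
    then have "l * Im D = wedge z D * (e * Re z)" using that by simp
    ultimately show ?thesis using l by (simp add: complex_eq_iff field_simps)
  qed
  have DD: "D = w *\<^sub>R Complex (- Im z) (e * Re z)" "D' = w' *\<^sub>R Complex (- Im z') (e * Re z')"
    using rot[OF z(1) D(1)] rot[OF z(2) D(2)] by (simp_all add: w_def w'_def)
  have sq: "diag e 1 (r *\<^sub>R z + w *\<^sub>R Complex (- Im z) (e * Re z)) (r *\<^sub>R z + w *\<^sub>R Complex (- Im z) (e * Re z))
      = (r\<^sup>2 + e * w\<^sup>2) * diag e 1 z z" for z w
    by (simp add: diag_def power2_eq_square algebra_simps)
  have kk: "k = (r\<^sup>2 + e * w\<^sup>2) * l" "k = (r\<^sup>2 + e * w'\<^sup>2) * l"
    using k[unfolded DD sq] z by simp_all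
  then have "w\<^sup>2 = w'\<^sup>2" using e l by auto
  moreover have "0 < w" "0 < w'" using D l by (simp_all add: w_def w'_def)
  ultimately have "w' = w" by (simp add: power2_eq_iff_nonneg)
  have "diag e 1 (r *\<^sub>R z + D) (r *\<^sub>R z' + D') = (r\<^sup>2 + e * w\<^sup>2) * diag e 1 z z'"
    "diag e 1 (r *\<^sub>R z - D) (r *\<^sub>R z' - D') = (r\<^sup>2 + e * w\<^sup>2) * diag e 1 z z'"
    unfolding DD \<open>w' = w\<close> diag_def by (simp_all add: power2_eq_square algebra_simps)
  then show "l * diag e 1 (r *\<^sub>R z + D) (r *\<^sub>R z' + D') = k * diag e 1 z z'"
    "l * diag e 1 (r *\<^sub>R z - D) (r *\<^sub>R z' - D') = k * diag e 1 z z'"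
    unfolding kk(1) by simp_all
qed

context extremal_form
begin

text \<open>Zero slope says that the chord is orthogonal to \<open>touch p\<close> for the form,
  which is the situation of \<open>chord_isometry\<close>.\<close>

lemma overlap_images:
  assumes "F p = 0" "F q = 0" "G p = G q" "G (nxt p) = G (nxt q)"
  shows "overlap (nxt p) (nxt q) = overlap p q" "overlap (prv p) (prv q) = overlap p q"
proof -
  have zero: "diag e 1 (touch t) (half t *\<^sub>R dir t) = 0" if "F t = 0" for t
    using that by (simp add: slope_at_def diag_linear)
  have w: "0 < wedge (touch t) (half t *\<^sub>R dir t)" for t
    using half_pos height_pos by (simp add: wedge_linear flip: height_def)
  have fw: "\<rho> *\<^sub>R touch t + half t *\<^sub>R dir t = touch (nxt t)" "\<rho> *\<^sub>R touch t - half t *\<^sub>R dir t = touch (prv t)" for t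
    by (simp_all add: nxt prv fwd_def bwd_def)
  have gp: "G (prv p) = G (nxt p)" using assms(1) F_eq_0_iff by simp
  note iso = chord_isometry[where z = "touch p" and z' = "touch q" and D = "half p *\<^sub>R dir p"
      and D' = "half q *\<^sub>R dir q" and r = \<rho> and l = "G p" and k = "G (nxt p)", unfolded fw,
      OF e_pos G_pos _ _ zero[OF assms(1)] zero[OF assms(2)] w w]
  have "G p * diag e 1 (touch (nxt p)) (touch (nxt q)) = G (nxt p) * diag e 1 (touch p) (touch q)"
    by (rule iso) (use assms in \<open>simp_all add: form_at_def\<close>)
  then show "overlap (nxt p) (nxt q) = overlap p q"
    using G_pos[of p] G_pos[of "nxt p"] by (simp add: overlap_def field_simps)
  have "G p * diag e 1 (touch (prv p)) (touch (prv q)) = G (nxt p) * diag e 1 (touch p) (touch q)"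
    by (rule iso) (use assms in \<open>simp_all add: form_at_def\<close>)
  then show "overlap (prv p) (prv q) = overlap p q"
    using G_pos[of p] G_pos[of "nxt p"] gp by (simp add: overlap_def field_simps)
qed

lemma ex_longest:
  assumes "plateau p0 q0" "p0 < q0"
  shows "\<exists>p q. longest p q"
proof -
  \<comment> \<open>Constancy is tested at proportional points of the interval, so that each test is
    a closed condition on the pair of ends.\<close>
  define X where "X = {x :: real \<times> real. 0 \<le> fst x} \<inter> {x. fst x \<le> pi} \<inter> {x. fst x \<le> snd x} \<inter>
    {x. snd x \<le> fst x + pi} \<inter> (\<Inter>s\<in>{0..1}. {x. G (fst x + s * (snd x - fst x)) = G (fst x)})"
  have contG: "continuous_on UNIV (\<lambda>x :: real \<times> real. G (f x))" if "continuous_on UNIV f" for f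
    by (rule continuous_on_compose2[OF continuous_form_at[of UNIV] that]) simp
  have "closed X"
    unfolding X_def
    by (intro closed_Int closed_INT ballI closed_Collect_le closed_Collect_eq contG
        continuous_on_fst continuous_on_snd continuous_on_id continuous_on_add continuous_on_diff
        continuous_on_mult continuous_on_const)
  moreover have "bounded X"
  proof (rule bounded_subset)
    show "bounded ({0..pi} \<times> {0..2 * pi})" by (intro bounded_Times) auto
    show "X \<subseteq> {0..pi} \<times> {0..2 * pi}" by (auto simp: X_def)
  qed
  ultimately have "compact X" by (simp add: compact_eq_bounded_closed)
  have X_in: "(p, q) \<in> X" if "plateau p q" "0 \<le> p" "p \<le> pi" for p q
  proof -
    have "G (p + s * (q - p)) = G p" if "0 \<le> s" "s \<le> 1" for s
    proof (rule plateauD[OF \<open>plateau p q\<close>])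
      have "0 \<le> s * (q - p)" "s * (q - p) \<le> q - p"
        using that plateau_le[OF \<open>plateau p q\<close>] by (auto intro: mult_left_le_one_le)
      then show "p \<le> p + s * (q - p)" "p + s * (q - p) \<le> q" by auto
    qed
    then show ?thesis using that plateau_le plateau_less_pi by (auto simp: X_def intro: less_imp_le)
  qed
  have X_out: "plateau p q" if "(p, q) \<in> X" for p q
  proof (rule plateauI)
    show le: "p \<le> q" using that by (simp add: X_def)
    fix t assume t: "p \<le> t" "t \<le> q"
    show "G t = G p"
    proof (cases "p = q")
      case False
      define s where "s = (t - p) / (q - p)"
      have "0 \<le> s" "s \<le> 1" using t False by (auto simp: s_def)
      then have "G (p + s * (q - p)) = G p" using that by (auto simp: X_def)
      moreover have "p + s * (q - p) = t" using False by (simp add: s_def)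
      ultimately show ?thesis by simp
    qed (use t in simp)
  qed
  have shifted: "\<exists>x\<in>X. overlap (fst x) (snd x) = overlap p q" if pl: "plateau p q" for p q
  proof -
    obtain n :: int where n: "0 \<le> p + of_int n * pi" "p + of_int n * pi < 0 + pi" by (rule ex_int_shift)
    then have "(p + of_int n * pi, q + of_int n * pi) \<in> X"
      by (intro X_in plateau_int_shift[OF pl]) auto
    then show ?thesis by (rule bexI[rotated]) (simp add: overlap_int_shift)
  qed
  obtain x0 where x0: "x0 \<in> X" "overlap (fst x0) (snd x0) = overlap p0 q0" using shifted assms by blast
  have "continuous_on X (\<lambda>x. overlap (fst x) (snd x))"
    unfolding overlap_def
    by (intro continuous_on_divide continuous_diag continuous_touch_comp
        continuous_on_fst continuous_on_snd continuous_on_id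
        continuous_on_compose2[OF continuous_form_at[of UNIV]] subset_UNIV ballI)
       (use G_pos in \<open>simp add: less_imp_neq[symmetric]\<close>)
  then have "\<exists>x\<in>X. \<forall>y\<in>X. overlap (fst x) (snd x) \<le> overlap (fst y) (snd y)"
    using \<open>compact X\<close> x0(1) by (intro continuous_attains_inf) auto
  then obtain x where x: "x \<in> X" "\<And>y. y \<in> X \<Longrightarrow> overlap (fst x) (snd x) \<le> overlap (fst y) (snd y)"
    by blast
  have pl: "plateau (fst x) (snd x)" using X_out x(1) by simp
  have self: "overlap t t = 1" for t
    using G_pos[of t] by (simp add: overlap_def form_at_def)
  have "overlap (fst x) (snd x) \<le> overlap p0 q0" using x(2)[OF x0(1)] x0(2) by simp
  also have "\<dots> < overlap p0 p0"
    using plateau_diag_less(1)[OF assms(1), of p0] assms(2) G_pos[of p0]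
    by (simp add: overlap_def divide_strict_right_mono)
  finally have "fst x \<noteq> snd x" using self[of p0] self[of "fst x"] by auto
  then have "fst x < snd x" using plateau_le[OF pl] by simp
  moreover have "overlap (fst x) (snd x) \<le> overlap p q" if "plateau p q" for p q
    using shifted[OF that] x(2) by force
  ultimately show ?thesis using pl unfolding longest_def by blast
qed

lemma prv_mono: "s \<le> s' \<Longrightarrow> prv s \<le> prv s'" and nxt_mono: "s \<le> s' \<Longrightarrow> nxt s \<le> nxt s'"
  using prv_less[of s s'] nxt_less[of s s'] by (cases "s = s'"; simp)+

text \<open>For \<open>s\<close> near \<open>a\<close> the chord ends of \<open>s\<close> have one
  value and, up to a half turn, lie one in each of the arcs cut by the chord of \<open>a\<close>.
  These arcs are on opposite sides of the level of \<open>a\<close>, or one of them is flat; so the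
  value is that level.\<close>

lemma zero_interval_const:
  assumes zero: "\<And>s. p \<le> s \<Longrightarrow> s \<le> q \<Longrightarrow> F s = 0" and t: "p \<le> t" "t \<le> q"
  shows "G (nxt t) = G (nxt p)"
proof (rule connected_local_const[of "{p..q}" t p "\<lambda>t. G (nxt t)"])
  show "\<forall>a\<in>{p..q}. \<forall>\<^sub>F b in at a within {p..q}. G (nxt a) = G (nxt b)"
  proof
    fix a assume a: "a \<in> {p..q}"
    then have Fa: "F a = 0" using zero by simp
    then have ka: "G (nxt a) = G (prv a)" using F_eq_0_iff by blast
    obtain \<delta> where \<delta>: "\<delta> > 0"
      "\<And>s. \<bar>s - a\<bar> < \<delta> \<Longrightarrow> prv s < nxt a \<and> nxt s < prv a + pi \<and> prv a < nxt s \<and> nxt a < prv s + pi"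
      using window[of a] by blast
    have "G (nxt a) = G (nxt s)" if s: "s \<in> {p..q}" "\<bar>s - a\<bar> < \<delta>" for s
    proof -
      have Fs: "G (nxt s) = G (prv s)" using zero[of s] s F_eq_0_iff by simp
      have w: "prv s < nxt a" "nxt s < prv a + pi" "prv a < nxt s" "nxt a < prv s + pi"
        using \<delta>(2)[OF s(2)] by auto
      have "\<exists>x y. prv a \<le> x \<and> x \<le> nxt a \<and> G x = G (nxt s) \<and>
        nxt a \<le> y \<and> y \<le> prv a + pi \<and> G y = G (nxt s)"
      proof (cases "a \<le> s")
        case True
        show ?thesis
          by (rule exI[of _ "prv s"], rule exI[of _ "nxt s"])
             (use prv_mono[OF True] nxt_mono[OF True] w Fs in simp)
      next
        case False
        \<comment> \<open>The rear end has left the arc from \<open>prv a\<close> to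
          \<open>nxt a\<close> backwards, so its antipode represents it in the other arc.\<close>
        then have le: "s \<le> a" by simp
        show ?thesis
          by (rule exI[of _ "nxt s"], rule exI[of _ "prv s + pi"])
             (use prv_mono[OF le] nxt_mono[OF le] w Fs in \<open>simp add: form_at_shift\<close>)
      qed
      then obtain x y where x: "prv a \<le> x" "x \<le> nxt a" "G x = G (nxt s)"
        and y: "nxt a \<le> y" "y \<le> prv a + pi" "G y = G (nxt s)" by blast
      from Fa show ?thesis
      proof (cases rule: zero_alternatives)
        case (turn \<tau>)
        have "\<tau> * G (nxt s) \<le> \<tau> * G (prv a)" "\<tau> * G (prv a) \<le> \<tau> * G (nxt s)"
          using turn(2)[OF x(1,2)] turn(3)[OF y(1,2)] x(3) y(3) by auto
        then show ?thesis using turn(1) ka by auto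
      next
        case inner
        then show ?thesis using inner[OF x(1,2)] x(3) ka by simp
      next
        case outer
        then show ?thesis using outer[OF y(1,2)] y(3) ka by simp
      qed
    qed
    then show "\<forall>\<^sub>F b in at a within {p..q}. G (nxt a) = G (nxt b)"
      unfolding eventually_at dist_real_def using \<delta>(1) by blast
  qed
qed (use t in auto)

text \<open>The slope vanishes along the plateau, so each chord end stays on one level, and
  preservation of overlap passes minimality on to the images.\<close>

lemma longest_images:
  assumes L: "longest p q"
  shows "longest (nxt p) (nxt q)" "longest (prv p) (prv q)" "G (nxt p) = G (prv p)"
proof -
  note LD = longestD[OF L]
  have zero: "F s = 0" if "p \<le> s" "s \<le> q" for s by (rule plateau_zero[OF LD(2,1) that])
  have const: "G (nxt t) = G (nxt p)" if "p \<le> t" "t \<le> q" for t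
    by (rule zero_interval_const[OF zero that])
  have np: "G (nxt t) = G (prv t)" if "p \<le> t" "t \<le> q" for t
    using zero[OF that] F_eq_0_iff by blast
  show npp: "G (nxt p) = G (prv p)" by (rule np) (use LD(1) in simp_all)
  have "F p = 0" "F q = 0" by (rule zero; use LD(1) in simp)+
  moreover have "G p = G q" using plateauD[OF LD(2), of q] LD(1) by simp
  moreover have "G (nxt p) = G (nxt q)" using const[of q] LD(1) by simp
  ultimately have eq: "overlap (nxt p) (nxt q) = overlap p q" "overlap (prv p) (prv q) = overlap p q"
    by (rule overlap_images)+
  have "plateau (nxt p) (nxt q)"
  proof (rule plateauI)
    show "nxt p \<le> nxt q" using nxt_mono LD(1) by simp
    fix x assume "nxt p \<le> x" "x \<le> nxt q"
    then obtain t where "p \<le> t" "t \<le> q" "nxt t = x"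
      using IVT'[of nxt p x q] continuous_nxt LD(1) by auto
    then show "G x = G (nxt p)" using const by blast
  qed
  then show "longest (nxt p) (nxt q)"
    using nxt_less[OF LD(1)] LD(3) unfolding longest_def eq by blast
  have "plateau (prv p) (prv q)"
  proof (rule plateauI)
    show "prv p \<le> prv q" using prv_mono LD(1) by simp
    fix x assume "prv p \<le> x" "x \<le> prv q"
    then obtain t where t: "p \<le> t" "t \<le> q" "prv t = x"
      using IVT'[of prv p x q] continuous_prv LD(1) by auto
    then show "G x = G (prv p)" using const[OF t(1,2)] np[OF t(1,2)] npp by simp
  qed
  then show "longest (prv p) (prv q)"
    using prv_less[OF LD(1)] LD(3) unfolding longest_def eq by blast
qed

text \<open>The sign beyond \<open>q\<close> puts the arc from \<open>prv q\<close> to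
  \<open>nxt q\<close> on one side of the common level, the sign before \<open>p\<close> puts the
  arc from \<open>prv p\<close> to \<open>nxt p\<close> on the other. Together they yield a plateau
  properly containing the image \<open>[prv p, prv q]\<close>, which is already longest.\<close>

lemma longest_no_common_sign:
  assumes L: "longest p q" and sig: "\<sigma> = 1 \<or> \<sigma> = - 1" and d: "d > 0"
    and right: "\<And>t. q \<le> t \<Longrightarrow> t < q + d \<Longrightarrow> 0 \<le> \<sigma> * F t"
    and left: "\<And>t. p - d < t \<Longrightarrow> t \<le> p \<Longrightarrow> 0 \<le> \<sigma> * F t"
  shows False
proof -
  note LD = longestD[OF L]
  note LN = longest_images(1)[OF L]
  note LP = longest_images(2)[OF L]
  note LND = longestD[OF LN]
  note LPD = longestD[OF LP]
  have LP': "longest (prv p + pi) (prv q + pi)" using longest_int_shift[OF LP, of 1] by simp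
  have Fz: "F p = 0" "F q = 0" using plateau_zero[OF LD(2,1)] LD(1) by simp_all
  have ord: "prv t < t" "t < nxt t" "nxt t < prv t + pi" for t
    using prv(2) nxt(1) nxt_less_prv by auto
  have less: "prv p < prv q" "nxt p < nxt q" using LPD(1) LND(1) by auto
  have k: "G (prv q) = G (prv p)" "G (nxt p) = G (prv p)"
    using plateauD[OF LPD(2), of "prv q"] less longest_images(3)[OF L] by auto
  have at_q: "\<sigma> * G s \<le> \<sigma> * G (prv q)" if s: "prv q \<le> s" "s \<le> nxt q" for s
    using Fz(2)
  proof (cases rule: zero_alternatives)
    case (turn \<tau>)
    \<comment> \<open>Otherwise the slope has both weak signs just after \<open>q\<close>, vanishes
      there and prolongs the plateau.\<close>
    have "\<tau> \<noteq> \<sigma>"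
    proof
      assume "\<tau> = \<sigma>"
      obtain d' where d': "d' > 0" "\<And>s. q \<le> s \<Longrightarrow> s < q + d' \<Longrightarrow> \<tau> * F s \<le> 0"
        "\<And>s. q - d' < s \<Longrightarrow> s \<le> q \<Longrightarrow> 0 \<le> \<tau> * F s"
        using turn_sign[OF turn(1) Fz(2) turn(2,3)] by metis
      define x where "x = min (min d d') pi / 2"
      have x: "x > 0" "x < d" "x < d'" "x < pi" using d d'(1) pi_gt_zero unfolding x_def by linarith+
      have "plateau q (q + x)"
      proof (rule zero_plateau)
        fix t assume t: "q < t" "t < q + x"
        have "0 \<le> \<sigma> * F t" "\<sigma> * F t \<le> 0"
          using right[of t] d'(2)[of t] t x \<open>\<tau> = \<sigma>\<close> by auto
        then show "F t = 0" using sig by auto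
      qed (use x in auto)
      then show False using longest_absorbs(2)[OF L, of q "q + x"] x LD(1) by simp
    qed
    then have "\<tau> = - \<sigma>" using turn(1) sig by auto
    then show ?thesis using turn(2)[OF s] by simp
  next
    case inner
    have "plateau (prv q) (nxt q)" using ord[of q] by (intro plateauI[OF _ inner]) linarith
    then show ?thesis using longest_absorbs(2)[OF L, of "prv q" "nxt q"] ord[of q] LD(1) by simp
  next
    case outer
    have le: "nxt q \<le> prv q + pi" using ord(3)[of q] by simp
    have const: "G t = G (nxt q)" if "nxt q \<le> t" "t \<le> prv q + pi" for t
      using outer[OF that] outer[OF order_refl le] by simp
    have "plateau (nxt q) (prv q + pi)" by (rule plateauI[OF le const])
    then show ?thesis
      using longest_absorbs(2)[OF LN, of "nxt q" "prv q + pi"] ord[of q] less by simp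
  qed
  have at_p: "\<sigma> * G (prv p) \<le> \<sigma> * G s" if s: "prv p \<le> s" "s \<le> nxt p" for s
    using Fz(1)
  proof (cases rule: zero_alternatives)
    case (turn \<tau>)
    have "\<tau> \<noteq> - \<sigma>"
    proof
      assume "\<tau> = - \<sigma>"
      obtain d' where d': "d' > 0" "\<And>s. p \<le> s \<Longrightarrow> s < p + d' \<Longrightarrow> \<tau> * F s \<le> 0"
        "\<And>s. p - d' < s \<Longrightarrow> s \<le> p \<Longrightarrow> 0 \<le> \<tau> * F s"
        using turn_sign[OF turn(1) Fz(1) turn(2,3)] by metis
      define x where "x = min (min d d') pi / 2"
      have x: "x > 0" "x < d" "x < d'" "x < pi" using d d'(1) pi_gt_zero unfolding x_def by linarith+
      have "plateau (p - x) p"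
      proof (rule zero_plateau)
        fix t assume t: "p - x < t" "t < p"
        have "0 \<le> \<sigma> * F t" "\<sigma> * F t \<le> 0"
          using left[of t] d'(3)[of t] t x \<open>\<tau> = - \<sigma>\<close> by auto
        then show "F t = 0" using sig by auto
      qed (use x in auto)
      then show False using longest_absorbs(1)[OF L, of "p - x" p] x LD(1) by simp
    qed
    then have "\<tau> = \<sigma>" using turn(1) sig by auto
    then show ?thesis using turn(2)[OF s] by simp
  next
    case inner
    have "plateau (prv p) (nxt p)" using ord[of p] by (intro plateauI[OF _ inner]) linarith
    then show ?thesis using longest_absorbs(1)[OF L, of "prv p" "nxt p"] ord[of p] LD(1) by simp
  next
    case outer
    have le: "nxt p \<le> prv p + pi" using ord(3)[of p] by simp
    have const: "G t = G (nxt p)" if "nxt p \<le> t" "t \<le> prv p + pi" for t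
      using outer[OF that] outer[OF order_refl le] by simp
    have "plateau (nxt p) (prv p + pi)" by (rule plateauI[OF le const])
    then show ?thesis
      using longest_absorbs(1)[OF LP', of "nxt p" "prv p + pi"] ord[of p] less ord[of q] by simp
  qed
  \<comment> \<open>The image plateaus cover both ends; in a possible gap between
    \<open>prv q\<close> and \<open>nxt p\<close> the two opposite bounds meet.\<close>
  have "plateau (prv p) (nxt q)"
  proof (rule plateauI)
    show "prv p \<le> nxt q" using less ord[of p] by simp
    fix s assume s: "prv p \<le> s" "s \<le> nxt q"
    consider "s \<le> prv q" | "nxt p \<le> s" | "prv q < s" "s < nxt p" by linarith
    then show "G s = G (prv p)"
    proof cases
      case 1
      then show ?thesis by (intro plateauD[OF LPD(2) s(1)])
    next
      case 2
      then show ?thesis using plateauD[OF LND(2) _ s(2)] k by simp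
    next
      case 3
      then have "\<sigma> * G s \<le> \<sigma> * G (prv p)" "\<sigma> * G (prv p) \<le> \<sigma> * G s"
        using at_q[of s] at_p[of s] s k by auto
      then show ?thesis using sig by auto
    qed
  qed
  then show False
    using longest_absorbs(2)[OF LP, of "prv p" "nxt q"] less ord[of q] by simp
qed

lemma F_sign:
  fixes n :: int
  assumes "of_int n * (pi/2) \<le> t" "t \<le> (of_int n + 1) * (pi/2)"
  shows "0 \<le> (if even n then 1 else - 1) * F t"
proof -
  define m where "m = n div 2"
  define t' where "t' = t + of_int (- m) * pi"
  have Ft: "F t' = F t" unfolding t'_def by (rule periodic_int_shift) (rule slope_at_shift)
  show ?thesis
  proof (cases "even n")
    case True
    then have "of_int n = 2 * (of_int m :: real)" by (auto simp: m_def elim!: evenE)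
    then have "0 \<le> F t'" using assms by (intro rise) (simp_all add: t'_def algebra_simps)
    then show ?thesis using True Ft by simp
  next
    case False
    then have "of_int n = 2 * (of_int m :: real) + 1" by (auto simp: m_def elim!: oddE)
    then have "F t' \<le> 0" using assms by (intro fall) (simp_all add: t'_def algebra_simps)
    then show ?thesis using False Ft by simp
  qed
qed

lemma G_turn:
  fixes n :: int
  shows "G (of_int n * (pi/2)) = (if even n then e else 1)"
proof (cases "even n")
  case True
  then obtain m where "n = 2 * m" by (elim evenE)
  then show ?thesis using G_int_shift[of 0 m] G_zero by simp
next
  case False
  then obtain m where "n = 2 * m + 1" by (elim oddE)
  then show ?thesis using G_int_shift[of "pi/2" m] G_pi_half by (simp add: algebra_simps)
qed

text \<open>Otherwise the plateau lies with a margin inside a quarter turn on which the slope keeps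
  one sign.\<close>

lemma longest_contains_turn:
  assumes L: "longest p q"
  obtains n :: int where "p \<le> of_int n * (pi/2)" "of_int n * (pi/2) \<le> q"
proof (rule ccontr)
  assume "\<not> thesis"
  then have none: "\<not> (p \<le> of_int n * (pi/2) \<and> of_int n * (pi/2) \<le> q)" for n :: int
    using that by blast
  define n where "n = \<lfloor>p / (pi/2)\<rfloor>"
  have pos: "0 < pi / 2" by simp
  have "of_int n \<le> p / (pi/2)" "p / (pi/2) < of_int n + 1" by (simp_all only: n_def) linarith+
  then have n: "of_int n * (pi/2) \<le> p" "p < (of_int n + 1) * (pi/2)"
    by (simp_all only: pos_le_divide_eq[OF pos] pos_divide_less_eq[OF pos])
  have 1: "of_int n * (pi/2) < p" using n(1) none[of n] longestD(1)[OF L] by force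
  have 2: "q < (of_int n + 1) * (pi/2)" using n(2) none[of "n + 1"] by force
  define d where "d = min (p - of_int n * (pi/2)) ((of_int n + 1) * (pi/2) - q)"
  have d: "d > 0" "d \<le> p - of_int n * (pi/2)" "d \<le> (of_int n + 1) * (pi/2) - q"
    using 1 2 by (auto simp: d_def)
  show False
  proof (rule longest_no_common_sign[OF L _ d(1), of "if even n then 1 else - 1"])
    show "0 \<le> (if even n then 1 else - 1) * F t" if "q \<le> t" "t < q + d" for t
      by (rule F_sign) (use that d 1 longestD(1)[OF L] in linarith)+
    show "0 \<le> (if even n then 1 else - 1) * F t" if "p - d < t" "t \<le> p" for t
      by (rule F_sign) (use that d n in linarith)+
  qed simp
qed

text \<open>
  Both images of a longest plateau are longest plateaus on one level, so up to a half turn they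
  contain the same turning point of \<^term>\<open>G\<close> and hence coincide, which is absurd.
\<close>

lemma no_plateau: "\<not> (plateau p q \<and> p < q)"
proof
  assume "plateau p q \<and> p < q"
  then obtain p q where L: "longest p q" using ex_longest by blast
  note LN = longest_images(1)[OF L]
  note LP = longest_images(2)[OF L]
  obtain n :: int where n: "nxt p \<le> of_int n * (pi/2)" "of_int n * (pi/2) \<le> nxt q"
    using longest_contains_turn[OF LN] by blast
  obtain m :: int where m: "prv p \<le> of_int m * (pi/2)" "of_int m * (pi/2) \<le> prv q"
    using longest_contains_turn[OF LP] by blast
  have "G (of_int n * (pi/2)) = G (of_int m * (pi/2))"
    using plateauD[OF longestD(2)[OF LN] n] plateauD[OF longestD(2)[OF LP] m] longest_images(3)[OF L]
    by simp
  \<comment> \<open>The turning values \<open>e\<close> and \<open>1\<close> differ, so equal levels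
    mean turning points of one kind, a multiple of \<open>pi\<close> apart.\<close>
  then have "even n \<longleftrightarrow> even m" using e_less unfolding G_turn by (auto split: if_splits)
  then have "even (n - m)" by simp
  then obtain j where j: "n = m + 2 * j" by (metis add.commute diff_eq_eq evenE)
  have LPj: "longest (prv p + of_int j * pi) (prv q + of_int j * pi)" using longest_int_shift[OF LP] .
  have nm: "of_int n * (pi/2) = of_int m * (pi/2) + of_int j * pi" by (simp add: j algebra_simps)
  have o: "prv p + of_int j * pi \<le> nxt q" "nxt p \<le> prv q + of_int j * pi" using n m nm by linarith+
  have "nxt p = prv p + of_int j * pi"
    using longest_absorbs(1)[OF LN longestD(2)[OF LPj] o] longest_absorbs(1)[OF LPj longestD(2)[OF LN] o(2,1)]
    by simp
  \<comment> \<open>No multiple of \<open>pi\<close> lies strictly between 0 and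
    \<open>pi\<close>.\<close>
  moreover have "prv p < nxt p" "nxt p < prv p + pi"
    using prv(2)[of p] nxt(1)[of p] nxt_less_prv[of p] by auto
  ultimately have "0 < of_int j * pi" "of_int j * pi < 1 * pi" by simp_all
  then have "0 < j" "j < 1" by (simp_all add: zero_less_mult_iff mult_less_cancel_right)
  then show False by simp
qed

text \<open>A turn gives the slope opposite weak signs on the two sides, so a constant sign makes it
  vanish on one side. Every alternative thus ends in a nondegenerate plateau.\<close>

lemma zero_not_locally_signed:
  assumes sig: "\<sigma> = 1 \<or> \<sigma> = - 1" and d: "d > 0"
    and sign: "\<And>s. t - d < s \<Longrightarrow> s < t + d \<Longrightarrow> 0 \<le> \<sigma> * F s"
  shows "F t \<noteq> 0"
proof
  assume zero: "F t = 0"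
  then show False
  proof (cases rule: zero_alternatives)
    case (turn \<tau>)
    obtain d' where d': "d' > 0" "\<And>s. t \<le> s \<Longrightarrow> s < t + d' \<Longrightarrow> \<tau> * F s \<le> 0"
      "\<And>s. t - d' < s \<Longrightarrow> s \<le> t \<Longrightarrow> 0 \<le> \<tau> * F s"
      using turn_sign[OF turn(1) zero turn(2,3)] by metis
    define x where "x = min (min d d') pi / 2"
    have x: "x > 0" "x < d" "x < d'" "x < pi" using d d'(1) pi_gt_zero unfolding x_def by linarith+
    show False
    proof (cases "\<tau> = \<sigma>")
      case True
      have "plateau t (t + x)"
      proof (rule zero_plateau)
        fix s assume s: "t < s" "s < t + x"
        have "0 \<le> \<sigma> * F s" "\<sigma> * F s \<le> 0" using sign[of s] d'(2)[of s] s x True by auto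
        then show "F s = 0" using sig by auto
      qed (use x in auto)
      then show False using no_plateau x by force
    next
      case False
      then have "\<tau> = - \<sigma>" using turn(1) sig by auto
      have "plateau (t - x) t"
      proof (rule zero_plateau)
        fix s assume s: "t - x < s" "s < t"
        have "0 \<le> \<sigma> * F s" "\<sigma> * F s \<le> 0" using sign[of s] d'(3)[of s] s x \<open>\<tau> = - \<sigma>\<close> by auto
        then show "F s = 0" using sig by auto
      qed (use x in auto)
      then show False using no_plateau x by force
    qed
  next
    case inner
    have "prv t < nxt t" using prv(2)[of t] nxt(1)[of t] by simp
    then have "plateau (prv t) (nxt t)" by (intro plateauI[OF _ inner]) simp
    then show False using no_plateau \<open>prv t < nxt t\<close> by blast
  next
    case outer
    have less: "nxt t < prv t + pi" by (rule nxt_less_prv)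
    have const: "G s = G (nxt t)" if "nxt t \<le> s" "s \<le> prv t + pi" for s
      using outer[OF that] outer[OF order_refl less_imp_le[OF less]] by simp
    have "plateau (nxt t) (prv t + pi)" by (rule plateauI[OF less_imp_le[OF less] const])
    then show False using no_plateau less by blast
  qed
qed

lemma F_strict_rise:
  assumes "0 < t" "t < pi/2"
  shows "0 < F t"
proof -
  define d where "d = min t (pi/2 - t)"
  have "F t \<noteq> 0"
    by (rule zero_not_locally_signed[of 1 d]) (use assms in \<open>auto simp: d_def intro!: rise\<close>)
  then show ?thesis using rise[of t] assms by simp
qed

lemma F_strict_fall:
  assumes "pi/2 < t" "t < pi"
  shows "F t < 0"
proof -
  define d where "d = min (t - pi/2) (pi - t)"
  have "F t \<noteq> 0"
    by (rule zero_not_locally_signed[of "- 1" d]) (use assms in \<open>auto simp: d_def intro!: fall\<close>)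
  then show ?thesis using fall[of t] assms by simp
qed

end

section \<open>Euclidean planes\<close>

lemma compact_interval_pos_bound:
  fixes f :: "real \<Rightarrow> real"
  assumes "continuous_on {a..b} f" "\<And>t. a \<le> t \<Longrightarrow> t \<le> b \<Longrightarrow> 0 < f t"
  shows "\<exists>\<eta>>0. \<forall>t. a \<le> t \<longrightarrow> t \<le> b \<longrightarrow> \<eta> \<le> f t"
proof (cases "a \<le> b")
  case True
  then have "\<exists>x\<in>{a..b}. \<forall>t\<in>{a..b}. f x \<le> f t"
    using assms(1) by (intro continuous_attains_inf) auto
  then obtain x where x: "a \<le> x" "x \<le> b" "\<forall>t\<in>{a..b}. f x \<le> f t" by auto
  then have "\<forall>t. a \<le> t \<longrightarrow> t \<le> b \<longrightarrow> f x \<le> f t" by simp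
  then show ?thesis using assms(2)[OF x(1,2)] by blast
next
  case False
  then show ?thesis by (intro exI[of _ 1]) auto
qed

context midpoint_plane
begin

text \<open>At \<open>t\<close> itself there is no positive bound to perturb. But near
  \<open>nxt t\<close> the form rises and near \<open>prv t\<close> it falls, stably in the
  coefficient, and its values at these two ends agree for every coefficient; so the increment along
  the chord of a nearby \<open>s\<close>, and with it the slope at \<open>s\<close>, has the right
  sign.\<close>

lemma sign_near_zero:
  assumes zero: "\<And>\<kappa>. slope_at \<kappa> \<mu> t = 0"
    and pos: "0 < slope_at \<kappa> \<mu> (nxt t)" and neg: "slope_at \<kappa> \<mu> (prv t) < 0"
  shows "\<exists>\<delta>>0. \<forall>\<kappa>' s. \<bar>\<kappa>' - \<kappa>\<bar> < \<delta> \<longrightarrow>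
    (t < s \<and> s < t + \<delta> \<longrightarrow> 0 < slope_at \<kappa>' \<mu> s) \<and> (t - \<delta> < s \<and> s < t \<longrightarrow> slope_at \<kappa>' \<mu> s < 0)"
proof -
  define \<eta> where "\<eta> = min (slope_at \<kappa> \<mu> (nxt t)) (- slope_at \<kappa> \<mu> (prv t)) / 2"
  have \<eta>: "0 < \<eta>" "\<eta> < slope_at \<kappa> \<mu> (nxt t)" "slope_at \<kappa> \<mu> (prv t) < - \<eta>"
    using pos neg unfolding \<eta>_def by linarith+
  have "isCont (\<lambda>s. slope_at \<kappa> \<mu> (nxt s)) t" "isCont (\<lambda>s. slope_at \<kappa> \<mu> (prv s)) t"
    using continuous_on_compose2[OF continuous_slope_at[of UNIV] continuous_nxt[of UNIV]]
      continuous_on_compose2[OF continuous_slope_at[of UNIV] continuous_prv[of UNIV]]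
    by (simp_all add: continuous_on_eq_continuous_at)
  then have c: "(\<lambda>s. slope_at \<kappa> \<mu> (nxt s)) \<midarrow>t\<rightarrow> slope_at \<kappa> \<mu> (nxt t)"
    "(\<lambda>s. slope_at \<kappa> \<mu> (prv s)) \<midarrow>t\<rightarrow> slope_at \<kappa> \<mu> (prv t)"
    by (simp_all add: isCont_def)
  have "\<forall>\<^sub>F s in at t. \<eta> < slope_at \<kappa> \<mu> (nxt s) \<and> slope_at \<kappa> \<mu> (prv s) < - \<eta>"
    by (intro eventually_conj order_tendstoD(1)[OF c(1) \<eta>(2)] order_tendstoD(2)[OF c(2) \<eta>(3)])
  then obtain d where d: "d > 0" "\<forall>s\<in>UNIV. s \<noteq> t \<and> dist s t < d \<longrightarrow>
      \<eta> < slope_at \<kappa> \<mu> (nxt s) \<and> slope_at \<kappa> \<mu> (prv s) < - \<eta>"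
    unfolding eventually_at by blast
  have surj_n: "\<exists>s. p \<le> s \<and> s \<le> q \<and> nxt s = x"
    if "nxt p < x" "x < nxt q" "p < q" for p q x
    using IVT'[of nxt p x q] continuous_nxt that by auto
  have surj_p: "\<exists>s. p \<le> s \<and> s \<le> q \<and> prv s = x"
    if "prv p < x" "x < prv q" "p < q" for p q x
    using IVT'[of prv p x q] continuous_prv that by auto
  define \<delta> where "\<delta> = min \<eta> d"
  have \<delta>: "0 < \<delta>" "\<delta> \<le> \<eta>" "\<delta> \<le> d" using \<eta> d by (auto simp: \<delta>_def)
  show ?thesis
  proof (rule exI[of _ \<delta>], intro conjI allI impI)
    fix \<kappa>' s assume \<kappa>': "\<bar>\<kappa>' - \<kappa>\<bar> < \<delta>"
    have near: "0 < slope_at \<kappa>' \<mu> (nxt x)" "slope_at \<kappa>' \<mu> (prv x) < 0" if x: "\<bar>x - t\<bar> < \<delta>" for x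
    proof -
      have "\<eta> < slope_at \<kappa> \<mu> (nxt x)" "slope_at \<kappa> \<mu> (prv x) < - \<eta>"
        using bspec[OF d(2), of x] \<eta> x \<delta> by (cases "x = t"; force simp: dist_real_def)+
      then show "0 < slope_at \<kappa>' \<mu> (nxt x)" "slope_at \<kappa>' \<mu> (prv x) < 0"
        using slope_at_perturb[of \<kappa>' \<mu> "nxt x" \<kappa>] slope_at_perturb[of \<kappa>' \<mu> "prv x" \<kappa>] \<kappa>' \<delta>
        by linarith+
    qed
    have eq: "form_at \<kappa>' \<mu> (nxt t) = form_at \<kappa>' \<mu> (prv t)"
      using form_increment[of \<kappa>' \<mu> t] zero by simp
    {
      assume s: "t < s \<and> s < t + \<delta>"
      have less: "nxt t < nxt s" "prv t < prv s" using s nxt_less prv_less by auto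
      have "0 < slope_at \<kappa>' \<mu> x" if x: "nxt t < x" "x < nxt s" for x
      proof -
        obtain y where "t \<le> y" "y \<le> s" "nxt y = x"
          using surj_n[OF x] s by auto
        then show ?thesis using near(1)[of y] s by auto
      qed
      then have 1: "form_at \<kappa>' \<mu> (nxt t) < form_at \<kappa>' \<mu> (nxt s)"
        by (rule form_increasing[of "nxt t" "nxt s"]) (use less in auto)
      have "slope_at \<kappa>' \<mu> x < 0" if x: "prv t < x" "x < prv s" for x
      proof -
        obtain y where "t \<le> y" "y \<le> s" "prv y = x"
          using surj_p[OF x] s by auto
        then show ?thesis using near(2)[of y] s by auto
      qed
      then have "form_at \<kappa>' \<mu> (prv s) < form_at \<kappa>' \<mu> (prv t)"
        by (rule form_decreasing[of "prv t" "prv s"]) (use less in auto)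
      then show "0 < slope_at \<kappa>' \<mu> s" using 1 eq slope_pos_iff by simp
    next
      assume s: "t - \<delta> < s \<and> s < t"
      have less: "nxt s < nxt t" "prv s < prv t" using s nxt_less prv_less by auto
      have "0 < slope_at \<kappa>' \<mu> x" if x: "nxt s < x" "x < nxt t" for x
      proof -
        obtain y where "s \<le> y" "y \<le> t" "nxt y = x"
          using surj_n[OF x] s by auto
        then show ?thesis using near(1)[of y] s by auto
      qed
      then have 1: "form_at \<kappa>' \<mu> (nxt s) < form_at \<kappa>' \<mu> (nxt t)"
        by (rule form_increasing[of "nxt s" "nxt t"]) (use less in auto)
      have "slope_at \<kappa>' \<mu> x < 0" if x: "prv s < x" "x < prv t" for x
      proof -
        obtain y where "s \<le> y" "y \<le> t" "prv y = x"
          using surj_p[OF x] s by auto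
        then show ?thesis using near(2)[of y] s by auto
      qed
      then have "form_at \<kappa>' \<mu> (prv t) < form_at \<kappa>' \<mu> (prv s)"
        by (rule form_decreasing[of "prv s" "prv t"]) (use less in auto)
      then show "slope_at \<kappa>' \<mu> s < 0" using 1 eq slope_neg_iff by simp
    }
  qed (rule \<delta>(1))
qed

text \<open>Weak inequalities on closed ranges, so that the admissible coefficients form a closed
  set and a largest one exists.\<close>

definition admissible :: "real \<Rightarrow> bool" where
  "admissible e \<longleftrightarrow> (\<forall>t\<in>{0..pi/2}. 0 \<le> slope_at e 1 t) \<and> (\<forall>t\<in>{pi/2..pi}. slope_at e 1 t \<le> 0)"

lemma cos_neg_second_quadrant: "pi/2 < t \<Longrightarrow> t < pi \<Longrightarrow> cos t < 0"
  using cos_gt_zero[of "pi - t"] by simp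

lemma admissible_zero: "admissible 0"
  unfolding admissible_def
proof (intro conjI ballI)
  have s: "slope_at 0 1 t = Im (touch t) * cos t" for t by (simp add: slope_at_def diag_def)
  have im: "0 \<le> Im (touch t)" if "0 \<le> t" "t \<le> pi" for t
  proof -
    consider "t = 0" | "0 < t" "t < pi" | "t = pi" using \<open>0 \<le> t\<close> \<open>t \<le> pi\<close> by linarith
    then show ?thesis
      using touch_half_shift(1)[of 0] by cases (auto simp: touch_zero Im_touch_pos less_imp_le)
  qed
  show "0 \<le> slope_at 0 1 t" if "t \<in> {0..pi/2}" for t
    unfolding s using that im[of t] by (intro mult_nonneg_nonneg cos_ge_zero) auto
  show "slope_at 0 1 t \<le> 0" if t: "t \<in> {pi/2..pi}" for t
  proof -
    have "0 \<le> cos (pi - t)" using t by (intro cos_ge_zero) auto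
    then show ?thesis
      unfolding s using t im[of t] by (intro mult_nonneg_nonpos) auto
  qed
qed

text \<open>The case \<open>e = 0\<close> is computed directly, because the degenerate form provides
  no angles.\<close>

lemma admissible_strict:
  assumes "admissible e" "0 \<le> e" "e < 1"
  shows "0 < t \<Longrightarrow> t < pi/2 \<Longrightarrow> 0 < slope_at e 1 t"
    and "pi/2 < t \<Longrightarrow> t < pi \<Longrightarrow> slope_at e 1 t < 0"
proof -
  have "(0 < t \<longrightarrow> t < pi/2 \<longrightarrow> 0 < slope_at e 1 t) \<and> (pi/2 < t \<longrightarrow> t < pi \<longrightarrow> slope_at e 1 t < 0)"
  proof (cases "e = 0")
    case True
    have s: "slope_at 0 1 t = Im (touch t) * cos t" by (simp add: slope_at_def diag_def)
    show ?thesis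
      unfolding True s using Im_touch_pos[of t] cos_gt_zero[of t] cos_neg_second_quadrant[of t] pi_half_gt_zero
      by (auto intro: mult_pos_neg)
  next
    case False
    then interpret extremal_form N \<rho> e
      using assms by unfold_locales (auto simp: admissible_def)
    show ?thesis using F_strict_rise F_strict_fall by blast
  qed
  then show "0 < t \<Longrightarrow> t < pi/2 \<Longrightarrow> 0 < slope_at e 1 t"
    "pi/2 < t \<Longrightarrow> t < pi \<Longrightarrow> slope_at e 1 t < 0" by blast+
qed

lemma admissible_enlarge:
  assumes adm: "admissible e" "0 \<le> e" "e < 1"
  shows "\<exists>e'. e < e' \<and> e' \<le> 1 \<and> admissible e'"
proof -
  note strict = admissible_strict[OF adm]
  have "slope_at e 1 (prv 0 + pi) < 0" using strict(2)[of "prv 0 + pi"] prv_zero by simp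
  then have "slope_at e 1 (prv 0) < 0" by (simp add: slope_at_shift)
  moreover have "0 < slope_at e 1 (nxt 0)" using strict(1) nxt_zero by blast
  ultimately obtain d1 where d1: "d1 > 0" "\<forall>\<kappa>' s. \<bar>\<kappa>' - e\<bar> < d1 \<longrightarrow>
      (0 < s \<and> s < 0 + d1 \<longrightarrow> 0 < slope_at \<kappa>' 1 s) \<and> (0 - d1 < s \<and> s < 0 \<longrightarrow> slope_at \<kappa>' 1 s < 0)"
    using sign_near_zero[of 1 0 e] slope_at_zero by blast
  \<comment> \<open>At \<open>pi/2\<close> the slope passes from positive to negative, so
    \<open>sign_near_zero\<close> is applied to the negated form.\<close>
  have "0 < slope_at (- e) (- 1) (nxt (pi/2))" "slope_at (- e) (- 1) (prv (pi/2)) < 0"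
    using strict(2)[of "nxt (pi/2)"] strict(1)[of "prv (pi/2)"] nxt_pi_half prv_pi_half
    unfolding slope_at_minus by simp_all
  then obtain d2 where d2: "d2 > 0" "\<forall>\<kappa>' s. \<bar>\<kappa>' - (- e)\<bar> < d2 \<longrightarrow>
      (pi/2 < s \<and> s < pi/2 + d2 \<longrightarrow> 0 < slope_at \<kappa>' (- 1) s) \<and> (pi/2 - d2 < s \<and> s < pi/2 \<longrightarrow> slope_at \<kappa>' (- 1) s < 0)"
    using sign_near_zero[of "- 1" "pi/2" "- e"] slope_at_pi_half by blast
  define d where "d = min d1 d2 / 2"
  have d: "0 < d" "d < d1" "d < d2" using d1(1) d2(1) by (auto simp: d_def)
  have "\<exists>\<eta>>0. \<forall>t. d \<le> t \<longrightarrow> t \<le> pi/2 - d \<longrightarrow> \<eta> \<le> slope_at e 1 t"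
    using d(1) by (intro compact_interval_pos_bound continuous_slope_at strict(1)) auto
  then obtain h1 where h1: "h1 > 0" "\<And>t. d \<le> t \<Longrightarrow> t \<le> pi/2 - d \<Longrightarrow> h1 \<le> slope_at e 1 t" by blast
  have "\<exists>\<eta>>0. \<forall>t. pi/2 + d \<le> t \<longrightarrow> t \<le> pi - d \<longrightarrow> \<eta> \<le> - slope_at e 1 t"
  proof (rule compact_interval_pos_bound)
    show "continuous_on {pi/2 + d..pi - d} (\<lambda>t. - slope_at e 1 t)"
      by (intro continuous_on_minus continuous_slope_at)
    show "0 < - slope_at e 1 t" if "pi/2 + d \<le> t" "t \<le> pi - d" for t
      using strict(2)[of t] that d(1) by simp
  qed
  then obtain h2 where h2: "h2 > 0" "\<And>t. pi/2 + d \<le> t \<Longrightarrow> t \<le> pi - d \<Longrightarrow> h2 \<le> - slope_at e 1 t" by blast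
  \<comment> \<open>Small enough for the neighbourhoods of the contact points and for the bounds
    \<open>h1\<close>, \<open>h2\<close> on the slope away from them.\<close>
  define e' where "e' = e + min (1 - e) (min d (min h1 h2))"
  have e': "e < e'" "e' \<le> 1" "e' - e \<le> d" "e' - e \<le> h1" "e' - e \<le> h2"
    using adm d h1(1) h2(1) by (auto simp: e'_def)
  have abs: "\<bar>e' - e\<bar> = e' - e" "\<bar>- e' - (- e)\<bar> = e' - e" using e'(1) by auto
  have n1: "0 < s \<Longrightarrow> s < d1 \<Longrightarrow> 0 < slope_at e' 1 s" "- d1 < s \<Longrightarrow> s < 0 \<Longrightarrow> slope_at e' 1 s < 0" for s
    using d1(2)[rule_format, of e' s] abs(1) e' d by auto
  have n2: "pi/2 < s \<Longrightarrow> s < pi/2 + d2 \<Longrightarrow> slope_at e' 1 s < 0"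
    "pi/2 - d2 < s \<Longrightarrow> s < pi/2 \<Longrightarrow> 0 < slope_at e' 1 s" for s
    using d2(2)[rule_format, of "- e'" s] abs(2) e' d unfolding slope_at_minus by auto
  have pert: "slope_at e 1 t - (e' - e) \<le> slope_at e' 1 t" "slope_at e' 1 t \<le> slope_at e 1 t + (e' - e)" for t
    using slope_at_perturb[of e' 1 t e] abs(1) by linarith+
  have "0 \<le> slope_at e' 1 t" if t: "0 \<le> t" "t \<le> pi/2" for t
  proof -
    consider "t = 0" | "t = pi/2" | "0 < t" "t < d1" | "pi/2 - d2 < t" "t < pi/2" | "d \<le> t" "t \<le> pi/2 - d"
      using t d by linarith
    then show ?thesis
    proof cases
      case 5
      then show ?thesis using h1(2)[OF 5] pert(1)[of t] e'(4) by linarith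
    next
      case 1
      then show ?thesis by (simp only: slope_at_zero order_refl)
    next
      case 2
      then show ?thesis by (simp only: slope_at_pi_half order_refl)
    next
      case 3
      then show ?thesis using n1(1) by (simp add: less_imp_le)
    next
      case 4
      then show ?thesis using n2(2) by (simp add: less_imp_le)
    qed
  qed
  moreover have "slope_at e' 1 t \<le> 0" if t: "pi/2 \<le> t" "t \<le> pi" for t
  proof -
    consider "t = pi" | "t = pi/2" | "pi/2 < t" "t < pi/2 + d2" | "pi - d1 < t" "t < pi" | "pi/2 + d \<le> t" "t \<le> pi - d"
      using t d by linarith
    then show ?thesis
    proof cases
      case 1
      then show ?thesis using slope_at_shift[of e' 1 0] slope_at_zero by simp
    next
      case 4
      then show ?thesis using n1(2)[of "t - pi"] slope_at_shift[of e' 1 "t - pi"] by simp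
    next
      case 5
      then show ?thesis using h2(2)[OF 5] pert(2)[of t] e'(5) by linarith
    next
      case 2
      then show ?thesis by (simp only: slope_at_pi_half order_refl)
    next
      case 3
      then show ?thesis using n2(1) by (simp add: less_imp_le)
    qed
  qed
  ultimately have "admissible e'" by (simp add: admissible_def)
  then show ?thesis using e' by blast
qed

lemma admissible_one: "admissible 1"
proof -
  define A where "A = {0..1} \<inter> ((\<Inter>t\<in>{0..pi/2}. {e. 0 \<le> slope_at e 1 t}) \<inter> (\<Inter>t\<in>{pi/2..pi}. {e. slope_at e 1 t \<le> 0}))"
  have A: "e \<in> A \<longleftrightarrow> 0 \<le> e \<and> e \<le> 1 \<and> admissible e" for e
    by (auto simp: A_def admissible_def)
  have cont: "continuous_on UNIV (\<lambda>e. slope_at e 1 t)" for t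
    unfolding slope_at_def diag_def by (intro continuous_intros)
  have "compact A"
    unfolding A_def
    by (intro compact_Int_closed compact_Icc closed_Int closed_INT ballI closed_Collect_le cont continuous_on_const)
  moreover have "A \<noteq> {}" using A[of 0] admissible_zero by auto
  ultimately obtain e where e: "e \<in> A" "\<And>x. x \<in> A \<Longrightarrow> x \<le> e"
    using compact_attains_sup by metis
  have "e = 1"
  proof (rule ccontr)
    assume "e \<noteq> 1"
    then obtain e' where "e < e'" "e' \<le> 1" "admissible e'"
      using admissible_enlarge[of e] e(1) A[of e] by auto
    then show False using e(2)[of e'] A[of e'] A[of e] e(1) by auto
  qed
  then show ?thesis using e(1) A by blast
qed

text \<open>For coefficient 1 the form takes one value at \<open>0\<close>, \<open>pi/2\<close> and
  \<open>pi\<close> and is monotone in between.\<close>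

lemma cmod_touch: "cmod (touch t) = 1"
proof -
  have rise: "0 \<le> slope_at 1 1 s" if "0 \<le> s" "s \<le> pi/2" for s
    using admissible_one that by (simp add: admissible_def)
  have fall: "slope_at 1 1 s \<le> 0" if "pi/2 \<le> s" "s \<le> pi" for s
    using admissible_one that by (simp add: admissible_def)
  have form: "form_at 1 1 s = (cmod (touch s))\<^sup>2" for s
    unfolding cmod_power2 by (simp add: form_at_def diag_def power2_eq_square)
  have ends: "form_at 1 1 0 = 1" "form_at 1 1 (pi/2) = 1" "form_at 1 1 pi = 1"
    using form_at_shift[of 1 1 0] by (simp_all add: form touch_zero touch_pi_half)
  obtain n :: int where n: "0 \<le> t + of_int n * pi" "t + of_int n * pi < 0 + pi" by (rule ex_int_shift)
  define s where "s = t + of_int n * pi"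
  have s: "0 \<le> s" "s < pi" using n by (auto simp: s_def)
  have "form_at 1 1 s = 1"
  proof (cases "s \<le> pi/2")
    case True
    have "form_at 1 1 0 \<le> form_at 1 1 s"
      by (rule form_mono) (use s True in \<open>auto intro: rise\<close>)
    moreover have "form_at 1 1 s \<le> form_at 1 1 (pi/2)"
      by (rule form_mono) (use s True in \<open>auto intro: rise\<close>)
    ultimately show ?thesis using ends by simp
  next
    case False
    then have False': "pi/2 \<le> s" by simp
    have "form_at 1 1 pi \<le> form_at 1 1 s"
      by (rule form_antimono) (use s False' pi_half_gt_zero in \<open>auto intro: fall\<close>)
    moreover have "form_at 1 1 s \<le> form_at 1 1 (pi/2)"
      by (rule form_antimono) (use s False' pi_half_gt_zero in \<open>auto intro: fall\<close>)
    ultimately show ?thesis using ends by simp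
  qed
  moreover have "form_at 1 1 s = form_at 1 1 t"
    unfolding s_def by (rule periodic_int_shift) (rule form_at_shift)
  ultimately have "(cmod (touch t))\<^sup>2 = 1" using form by simp
  then show ?thesis using norm_ge_zero[of "touch t"] by (simp add: power2_eq_1_iff)
qed

text \<open>Every vector is a multiple of some \<open>touch t\<close>, since
  \<open>wedge (touch t) z\<close> changes sign over half a turn.\<close>

lemma N_eq_cmod: "N z = cmod z"
proof -
  define f where "f = (\<lambda>t. wedge (touch t) z)"
  have cont: "continuous_on {0..pi} f" unfolding f_def by (intro continuous_intros)
  have "f pi = - f 0" using touch_half_shift(1)[of 0] by (simp add: f_def wedge_linear)
  then have "\<exists>t. 0 \<le> t \<and> t \<le> pi \<and> f t = 0"
    using IVT'[OF _ _ _ cont, of 0] IVT2'[OF _ _ _ cont, of 0] pi_ge_zero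
    by (cases "f 0 \<le> 0") auto
  then obtain t where t: "wedge (touch t) z = 0" by (auto simp: f_def)
  define r where "r = inner (touch t) z"
  have one: "(Re (touch t))\<^sup>2 + (Im (touch t))\<^sup>2 = 1"
    using cmod_touch[of t] cmod_power2[of "touch t"] by simp
  have w: "Re (touch t) * Im z - Im (touch t) * Re z = 0" using t by (simp add: wedge_def)
  have "Re z = r * Re (touch t)" "Im z = r * Im (touch t)"
    unfolding r_def inner_complex_def using one w by algebra+
  then have "z = r *\<^sub>R touch t" by (simp add: complex_eq_iff)
  then show ?thesis by (simp add: scale N_touch cmod_touch)
qed

end

section \<open>From planes to the whole space\<close>

lemma wedge_expand:
  assumes "wedge p q \<noteq> 0"
  shows "z = (wedge z q / wedge p q) *\<^sub>R p + (wedge p z / wedge p q) *\<^sub>R q"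
proof -
  have "wedge p q * Re z = wedge z q * Re p + wedge p z * Re q"
    "wedge p q * Im z = wedge z q * Im p + wedge p z * Im q"
    by (simp_all add: wedge_def algebra_simps)
  then show ?thesis using assms by (simp add: complex_eq_iff field_simps)
qed

text \<open>
  The plane is spanned by a pair of unit vectors of maximal wedge product; then the unit circle
  lies in the square with these vectors as midpoints of two sides, as the locale requires.
\<close>

lemma norm_quadratic_on_independent:
  fixes x y :: "'a::real_normed_vector"
  assumes rho: "0 < \<rho>" "\<rho> < 1"
    and mid: "\<And>u v :: 'a. norm u = 1 \<Longrightarrow> norm v = 1 \<Longrightarrow>
      (INF t\<in>{0..1::real}. norm (t *\<^sub>R u + (1 - t) *\<^sub>R v)) = \<rho> \<Longrightarrow> norm (u + v) = 2 * \<rho>"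
    and indep: "\<And>a b. a *\<^sub>R x + b *\<^sub>R y = 0 \<Longrightarrow> a = 0 \<and> b = 0"
  shows "\<exists>A B C. \<forall>a b. (norm (a *\<^sub>R x + b *\<^sub>R y))\<^sup>2 = A * a\<^sup>2 + 2 * B * a * b + C * b\<^sup>2"
proof -
  define L where "L = (\<lambda>z. Re z *\<^sub>R x + Im z *\<^sub>R y)"
  have L_add: "L (z + w) = L z + L w" and L_scale: "L (r *\<^sub>R z) = r *\<^sub>R L z" for z w r
    by (simp_all add: L_def algebra_simps)
  define N where "N = (\<lambda>z. norm (L z))"
  have N_scale: "N (r *\<^sub>R z) = \<bar>r\<bar> * N z" for r z by (simp add: N_def L_scale)
  have N_pos: "0 < N z" if "z \<noteq> 0" for z
    using indep[of "Re z" "Im z"] that by (auto simp: N_def L_def complex_eq_iff)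
  have N_cont: "continuous_on S N" for S
    unfolding N_def L_def by (intro continuous_intros)
  \<comment> \<open>A positive minimum of \<open>N\<close> on the Euclidean circle bounds the unit
    circle of \<open>N\<close>.\<close>
  have "\<exists>z\<in>sphere 0 1. \<forall>w\<in>sphere 0 1. N z \<le> N (w :: complex)"
    by (intro continuous_attains_inf N_cont) auto
  then obtain z0 where z0: "cmod z0 = 1" "\<And>w. cmod w = 1 \<Longrightarrow> N z0 \<le> N w" by auto
  have m: "N z0 > 0" using z0(1) by (intro N_pos) auto
  have cmod_le: "cmod z * N z0 \<le> N z" for z
  proof (cases "z = 0")
    case False
    then have "N z0 \<le> N ((1 / cmod z) *\<^sub>R z)" by (intro z0(2)) simp
    then show ?thesis using False by (simp add: N_scale field_simps)
  qed (simp add: N_def)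
  define S where "S = {z. N z = 1}"
  have "closed S" unfolding S_def by (intro closed_Collect_eq N_cont continuous_on_const)
  moreover have "bounded S"
  proof (rule boundedI)
    fix z assume "z \<in> S"
    then show "cmod z \<le> 1 / N z0" using cmod_le[of z] m by (simp add: S_def field_simps)
  qed
  ultimately have "compact S" by (simp add: compact_eq_bounded_closed)
  have unit: "(1 / N z) *\<^sub>R z \<in> S" if "z \<noteq> 0" for z
    using N_pos[OF that] by (simp add: S_def N_scale)
  have "\<exists>c\<in>S \<times> S. \<forall>d\<in>S \<times> S. wedge (fst d) (snd d) \<le> wedge (fst c) (snd c)"
  proof (rule continuous_attains_sup)
    show "compact (S \<times> S)" using \<open>compact S\<close> by (intro compact_Times)
    show "S \<times> S \<noteq> {}" using unit[of 1] by auto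
    show "continuous_on (S \<times> S) (\<lambda>d. wedge (fst d) (snd d))"
      by (intro continuous_wedge continuous_on_fst continuous_on_snd continuous_on_id)
  qed
  then obtain p q where pq: "p \<in> S" "q \<in> S"
    and max: "\<And>r s. r \<in> S \<Longrightarrow> s \<in> S \<Longrightarrow> wedge r s \<le> wedge p q" by auto
  define W where "W = wedge p q"
  have "wedge ((1 / N 1) *\<^sub>R 1) ((1 / N \<i>) *\<^sub>R \<i>) \<le> W" unfolding W_def by (intro max unit) auto
  moreover have "0 < wedge ((1 / N 1) *\<^sub>R 1) ((1 / N \<i>) *\<^sub>R \<i>)"
    using N_pos[of 1] N_pos[of \<i>] by (simp add: wedge_def)
  ultimately have W: "0 < W" by simp
  \<comment> \<open>Exchanging one vector of the maximal pair for a normalised \<open>r\<close>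
    cannot raise the wedge product; in the coordinates \<open>T\<close> these bounds become
    \<open>Re_le\<close> and \<open>Im_le\<close>.\<close>
  have bound: "\<bar>wedge r q\<bar> \<le> N r * W" "\<bar>wedge p r\<bar> \<le> N r * W" for r
  proof -
    have 1: "wedge r q \<le> N r * W" "wedge p r \<le> N r * W" for r
    proof -
      have "wedge r q \<le> N r * W \<and> wedge p r \<le> N r * W"
      proof (cases "r = 0")
        case False
        then show ?thesis
          using max[OF unit[OF False] pq(2)] max[OF pq(1) unit[OF False]] N_pos[OF False]
          by (simp add: wedge_scale_left wedge_scale_right W_def field_simps)
      qed (use W in \<open>simp add: wedge_def N_def\<close>)
      then show "wedge r q \<le> N r * W" "wedge p r \<le> N r * W" by auto
    qed
    have "N (- r) = N r" using N_scale[of "- 1" r] by simp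
    then show "\<bar>wedge r q\<bar> \<le> N r * W" "\<bar>wedge p r\<bar> \<le> N r * W"
      using 1[of r] 1[of "- r"] by (auto simp: wedge_minus_left wedge_minus_right abs_le_iff)
  qed
  define T where "T = (\<lambda>z. Re z *\<^sub>R p + Im z *\<^sub>R q)"
  have T_add: "T (z + w) = T z + T w" and T_scale: "T (r *\<^sub>R z) = r *\<^sub>R T z" for z w r
    by (simp_all add: T_def algebra_simps)
  have T_wedge: "wedge (T z) q = Re z * W" "wedge p (T z) = Im z * W" for z
    by (simp_all add: T_def wedge_linear W_def)
  interpret midpoint_plane "\<lambda>z. N (T z)" \<rho>
  proof
    show "N (T (z + w)) \<le> N (T z) + N (T w)" for z w
      by (simp add: N_def T_add L_add norm_triangle_ineq)
    show "N (T (r *\<^sub>R z)) = \<bar>r\<bar> * N (T z)" for r z by (simp add: T_scale N_scale)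
    show "N (T 1) = 1" "N (T \<i>) = 1" using pq by (simp_all add: T_def S_def)
    show "\<bar>Re z\<bar> \<le> N (T z)" for z
      using bound(1)[of "T z"] W by (simp add: T_wedge abs_mult)
    show "\<bar>Im z\<bar> \<le> N (T z)" for z
      using bound(2)[of "T z"] W by (simp add: T_wedge abs_mult)
    fix u v :: complex and s :: real
    assume uv: "N (T u) = 1" "N (T v) = 1"
      and ge: "\<And>s. 0 \<le> s \<Longrightarrow> s \<le> 1 \<Longrightarrow> \<rho> \<le> N (T (s *\<^sub>R u + (1 - s) *\<^sub>R v))"
      and s: "0 \<le> s" "s \<le> 1" "N (T (s *\<^sub>R u + (1 - s) *\<^sub>R v)) = \<rho>"
    have lin: "N (T (s *\<^sub>R u + (1 - s) *\<^sub>R v)) = norm (s *\<^sub>R L (T u) + (1 - s) *\<^sub>R L (T v))" for s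
      by (simp only: N_def T_add T_scale L_add L_scale)
    have "(INF t\<in>{0..1}. norm (t *\<^sub>R L (T u) + (1 - t) *\<^sub>R L (T v))) = \<rho>"
    proof (rule cInf_eq_minimum)
      show "\<rho> \<in> (\<lambda>t. norm (t *\<^sub>R L (T u) + (1 - t) *\<^sub>R L (T v))) ` {0..1}"
        using s lin[of s] by (intro image_eqI[of _ _ s]) auto
      show "\<rho> \<le> r" if "r \<in> (\<lambda>t. norm (t *\<^sub>R L (T u) + (1 - t) *\<^sub>R L (T v))) ` {0..1}" for r
        using that ge lin by auto
    qed
    then have "norm (L (T u) + L (T v)) = 2 * \<rho>" using uv by (intro mid) (simp_all add: N_def)
    then show "N (T (u + v)) = 2 * \<rho>" by (simp add: N_def T_add L_add)
  qed (fact rho)+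
  \<comment> \<open>The coefficients of
    \<open>((wedge z q)\<^sup>2 + (wedge p z)\<^sup>2) / W\<^sup>2\<close>, the squared Euclidean
    length of the coordinates of \<open>z\<close> in the basis \<open>p\<close>,
    \<open>q\<close>.\<close>
  define A where "A = ((Im q)\<^sup>2 + (Im p)\<^sup>2) / W\<^sup>2"
  define B where "B = - (Im q * Re q + Im p * Re p) / W\<^sup>2"
  define C where "C = ((Re q)\<^sup>2 + (Re p)\<^sup>2) / W\<^sup>2"
  have "(norm (a *\<^sub>R x + b *\<^sub>R y))\<^sup>2 = A * a\<^sup>2 + 2 * B * a * b + C * b\<^sup>2" for a b
  proof -
    define z where "z = Complex a b"
    define z' where "z' = Complex (wedge z q / W) (wedge p z / W)"
    have "T z' = z" using wedge_expand[of p q z] W by (simp add: T_def z'_def W_def)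
    then have "norm (a *\<^sub>R x + b *\<^sub>R y) = N (T z')" by (simp add: N_def L_def z_def)
    also have "\<dots> = cmod z'" by (rule N_eq_cmod)
    finally have "(norm (a *\<^sub>R x + b *\<^sub>R y))\<^sup>2 = ((wedge z q)\<^sup>2 + (wedge p z)\<^sup>2) / W\<^sup>2"
      by (simp add: cmod_power2 z'_def power_divide add_divide_distrib)
    also have "(wedge z q)\<^sup>2 + (wedge p z)\<^sup>2 =
        ((Im q)\<^sup>2 + (Im p)\<^sup>2) * a\<^sup>2 + 2 * (- (Im q * Re q + Im p * Re p)) * a * b + ((Re q)\<^sup>2 + (Re p)\<^sup>2) * b\<^sup>2"
      by (simp add: wedge_def z_def power2_eq_square algebra_simps)
    finally show ?thesis by (simp add: A_def B_def C_def divide_inverse algebra_simps)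
  qed
  then show ?thesis by blast
qed

lemma norm_quadratic_on_planes:
  fixes x y :: "'a::real_normed_vector"
  assumes rho: "0 < \<rho>" "\<rho> < 1"
    and mid: "\<And>u v :: 'a. norm u = 1 \<Longrightarrow> norm v = 1 \<Longrightarrow>
      (INF t\<in>{0..1::real}. norm (t *\<^sub>R u + (1 - t) *\<^sub>R v)) = \<rho> \<Longrightarrow> norm (u + v) = 2 * \<rho>"
  shows "\<exists>A B C. \<forall>a b. (norm (a *\<^sub>R x + b *\<^sub>R y))\<^sup>2 = A * a\<^sup>2 + 2 * B * a * b + C * b\<^sup>2"
proof (cases "\<exists>w :: 'a. \<exists>c d. x = c *\<^sub>R w \<and> y = d *\<^sub>R w")
  case True
  then obtain w :: 'a and c d where w: "x = c *\<^sub>R w" "y = d *\<^sub>R w" by blast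
  have "(norm (a *\<^sub>R x + b *\<^sub>R y))\<^sup>2 =
      (c\<^sup>2 * (norm w)\<^sup>2) * a\<^sup>2 + 2 * (c * d * (norm w)\<^sup>2) * a * b + (d\<^sup>2 * (norm w)\<^sup>2) * b\<^sup>2" for a b
  proof -
    have "a *\<^sub>R x + b *\<^sub>R y = (a * c + b * d) *\<^sub>R w" by (simp add: w algebra_simps)
    then have "(norm (a *\<^sub>R x + b *\<^sub>R y))\<^sup>2 = (a * c + b * d)\<^sup>2 * (norm w)\<^sup>2"
      by (simp add: power_mult_distrib)
    then show ?thesis by (simp add: power2_eq_square algebra_simps)
  qed
  then show ?thesis by blast
next
  case False
  have indep: "a = 0 \<and> b = 0" if ab: "a *\<^sub>R x + b *\<^sub>R y = 0" for a b
  proof (rule ccontr)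
    assume "\<not> (a = 0 \<and> b = 0)"
    then consider "a \<noteq> 0" | "b \<noteq> 0" by blast
    then have "\<exists>w :: 'a. \<exists>c d. x = c *\<^sub>R w \<and> y = d *\<^sub>R w"
    proof cases
      case 1
      have "a *\<^sub>R x = - (b *\<^sub>R y)" using ab by (simp add: eq_neg_iff_add_eq_0)
      then have "(1 / a) *\<^sub>R (a *\<^sub>R x) = (1 / a) *\<^sub>R (- (b *\<^sub>R y))" by simp
      then have "x = (- b / a) *\<^sub>R y" "y = 1 *\<^sub>R y" using 1 by simp_all
      then show ?thesis by blast
    next
      case 2
      have "b *\<^sub>R y = - (a *\<^sub>R x)" using ab by (simp add: eq_neg_iff_add_eq_0 add.commute)
      then have "(1 / b) *\<^sub>R (b *\<^sub>R y) = (1 / b) *\<^sub>R (- (a *\<^sub>R x))" by simp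
      then have "y = (- a / b) *\<^sub>R x" "x = 1 *\<^sub>R x" using 2 by simp_all
      then show ?thesis by blast
    qed
    then show False using False by blast
  qed
  show ?thesis
  proof (rule norm_quadratic_on_independent[OF rho])
    show "norm (u + v) = 2 * \<rho>" if "norm u = 1" "norm v = 1"
      "(INF t\<in>{0..1::real}. norm (t *\<^sub>R u + (1 - t) *\<^sub>R v)) = \<rho>" for u v :: 'a
      by (rule mid[OF that])
    show "a = 0 \<and> b = 0" if "a *\<^sub>R x + b *\<^sub>R y = 0" for a b by (rule indep[OF that])
  qed
qed

text \<open>Jordan and von Neumann's polarisation argument; the quadratic expression on each plane
  yields homogeneity for real factors directly, so that only additivity has to be drawn from the
  parallelogram law.\<close>

lemma induced_by_inner_product_if_quadratic_on_planes:
  assumes quad: "\<And>x y :: 'a::real_normed_vector.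
    \<exists>A B C. \<forall>a b. (norm (a *\<^sub>R x + b *\<^sub>R y))\<^sup>2 = A * a\<^sup>2 + 2 * B * a * b + C * b\<^sup>2"
  shows "induced_by_inner_product (norm :: 'a \<Rightarrow> real)"
proof -
  define ip where "ip = (\<lambda>x y :: 'a. ((norm (x + y))\<^sup>2 - (norm (x - y))\<^sup>2) / 4)"
  have par: "(norm (x + y))\<^sup>2 + (norm (x - y))\<^sup>2 = 2 * (norm x)\<^sup>2 + 2 * (norm y)\<^sup>2"
    and scale: "ip (r *\<^sub>R x) y = r * ip x y" for x y :: 'a and r
  proof -
    obtain A B C where q: "\<And>a b. (norm (a *\<^sub>R x + b *\<^sub>R y))\<^sup>2 = A * a\<^sup>2 + 2 * B * a * b + C * b\<^sup>2"
      using quad[of x y] by blast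
    show "(norm (x + y))\<^sup>2 + (norm (x - y))\<^sup>2 = 2 * (norm x)\<^sup>2 + 2 * (norm y)\<^sup>2"
      using q[of 1 1] q[of 1 "- 1"] q[of 1 0] q[of 0 1] by simp
    show "ip (r *\<^sub>R x) y = r * ip x y"
    proof -
      have "(norm (x + y))\<^sup>2 = A + 2 * B + C" "(norm (x - y))\<^sup>2 = A - 2 * B + C"
        "(norm (r *\<^sub>R x + y))\<^sup>2 = A * r\<^sup>2 + 2 * B * r + C"
        "(norm (r *\<^sub>R x - y))\<^sup>2 = A * r\<^sup>2 - 2 * B * r + C"
        using q[of 1 1] q[of 1 "- 1"] q[of r 1] q[of r "- 1"] by simp_all
      then show ?thesis by (simp add: ip_def)
    qed
  qed
  have sym: "ip x y = ip y x" for x y by (simp add: ip_def add.commute norm_minus_commute)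
  \<comment> \<open>The parallelogram laws for \<open>x + y\<close> and \<open>x - y\<close>, each
    with \<open>x'\<close>, are subtracted.\<close>
  have jensen: "ip (x + x') y + ip (x - x') y = 2 * ip x y" for x x' y
  proof -
    have "(x + y) + x' = (x + x') + y" "(x + y) - x' = (x - x') + y"
      "(x - y) + x' = (x + x') - y" "(x - y) - x' = (x - x') - y" by simp_all
    then show ?thesis using par[of "x + y" x'] par[of "x - y" x'] by (simp add: ip_def field_simps)
  qed
  have add: "ip (x + x') y = ip x y + ip x' y" for x x' y
  proof -
    have "(1/2) *\<^sub>R (x + x') + (1/2) *\<^sub>R (x - x') = x" "(1/2) *\<^sub>R (x + x') - (1/2) *\<^sub>R (x - x') = x'"
      by (simp_all add: algebra_simps flip: scaleR_add_left)
    then have "ip x y + ip x' y = 2 * ip ((1/2) *\<^sub>R (x + x')) y"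
      using jensen[of "(1/2) *\<^sub>R (x + x')" "(1/2) *\<^sub>R (x - x')" y] by simp
    then show ?thesis by (simp only: scale)
  qed
  have self: "ip x x = (norm x)\<^sup>2" for x
  proof -
    have "norm (x + x) = 2 * norm x" by (simp flip: scaleR_2)
    then show ?thesis by (simp add: ip_def power_mult_distrib)
  qed
  have "linear (\<lambda>x. ip x y)" for y by (rule linearI) (simp_all add: add scale)
  moreover have "linear (\<lambda>y. ip x y)" for x
    using \<open>\<And>y. linear (\<lambda>x. ip x y)\<close>[of x] unfolding sym[of x] .
  ultimately have "inner_product ip"
    unfolding inner_product_def bilinear_def using sym self by simp
  moreover have "norm x = sqrt (ip x x)" for x by (simp add: self)
  ultimately show ?thesis unfolding induced_by_inner_product_def by blast
qed

text \<open>The squared norm along the segment is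
  \<open>(1 + g) / 2 + 2 * (1 - g) * (t - 1/2)\<^sup>2\<close>, and
  \<open>g \<le> 1\<close>.\<close>

lemma inner_product_midpoint_nearest:
  fixes u v :: "'a::real_normed_vector"
  assumes "induced_by_inner_product (norm :: 'a \<Rightarrow> real)" and u: "norm u = 1" and v: "norm v = 1"
  shows "(INF t\<in>{0..1::real}. norm (t *\<^sub>R u + (1 - t) *\<^sub>R v)) = norm ((1/2) *\<^sub>R u + (1/2) *\<^sub>R v)"
proof -
  obtain ip where ip: "inner_product ip" and n: "\<And>x :: 'a. norm x = sqrt (ip x x)"
    using assms(1) unfolding induced_by_inner_product_def by blast
  have bil: "bilinear ip" and sym: "\<And>x y. ip x y = ip y x"
    using ip by (auto simp: inner_product_def)
  have nonneg: "0 \<le> ip x x" for x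
    using ip bilinear_lzero[OF bil, of 0] by (cases "x = 0") (auto simp: inner_product_def less_imp_le)
  have sq: "(norm x)\<^sup>2 = ip x x" for x using nonneg by (simp add: n)
  note lin = bilinear_ladd[OF bil] bilinear_radd[OF bil] bilinear_lmul[OF bil] bilinear_rmul[OF bil]
    bilinear_lsub[OF bil] bilinear_rsub[OF bil]
  define g where "g = ip u v"
  have uv: "ip u u = 1" "ip v v = 1" "ip v u = g" "ip u v = g"
    using sq[of u] sq[of v] u v sym by (auto simp: g_def)
  have form: "(norm (t *\<^sub>R u + (1 - t) *\<^sub>R v))\<^sup>2 = t\<^sup>2 + (1 - t)\<^sup>2 + 2 * t * (1 - t) * g" for t
    unfolding sq by (simp add: lin uv power2_eq_square algebra_simps)
  have "0 \<le> ip (u - v) (u - v)" by (rule nonneg)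
  then have "g \<le> 1" by (simp add: lin uv)
  have le: "norm ((1/2) *\<^sub>R u + (1/2) *\<^sub>R v) \<le> norm (t *\<^sub>R u + (1 - t) *\<^sub>R v)" for t
  proof (rule power2_le_imp_le)
    have "0 \<le> 2 * (1 - g) * (t - 1/2)\<^sup>2" using \<open>g \<le> 1\<close> by simp
    then show "(norm ((1/2) *\<^sub>R u + (1/2) *\<^sub>R v))\<^sup>2 \<le> (norm (t *\<^sub>R u + (1 - t) *\<^sub>R v))\<^sup>2"
      using form[of "1/2"] form[of t] by (simp add: power2_eq_square algebra_simps)
  qed simp
  show ?thesis
  proof (rule cInf_eq_minimum)
    show "norm ((1/2) *\<^sub>R u + (1/2) *\<^sub>R v) \<in> (\<lambda>t. norm (t *\<^sub>R u + (1 - t) *\<^sub>R v)) ` {0..1}"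
      by (rule image_eqI[of _ _ "1/2"]) simp_all
  qed (use le in auto)
qed

text \<open>The member with \<open>m = k = 1\<close>, from
  \<open>cos (2 * pi / 3) = - 1 / 2\<close>.\<close>

lemma half_in_M: "1 / 2 \<in> M"
proof -
  have "sqrt (1 / 2 * (1 + cos (2 * real 1 * pi / (2 * real 1 + 1)))) = 1 / 2"
    by (rule real_sqrt_unique) (simp_all add: cos_120 power2_eq_square)
  then show ?thesis unfolding M_def by (intro CollectI conjI exI[of _ "1::nat"]) simp_all
qed

theorem theorem11:
  "induced_by_inner_product (norm :: 'a::real_normed_vector \<Rightarrow> real) \<longleftrightarrow>
     (\<exists>\<rho>\<in>M. \<forall>u\<in>sphere (0::'a) 1. \<forall>v\<in>sphere (0::'a) 1.
        (INF t\<in>{0..1::real}. norm (t *\<^sub>R u + (1 - t) *\<^sub>R v)) = \<rho> \<longrightarrow>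
        (1 / 2) *\<^sub>R u + (1 / 2) *\<^sub>R v \<in> (\<lambda>x. \<rho> *\<^sub>R x) ` sphere 0 1)"
proof
  assume ips: "induced_by_inner_product (norm :: 'a \<Rightarrow> real)"
  show "\<exists>\<rho>\<in>M. \<forall>u\<in>sphere (0::'a) 1. \<forall>v\<in>sphere (0::'a) 1.
        (INF t\<in>{0..1::real}. norm (t *\<^sub>R u + (1 - t) *\<^sub>R v)) = \<rho> \<longrightarrow>
        (1 / 2) *\<^sub>R u + (1 / 2) *\<^sub>R v \<in> (\<lambda>x. \<rho> *\<^sub>R x) ` sphere 0 1"
  proof (intro bexI[OF _ half_in_M] ballI impI)
    fix u v :: 'a
    assume "u \<in> sphere 0 1" "v \<in> sphere 0 1"
      and "(INF t\<in>{0..1::real}. norm (t *\<^sub>R u + (1 - t) *\<^sub>R v)) = 1 / 2"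
    then have "norm ((1 / 2) *\<^sub>R u + (1 / 2) *\<^sub>R v) = 1 / 2"
      using inner_product_midpoint_nearest[OF ips, of u v] by simp
    then show "(1 / 2) *\<^sub>R u + (1 / 2) *\<^sub>R v \<in> (\<lambda>x. (1 / 2) *\<^sub>R x) ` sphere 0 1"
      by (intro image_eqI[of _ _ "2 *\<^sub>R ((1 / 2) *\<^sub>R u + (1 / 2) *\<^sub>R v)"]) simp_all
  qed
next
  assume "\<exists>\<rho>\<in>M. \<forall>u\<in>sphere (0::'a) 1. \<forall>v\<in>sphere (0::'a) 1.
        (INF t\<in>{0..1::real}. norm (t *\<^sub>R u + (1 - t) *\<^sub>R v)) = \<rho> \<longrightarrow>
        (1 / 2) *\<^sub>R u + (1 / 2) *\<^sub>R v \<in> (\<lambda>x. \<rho> *\<^sub>R x) ` sphere 0 1"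
  then obtain \<rho> where rho_M: "\<rho> \<in> M" and near: "\<And>u v :: 'a. u \<in> sphere 0 1 \<Longrightarrow> v \<in> sphere 0 1 \<Longrightarrow>
        (INF t\<in>{0..1::real}. norm (t *\<^sub>R u + (1 - t) *\<^sub>R v)) = \<rho> \<Longrightarrow>
        (1 / 2) *\<^sub>R u + (1 / 2) *\<^sub>R v \<in> (\<lambda>x. \<rho> *\<^sub>R x) ` sphere 0 1"
    by blast
  have rho: "0 < \<rho>" "\<rho> < 1" using rho_M by (auto simp: M_def)
  have mid: "norm (u + v) = 2 * \<rho>" if uv: "norm u = 1" "norm v = 1"
    "(INF t\<in>{0..1::real}. norm (t *\<^sub>R u + (1 - t) *\<^sub>R v)) = \<rho>" for u v :: 'a
  proof -
    have "(1 / 2) *\<^sub>R u + (1 / 2) *\<^sub>R v \<in> (\<lambda>x. \<rho> *\<^sub>R x) ` sphere 0 1"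
      by (rule near) (use uv in simp_all)
    then obtain s where s: "(1 / 2) *\<^sub>R u + (1 / 2) *\<^sub>R v = \<rho> *\<^sub>R s" "s \<in> sphere 0 1" by (rule imageE)
    then have "norm ((1 / 2) *\<^sub>R (u + v)) = \<rho>" using rho by (simp add: scaleR_add_right)
    then show ?thesis by simp
  qed
  show "induced_by_inner_product (norm :: 'a \<Rightarrow> real)"
  proof (rule induced_by_inner_product_if_quadratic_on_planes)
    show "\<exists>A B C. \<forall>a b. (norm (a *\<^sub>R x + b *\<^sub>R y))\<^sup>2 = A * a\<^sup>2 + 2 * B * a * b + C * b\<^sup>2" for x y :: 'a
    proof (rule norm_quadratic_on_planes[OF rho])
      show "norm (u + v) = 2 * \<rho>" if "norm u = 1" "norm v = 1"
        "(INF t\<in>{0..1::real}. norm (t *\<^sub>R u + (1 - t) *\<^sub>R v)) = \<rho>" for u v :: 'a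
        by (rule mid[OF that])
    qed
  qed
qed

end
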